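(* Let $p,r\in L_2(0,1)$ be real-valued and let $A$, $B$ and $T(\lambda)=\lambda^2I-\lambda B-A$ be the operators and the operator pencil associated with $p$ and $r$ as described in the context. Assume that $0\notin\sigma(T)$, i.e. that $A$ is boundedly invertible. Let $\kappa$ be the number of negative eigenvalues of the operator $A$. Then (i) the spectrum of the operator pencil $T$ is real with possible exception of at most $\kappa$ pairs of complex-conjugate eigenvalues $\lambda$ and $\overline{\lambda}$; (ii) the algebraic multiplicity of every eigenvalue of $T$ does not exceed $2\kappa+1$. If the operator $A$ is positive, then the spectrum of the operator pencil $T$ is real and simple.
   Context: For an absolutely continuous function $y$ on $[0,1]$ put $y^{[1]}:=y'-ry$. Define $\ell(y)=-\bigl(y^{[1]}\bigr)'-r y^{[1]}-r^2y$ on $\operatorname{dom}\ell=\{y\in AC[0,1]\mid y^{[1]}\in AC[0,1],\ \ell(y)\in L_2(0,1)\}$ (so $\ell(y)=-y''+qy$ with $q=r'\in W_2^{-1}(0,1)$ in the distributional sense). The operator $A$ in $L_2(0,1)$ acts by $Ay=\ell(y)$ on $\operatorname{dom}A=\{y\in\operatorname{dom}\ell\mid y(0)=y(1)=0\}$; it is known to be self-adjoint, bounded below, with simple discrete spectrum (so it has finitely many negative eigenvalues). $B$ is the operator of multiplication by $2p$ in $L_2(0,1)$ (one has $\operatorname{dom}A\subset\operatorname{dom}B$). The pencil $T(\lambda)=\lambda^2I-\lambda B-A$, $\lambda\in\mathbb{C}$, is defined on $\operatorname{dom}T=\operatorname{dom}A$. $\sigma(T)=\{\lambda\in\mathbb{C}\mid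 0\in\sigma(T(\lambda))\}$; $\lambda$ is an eigenvalue of $T$ if $T(\lambda)y_0=0$ for some nonzero $y_0\in\operatorname{dom}T$ (an eigenvector). Vectors $y_1,\dots,y_{m-1}\in\operatorname{dom}T$ are associated with $y_0$ if $\sum_{k=0}^{j}\frac1{k!}T^{(k)}(\lambda)y_{j-k}=0$ for $j=1,\dots,m-1$, where $T^{(k)}$ is the $k$-th derivative in $\lambda$; then $y_0,\dots,y_{m-1}$ is a chain of length $m$. All eigenvalues of $T$ are geometrically simple ($\dim\ker T(\lambda)=1$), and the algebraic multiplicity of an eigenvalue is the maximal length of a chain starting with a corresponding eigenvector. The spectrum is called simple if it consists of eigenvalues of algebraic multiplicity one. *)

theory Defs
  imports "HOL-Analysis.Analysis"
begin

section \<open>The Hilbert space \<open>L\<^sub>2(0,1)\<close>\<close>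

text \<open>
  Elements of \<open>L\<^sub>2(0,1)\<close> are represented by functions on the whole real line whose values outside
  \<open>[0,1]\<close> are irrelevant; equality in \<open>L\<^sub>2(0,1)\<close> is the relation \<open>ae_eq\<close>.
\<close>

abbreviation leb01 :: "real measure" where
  "leb01 \<equiv> lebesgue_on {0..1}"

definition L2 :: "(real \<Rightarrow> 'a::{real_normed_vector, second_countable_topology}) set" where
  "L2 = {f \<in> borel_measurable leb01. integrable leb01 (\<lambda>x. (norm (f x))\<^sup>2)}"

definition ae_eq :: "(real \<Rightarrow> 'a) \<Rightarrow> (real \<Rightarrow> 'a) \<Rightarrow> bool" (infix "=\<^sub>a\<^sub>e" 50) where
  "f =\<^sub>a\<^sub>e g \<longleftrightarrow> (AE x in leb01. f x = g x)"

definition L2_inner :: "(real \<Rightarrow> complex) \<Rightarrow> (real \<Rightarrow> complex) \<Rightarrow> complex" where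
  "L2_inner f g = (LINT x|leb01. f x * cnj (g x))"

definition L2_norm :: "(real \<Rightarrow> complex) \<Rightarrow> real" where
  "L2_norm f = sqrt (LINT x|leb01. (norm (f x))\<^sup>2)"

section \<open>Unbounded linear operators in \<open>L\<^sub>2(0,1)\<close>\<close>

text \<open>
  An operator is given by its domain \<open>D\<close> and its action \<open>S\<close>.  Linearity of \<open>D\<close> and \<open>S\<close> is not
  part of the definitions; it holds for all operators they are applied to.
\<close>

definition boundedly_invertible ::
    "(real \<Rightarrow> complex) set \<Rightarrow> ((real \<Rightarrow> complex) \<Rightarrow> real \<Rightarrow> complex) \<Rightarrow> bool" where
  "boundedly_invertible D S \<longleftrightarrow>
     (\<forall>f\<in>L2. \<exists>y\<in>D. S y =\<^sub>a\<^sub>e f \<and> (\<forall>z\<in>D. S z =\<^sub>a\<^sub>e f \<longrightarrow> z =\<^sub>a\<^sub>e y)) \<and>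
     (\<exists>C. \<forall>y\<in>D. L2_norm y \<le> C * L2_norm (S y))"

definition op_spectrum ::
    "(real \<Rightarrow> complex) set \<Rightarrow> ((real \<Rightarrow> complex) \<Rightarrow> real \<Rightarrow> complex) \<Rightarrow> complex set" where
  "op_spectrum D S = {\<mu>. \<not> boundedly_invertible D (\<lambda>y x. S y x - \<mu> * y x)}"

definition op_eigenvalue ::
    "(real \<Rightarrow> complex) set \<Rightarrow> ((real \<Rightarrow> complex) \<Rightarrow> real \<Rightarrow> complex) \<Rightarrow> complex \<Rightarrow> bool" where
  "op_eigenvalue D S \<mu> \<longleftrightarrow> (\<exists>y\<in>D. \<not> y =\<^sub>a\<^sub>e (\<lambda>_. 0) \<and> S y =\<^sub>a\<^sub>e (\<lambda>x. \<mu> * y x))"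

definition op_positive ::
    "(real \<Rightarrow> complex) set \<Rightarrow> ((real \<Rightarrow> complex) \<Rightarrow> real \<Rightarrow> complex) \<Rightarrow> bool" where
  "op_positive D S \<longleftrightarrow>
     (\<forall>y\<in>D. \<not> y =\<^sub>a\<^sub>e (\<lambda>_. 0) \<longrightarrow> L2_inner (S y) y \<in> \<real> \<and> 0 < Re (L2_inner (S y) y))"

section \<open>The differential expression \<open>\<ell>\<close> and the operator \<open>A\<close>\<close>

definition AC01 :: "(real \<Rightarrow> complex) set" where
  "AC01 = {f. \<forall>\<epsilon>>0. \<exists>\<delta>>0. \<forall>(n::nat) (a::nat \<Rightarrow> real) b.
     (\<forall>i<n. 0 \<le> a i \<and> a i \<le> b i \<and> b i \<le> 1) \<longrightarrow>
     disjoint_family_on (\<lambda>i. {a i<..<b i}) {..<n} \<longrightarrow>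
     (\<Sum>i<n. b i - a i) < \<delta> \<longrightarrow>
     (\<Sum>i<n. norm (f (b i) - f (a i))) < \<epsilon>}"

text \<open>
  The derivative \<open>y'\<close> of an absolutely continuous function exists only almost everywhere, so
  \<open>y\<^sup>[\<^sup>1\<^sup>] = y' - r y\<close> is determined almost everywhere.  The condition \<open>y\<^sup>[\<^sup>1\<^sup>] \<in> AC[0,1]\<close> means that
  it agrees almost everywhere with an absolutely continuous function, which is then unique on
  \<open>[0,1]\<close> and is used wherever \<open>y\<^sup>[\<^sup>1\<^sup>]\<close> is differentiated.
\<close>

definition has_AC_rep :: "(real \<Rightarrow> complex) \<Rightarrow> bool" where
  "has_AC_rep f \<longleftrightarrow> (\<exists>u\<in>AC01. u =\<^sub>a\<^sub>e f)"

definition AC_rep :: "(real \<Rightarrow> complex) \<Rightarrow> real \<Rightarrow> complex" where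
  "AC_rep f = (SOME u. u \<in> AC01 \<and> u =\<^sub>a\<^sub>e f)"

definition pre_quasi_deriv :: "(real \<Rightarrow> real) \<Rightarrow> (real \<Rightarrow> complex) \<Rightarrow> real \<Rightarrow> complex" where
  "pre_quasi_deriv r y = (\<lambda>x. vector_derivative y (at x) - of_real (r x) * y x)"

definition quasi_deriv :: "(real \<Rightarrow> real) \<Rightarrow> (real \<Rightarrow> complex) \<Rightarrow> real \<Rightarrow> complex" where
  "quasi_deriv r y = AC_rep (pre_quasi_deriv r y)"

definition ell :: "(real \<Rightarrow> real) \<Rightarrow> (real \<Rightarrow> complex) \<Rightarrow> real \<Rightarrow> complex" where
  "ell r y = (\<lambda>x. - vector_derivative (quasi_deriv r y) (at x)
                  - of_real (r x) * quasi_deriv r y x - (of_real (r x))\<^sup>2 * y x)"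

definition dom_ell :: "(real \<Rightarrow> real) \<Rightarrow> (real \<Rightarrow> complex) set" where
  "dom_ell r = {y \<in> AC01. has_AC_rep (pre_quasi_deriv r y) \<and> ell r y \<in> L2}"

definition dom_A :: "(real \<Rightarrow> real) \<Rightarrow> (real \<Rightarrow> complex) set" where
  "dom_A r = {y \<in> dom_ell r. y 0 = 0 \<and> y 1 = 0}"

definition op_A :: "(real \<Rightarrow> real) \<Rightarrow> (real \<Rightarrow> complex) \<Rightarrow> real \<Rightarrow> complex" where
  "op_A r y = ell r y"

text \<open>
  The number of negative eigenvalues of \<open>A\<close>.  The set below is finite, because \<open>A\<close> is bounded below
  with discrete spectrum, so \<open>card\<close> does not fall into its default value for infinite sets; and as
  the eigenvalues of \<open>A\<close> are simple, counting them with multiplicity gives the same number.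
\<close>

definition num_neg_eigenvalues :: "(real \<Rightarrow> real) \<Rightarrow> nat" where
  "num_neg_eigenvalues r = card {\<mu>::real. \<mu> < 0 \<and> op_eigenvalue (dom_A r) (op_A r) (of_real \<mu>)}"

section \<open>The operator pencil \<open>T(\<zeta>) = \<zeta>\<^sup>2 I - \<zeta> B - A\<close>\<close>

definition op_B :: "(real \<Rightarrow> real) \<Rightarrow> (real \<Rightarrow> complex) \<Rightarrow> real \<Rightarrow> complex" where
  "op_B p y = (\<lambda>x. 2 * of_real (p x) * y x)"

definition pencil ::
    "(real \<Rightarrow> real) \<Rightarrow> (real \<Rightarrow> real) \<Rightarrow> complex \<Rightarrow> (real \<Rightarrow> complex) \<Rightarrow> real \<Rightarrow> complex" where
  "pencil p r \<zeta> y = (\<lambda>x. \<zeta>\<^sup>2 * y x - \<zeta> * op_B p y x - op_A r y x)"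

definition pencil_spectrum :: "(real \<Rightarrow> real) \<Rightarrow> (real \<Rightarrow> real) \<Rightarrow> complex set" where
  "pencil_spectrum p r = {\<zeta>. 0 \<in> op_spectrum (dom_A r) (pencil p r \<zeta>)}"

definition pencil_eigenvector ::
    "(real \<Rightarrow> real) \<Rightarrow> (real \<Rightarrow> real) \<Rightarrow> complex \<Rightarrow> (real \<Rightarrow> complex) \<Rightarrow> bool" where
  "pencil_eigenvector p r \<zeta> y \<longleftrightarrow>
     y \<in> dom_A r \<and> \<not> y =\<^sub>a\<^sub>e (\<lambda>_. 0) \<and> pencil p r \<zeta> y =\<^sub>a\<^sub>e (\<lambda>_. 0)"

definition pencil_eigenvalue :: "(real \<Rightarrow> real) \<Rightarrow> (real \<Rightarrow> real) \<Rightarrow> complex \<Rightarrow> bool" where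
  "pencil_eigenvalue p r \<zeta> \<longleftrightarrow> (\<exists>y. pencil_eigenvector p r \<zeta> y)"

text \<open>The \<open>k\<close>-th derivative in \<open>\<zeta>\<close> of the operator-valued function \<open>T\<close>, taken pointwise.\<close>

definition pencil_deriv ::
    "nat \<Rightarrow> (real \<Rightarrow> real) \<Rightarrow> (real \<Rightarrow> real) \<Rightarrow> complex \<Rightarrow> (real \<Rightarrow> complex) \<Rightarrow> real \<Rightarrow> complex" where
  "pencil_deriv k p r \<zeta> y = (\<lambda>x. (deriv ^^ k) (\<lambda>z. pencil p r z y x) \<zeta>)"

text \<open>\<open>ys 0, \<dots>, ys (m - 1)\<close> is a chain of length \<open>m\<close> at \<open>\<zeta>\<close>; the values \<open>ys i\<close> for \<open>i \<ge> m\<close> play no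
  role.\<close>

definition pencil_chain ::
    "(real \<Rightarrow> real) \<Rightarrow> (real \<Rightarrow> real) \<Rightarrow> complex \<Rightarrow> nat \<Rightarrow> (nat \<Rightarrow> real \<Rightarrow> complex) \<Rightarrow> bool" where
  "pencil_chain p r \<zeta> m ys \<longleftrightarrow>
     1 \<le> m \<and> pencil_eigenvector p r \<zeta> (ys 0) \<and> (\<forall>i<m. ys i \<in> dom_A r) \<and>
     (\<forall>j\<in>{1..<m}. (\<lambda>x. \<Sum>k=0..j. 1 / fact k * pencil_deriv k p r \<zeta> (ys (j - k)) x) =\<^sub>a\<^sub>e (\<lambda>_. 0))"

text \<open>Valued in \<open>enat\<close>, so that arbitrarily long chains would give \<open>\<infinity>\<close>.\<close>

definition alg_mult :: "(real \<Rightarrow> real) \<Rightarrow> (real \<Rightarrow> real) \<Rightarrow> complex \<Rightarrow> enat" where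
  "alg_mult p r \<zeta> = Sup {enat m | m. \<exists>ys. pencil_chain p r \<zeta> m ys}"

definition pencil_spectrum_simple :: "(real \<Rightarrow> real) \<Rightarrow> (real \<Rightarrow> real) \<Rightarrow> bool" where
  "pencil_spectrum_simple p r \<longleftrightarrow>
     (\<forall>\<zeta>\<in>pencil_spectrum p r. pencil_eigenvalue p r \<zeta> \<and> alg_mult p r \<zeta> = 1)"

end

theory Submission
  imports Defs "HOL-Complex_Analysis.Great_Picard"
begin

text \<open>
  With \<open>v = \<zeta> y\<close> the equation \<open>T(\<zeta>) y = 0\<close> becomes the eigenvalue problem for
  \<open>(y, v) \<mapsto> (v, A y + B v)\<close>, which is symmetric for the indefinite form
  \<open>[(y, v), (y', v')] = (A y, y') + (v, v')\<close>.  Eigenvectors for eigenvalues in the open upper half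
  plane are neutral and mutually orthogonal for this form, and so are the first \<open>k\<close> vectors of a
  chain of length \<open>2k\<close>.  On the span of a neutral family \<open>(A y, y) = - (v, v) \<le> 0\<close>, and a subspace of
  \<open>dom A\<close> with this property has dimension at most \<open>\<kappa>\<close>: otherwise it contains a nonzero \<open>y\<close>
  orthogonal to the eigenvectors of \<open>A\<close> for the negative eigenvalues, on whose orthogonal
  complement the form of \<open>A\<close> is positive.  The last fact follows by minimising \<open>(A y, y)\<close> over
  \<open>\<parallel>A y\<parallel> = 1\<close>, using that \<open>A\<^sup>-\<^sup>1\<close> maps bounded sets to equicontinuous ones.

  The domain of \<open>A\<close> is described by the first order system for \<open>(y, y\<^sup>[\<^sup>1\<^sup>])\<close>, which has \<open>L\<^sub>1\<close>
  coefficients; hence the Fredholm alternative reduces to linear algebra for its solutions.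
\<close>

section \<open>Absolutely continuous functions\<close>

text \<open>Why first components suffice: if a combination of the \<open>y j\<close> of a neutral
  family vanishes, its energy is 0, so the same combination of the \<open>v j\<close> vanishes too.
  Subtracting \<zeta> times the first relation from the second gives a shorter relation, and the
  \<open>y j\<close> turn out to be independent. A contradiction needs \<kappa> + 1 mutually neutral
  vectors, which a chain of length 2 \<kappa> + 2 provides; hence the bound 2 \<kappa> + 1.
  Compactness of the inverse does not keep negative eigenvalues of \<open>A\<close> from running off
  to minus infinity, and \<open>card\<close> of an infinite set is 0. A lower bound for them is
  therefore derived from the form. There the coefficient \<open>r\<^sup>2\<close> is only
  integrable, but it cancels once the form is written with y' in place of the quasi-derivative. The
  form is minimised relative to the norm of \<open>A y\<close> and not of \<open>y\<close>: this
  quotient is bounded because the inverse is bounded, and normalised sequences are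
  equicontinuous.\<close>

lemma sum_length_disjoint_le:
  fixes u v :: "'i \<Rightarrow> real"
  assumes "finite I" "a \<le> b" and le: "\<And>i. i \<in> I \<Longrightarrow> a \<le> u i \<and> u i \<le> v i \<and> v i \<le> b"
    and disj: "disjoint_family_on (\<lambda>i. {u i<..<v i}) I"
  shows "(\<Sum>i\<in>I. v i - u i) \<le> b - a"
proof -
  have "(\<Sum>i\<in>I. v i - u i) = (\<Sum>i\<in>I. measure lborel {u i<..<v i})"
    using le by (intro sum.cong) auto
  also have "\<dots> = measure lborel (\<Union>i\<in>I. {u i<..<v i})"
    using disj \<open>finite I\<close> le
    by (intro measure_finite_Union [symmetric]) (auto simp: emeasure_lborel_Ioo)
  also have "\<dots> \<le> measure lborel {a..b}"
  proof (rule measure_mono_fmeasurable)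
    show "(\<Union>i\<in>I. {u i<..<v i}) \<subseteq> {a..b}" using le by fastforce
    show "(\<Union>i\<in>I. {u i<..<v i}) \<in> sets lborel" using \<open>finite I\<close> by auto
    show "{a..b} \<in> fmeasurable lborel" by (simp add: fmeasurable_def emeasure_lborel_Icc_eq)
  qed
  finally show ?thesis using \<open>a \<le> b\<close> by simp
qed

text \<open>Global on the line, because it is applied to the constant extensions of the real and
  imaginary parts of \<open>AC01\<close> functions, whose variation yields distribution functions of
  Stieltjes measures.\<close>

definition abs_cont :: "(real \<Rightarrow> real) \<Rightarrow> bool" where
  "abs_cont f \<longleftrightarrow> (\<forall>\<epsilon>>0. \<exists>\<delta>>0. \<forall>(n::nat) (a::nat \<Rightarrow> real) b.
     (\<forall>i<n. a i \<le> b i) \<longrightarrow> disjoint_family_on (\<lambda>i. {a i<..<b i}) {..<n} \<longrightarrow>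
     (\<Sum>i<n. b i - a i) < \<delta> \<longrightarrow> (\<Sum>i<n. \<bar>f (b i) - f (a i)\<bar>) < \<epsilon>)"

text \<open>Reindexing along a bijection. Later families are indexed by pairs of numbers (in
  \<open>abs_cont_pos_var\<close>) and by the intervals themselves (in
  \<open>null_set_interval_measure\<close>).\<close>

lemma abs_cont_index:
  assumes "abs_cont f" "\<epsilon> > 0"
  obtains \<delta> where "\<delta> > 0"
    "\<And>(I::'i set) a b. finite I \<Longrightarrow> (\<And>i. i \<in> I \<Longrightarrow> a i \<le> b i) \<Longrightarrow>
       disjoint_family_on (\<lambda>i. {a i<..<b i}) I \<Longrightarrow> (\<Sum>i\<in>I. b i - a i) < \<delta> \<Longrightarrow>
       (\<Sum>i\<in>I. \<bar>f (b i) - f (a i)\<bar>) < \<epsilon>"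
proof -
  obtain \<delta> where "\<delta> > 0" and \<delta>: "\<forall>(n::nat) (a::nat \<Rightarrow> real) b.
     (\<forall>i<n. a i \<le> b i) \<longrightarrow> disjoint_family_on (\<lambda>i. {a i<..<b i}) {..<n} \<longrightarrow>
     (\<Sum>i<n. b i - a i) < \<delta> \<longrightarrow> (\<Sum>i<n. \<bar>f (b i) - f (a i)\<bar>) < \<epsilon>"
    using assms(1)[unfolded abs_cont_def, rule_format, OF assms(2)] by auto
  show thesis
  proof
    fix I :: "'i set" and a b
    assume I: "finite I" "\<And>i. i \<in> I \<Longrightarrow> a i \<le> b i"
      "disjoint_family_on (\<lambda>i. {a i<..<b i}) I" "(\<Sum>i\<in>I. b i - a i) < \<delta>"
    obtain h where h: "bij_betw h {..<card I} I"
      using ex_bij_betw_nat_finite [OF I(1)] by (auto simp: atLeast0LessThan)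
    have hI: "h i \<in> I" if "i < card I" for i using h that by (auto simp: bij_betw_def)
    have "(\<Sum>i<card I. \<bar>f (b (h i)) - f (a (h i))\<bar>) < \<epsilon>"
    proof (rule \<delta> [rule_format])
      show "disjoint_family_on (\<lambda>i. {a (h i)<..<b (h i)}) {..<card I}"
        unfolding disjoint_family_on_def
      proof (intro ballI impI)
        fix i j assume "i \<in> {..<card I}" "j \<in> {..<card I}" "i \<noteq> j"
        then have "h i \<in> I" "h j \<in> I" "h i \<noteq> h j"
          using h hI by (auto simp: bij_betw_def inj_on_def)
        with I(3) show "{a (h i)<..<b (h i)} \<inter> {a (h j)<..<b (h j)} = {}"
          unfolding disjoint_family_on_def by blast
      qed
      show "(\<Sum>i<card I. b (h i) - a (h i)) < \<delta>"
        using I(4) sum.reindex_bij_betw [OF h, of "\<lambda>i. b i - a i"] by simp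
    qed (use I hI in auto)
    then show "(\<Sum>i\<in>I. \<bar>f (b i) - f (a i)\<bar>) < \<epsilon>"
      using sum.reindex_bij_betw [OF h, of "\<lambda>i. \<bar>f (b i) - f (a i)\<bar>"] by simp
  qed fact
qed

lemma abs_cont_diff:
  assumes "abs_cont f" "abs_cont g"
  shows "abs_cont (\<lambda>x. f x - g x)"
  unfolding abs_cont_def
proof (intro allI impI)
  fix \<epsilon> :: real assume "\<epsilon> > 0"
  then have "\<epsilon>/2 > 0" by simp
  obtain d1 where d1: "d1 > 0" "\<And>(I::nat set) a b. finite I \<Longrightarrow> (\<And>i. i \<in> I \<Longrightarrow> a i \<le> b i) \<Longrightarrow>
       disjoint_family_on (\<lambda>i. {a i<..<b i}) I \<Longrightarrow> (\<Sum>i\<in>I. b i - a i) < d1 \<Longrightarrow>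
       (\<Sum>i\<in>I. \<bar>f (b i) - f (a i)\<bar>) < \<epsilon>/2"
    by (rule abs_cont_index [OF assms(1) \<open>\<epsilon>/2 > 0\<close>]) blast
  obtain d2 where d2: "d2 > 0" "\<And>(I::nat set) a b. finite I \<Longrightarrow> (\<And>i. i \<in> I \<Longrightarrow> a i \<le> b i) \<Longrightarrow>
       disjoint_family_on (\<lambda>i. {a i<..<b i}) I \<Longrightarrow> (\<Sum>i\<in>I. b i - a i) < d2 \<Longrightarrow>
       (\<Sum>i\<in>I. \<bar>g (b i) - g (a i)\<bar>) < \<epsilon>/2"
    by (rule abs_cont_index [OF assms(2) \<open>\<epsilon>/2 > 0\<close>]) blast
  show "\<exists>\<delta>>0. \<forall>(n::nat) a b. (\<forall>i<n. a i \<le> b i) \<longrightarrow>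
       disjoint_family_on (\<lambda>i. {a i<..<b i}) {..<n} \<longrightarrow> (\<Sum>i<n. b i - a i) < \<delta> \<longrightarrow>
       (\<Sum>i<n. \<bar>f (b i) - g (b i) - (f (a i) - g (a i))\<bar>) < \<epsilon>"
  proof (intro exI [of _ "min d1 d2"] conjI allI impI)
    fix n :: nat and a b :: "nat \<Rightarrow> real"
    assume *: "\<forall>i<n. a i \<le> b i" "disjoint_family_on (\<lambda>i. {a i<..<b i}) {..<n}"
      "(\<Sum>i<n. b i - a i) < min d1 d2"
    have "(\<Sum>i<n. \<bar>f (b i) - g (b i) - (f (a i) - g (a i))\<bar>)
        \<le> (\<Sum>i<n. \<bar>f (b i) - f (a i)\<bar>) + (\<Sum>i<n. \<bar>g (b i) - g (a i)\<bar>)"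
      unfolding sum.distrib [symmetric] by (intro sum_mono) linarith
    also have "\<dots> < \<epsilon>/2 + \<epsilon>/2"
      using * by (intro add_strict_mono d1 d2) auto
    finally show "(\<Sum>i<n. \<bar>f (b i) - g (b i) - (f (a i) - g (a i))\<bar>) < \<epsilon>" by simp
  qed (use d1 d2 in auto)
qed

lemma abs_cont_imp_continuous:
  assumes "abs_cont f"
  shows "continuous_on UNIV f"
  unfolding continuous_on_iff
proof (intro ballI allI impI)
  fix x \<epsilon> :: real assume "\<epsilon> > 0"
  then obtain d where d: "d > 0" "\<And>(I::nat set) a b. finite I \<Longrightarrow> (\<And>i. i \<in> I \<Longrightarrow> a i \<le> b i) \<Longrightarrow>
       disjoint_family_on (\<lambda>i. {a i<..<b i}) I \<Longrightarrow> (\<Sum>i\<in>I. b i - a i) < d \<Longrightarrow>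
       (\<Sum>i\<in>I. \<bar>f (b i) - f (a i)\<bar>) < \<epsilon>"
    by (rule abs_cont_index [OF assms]) blast
  show "\<exists>d>0. \<forall>y\<in>UNIV. dist y x < d \<longrightarrow> dist (f y) (f x) < \<epsilon>"
  proof (intro exI [of _ d] conjI ballI impI d)
    fix y assume "dist y x < d"
    then show "dist (f y) (f x) < \<epsilon>"
      using d(2) [of "{0}" "\<lambda>_. min x y" "\<lambda>_. max x y"]
      by (cases "x \<le> y") (auto simp: dist_real_def disjoint_family_on_def)
  qed
qed

section \<open>Positive variation of an absolutely continuous function\<close>

definition interval_fam :: "real \<Rightarrow> nat \<Rightarrow> (nat \<Rightarrow> real) \<Rightarrow> (nat \<Rightarrow> real) \<Rightarrow> bool" where
  "interval_fam x n u v \<longleftrightarrow>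
     (\<forall>i<n. u i \<le> v i \<and> v i \<le> x) \<and> disjoint_family_on (\<lambda>i. {u i<..<v i}) {..<n}"

text \<open>The families need not cover the half-line, so the supremum is the positive variation.\<close>

definition pos_var :: "(real \<Rightarrow> real) \<Rightarrow> real \<Rightarrow> real" where
  "pos_var f x = Sup {(\<Sum>i<n. f (v i) - f (u i)) | n u v. interval_fam x n u v}"

lemma disjoint_family_on_sub:
  assumes "disjoint_family_on A I" "\<And>i. i \<in> I \<Longrightarrow> B i \<subseteq> A i"
  shows "disjoint_family_on B I"
  using assms unfolding disjoint_family_on_def by fast

text \<open>Clamping shrinks an open interval or makes it empty, so disjointness survives; the same
  holds for \<open>max\<close> below.\<close>

lemma interval_fam_min:
  "interval_fam y n u v \<Longrightarrow> interval_fam x n (\<lambda>i. min (u i) x) (\<lambda>i. min (v i) x)"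
  unfolding interval_fam_def
  by (auto simp: min_le_iff_disj elim!: disjoint_family_on_sub)

lemma interval_fam_max:
  "interval_fam y n u v \<Longrightarrow> x \<le> y \<Longrightarrow> interval_fam y n (\<lambda>i. max (u i) x) (\<lambda>i. max (v i) x)"
  unfolding interval_fam_def
  by (auto simp: le_max_iff_disj elim!: disjoint_family_on_sub)

text \<open>Cutting at \<open>x\<close> is exact for every single interval: if it lies on one side
  of \<open>x\<close>, one of the two differences is 0; otherwise the two telescope through
  \<open>f x\<close>.\<close>

lemma sum_split_at:
  fixes f :: "real \<Rightarrow> real"
  shows "(\<Sum>i<n. f (v i) - f (u i)) =
    (\<Sum>i<n. f (min (v i) x) - f (min (u i) x)) + (\<Sum>i<n. f (max (v i) x) - f (max (u i) x))"
  unfolding sum.distrib [symmetric] by (intro sum.cong) (auto simp: min_def max_def)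

context
  fixes f :: "real \<Rightarrow> real"
  assumes ac: "abs_cont f" and const: "\<And>x. x \<le> 0 \<Longrightarrow> f x = f 0"
begin

text \<open>Makes the supremum in \<open>pos_var\<close> a real bound. Nothing is gained below 0,
  where \<open>f\<close> is constant; above 0 the half-line is cut into strips of length
  \<open>d/2\<close>, where \<open>d\<close> belongs to \<epsilon> = 1, so each strip adds less than
  1.\<close>

lemma interval_fam_bounded:
  obtains K where "\<And>n u v. interval_fam x n u v \<Longrightarrow> (\<Sum>i<n. f (v i) - f (u i)) \<le> K"
proof -
  obtain d where d: "d > 0" "\<And>(I::nat set) a b. finite I \<Longrightarrow> (\<And>i. i \<in> I \<Longrightarrow> a i \<le> b i) \<Longrightarrow>
       disjoint_family_on (\<lambda>i. {a i<..<b i}) I \<Longrightarrow> (\<Sum>i\<in>I. b i - a i) < d \<Longrightarrow>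
       (\<Sum>i\<in>I. \<bar>f (b i) - f (a i)\<bar>) < 1"
    by (rule abs_cont_index [OF ac zero_less_one]) blast
  have *: "interval_fam (real k * (d/2)) n u v \<Longrightarrow> (\<Sum>i<n. f (v i) - f (u i)) \<le> real k" for k n u v
  proof (induction k arbitrary: u v)
    case 0
    then have "f (v i) - f (u i) = 0" if "i < n" for i
      using that const [of "u i"] const [of "v i"] by (auto simp: interval_fam_def)
    then show ?case by simp
  next
    case (Suc k)
    let ?x = "real k * (d/2)" and ?y = "real (Suc k) * (d/2)"
    have fam: "interval_fam ?y n (\<lambda>i. max (u i) ?x) (\<lambda>i. max (v i) ?x)"
      using d(1) by (intro interval_fam_max Suc.prems) (auto simp: field_simps)
    have "(\<Sum>i<n. max (v i) ?x - max (u i) ?x) \<le> ?y - ?x"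
      using fam d(1) by (intro sum_length_disjoint_le) (auto simp: interval_fam_def field_simps)
    then have len: "(\<Sum>i<n. max (v i) ?x - max (u i) ?x) < d"
      using d(1) by (simp add: field_simps)
    have "(\<Sum>i<n. f (max (v i) ?x) - f (max (u i) ?x)) \<le> (\<Sum>i<n. \<bar>f (max (v i) ?x) - f (max (u i) ?x)\<bar>)"
      by (intro sum_mono) auto
    also have "\<dots> < 1"
      using fam len by (intro d) (auto simp: interval_fam_def)
    finally show ?case
      using sum_split_at [of f v u n ?x] Suc.IH [OF interval_fam_min [OF Suc.prems]] by simp
  qed
  obtain k :: nat where k: "x \<le> real k * (d/2)"
    using reals_Archimedean2 [of "x / (d/2)"] d(1) by (auto simp: field_simps intro: less_imp_le)
  show thesis
  proof
    fix n u v assume "interval_fam x n u v"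
    then have "interval_fam (real k * (d/2)) n u v"
      using k by (force simp: interval_fam_def)
    then show "(\<Sum>i<n. f (v i) - f (u i)) \<le> real k" by (rule *)
  qed
qed

lemma pos_var_upper: "interval_fam x n u v \<Longrightarrow> (\<Sum>i<n. f (v i) - f (u i)) \<le> pos_var f x"
  unfolding pos_var_def
proof (rule cSup_upper)
  obtain K where "\<And>n u v. interval_fam x n u v \<Longrightarrow> (\<Sum>i<n. f (v i) - f (u i)) \<le> K"
    by (rule interval_fam_bounded [of x]) blast
  then show "bdd_above {(\<Sum>i<n. f (v i) - f (u i)) | n u v. interval_fam x n u v}"
    by (auto simp: bdd_above_def)
qed blast

lemma pos_var_approx:
  assumes "\<eta> > 0"
  obtains n u v where "interval_fam x n u v" "pos_var f x - \<eta> < (\<Sum>i<n. f (v i) - f (u i))"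
proof -
  have "interval_fam x 0 (\<lambda>_. 0) (\<lambda>_. 0)" by (simp add: interval_fam_def disjoint_family_on_def)
  then have ne: "{(\<Sum>i<n. f (v i) - f (u i)) | n u v. interval_fam x n u v} \<noteq> {}" by blast
  have "pos_var f x - \<eta> < Sup {(\<Sum>i<n. f (v i) - f (u i)) | n u v. interval_fam x n u v}"
    using assms by (simp add: pos_var_def)
  from less_cSupD [OF ne this] show thesis using that by auto
qed

text \<open>A family for \<open>x\<close> can be enlarged by the interval from \<open>x\<close> to
  \<open>y\<close>. The maximum with 0 packs two facts into one: both \<open>pos_var f\<close> and
  \<open>pos_var f - f\<close> are increasing.\<close>

lemma pos_var_increment:
  assumes "x \<le> y"
  shows "pos_var f x + max 0 (f y - f x) \<le> pos_var f y"
proof (rule field_le_epsilon)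
  fix \<eta> :: real assume "\<eta> > 0"
  then obtain n u v where *: "interval_fam x n u v" "pos_var f x - \<eta> < (\<Sum>i<n. f (v i) - f (u i))"
    by (rule pos_var_approx) blast
  have fam: "interval_fam y n u v" using * assms by (force simp: interval_fam_def)
  let ?u = "u(n := x)" and ?v = "v(n := y)"
  have "interval_fam y (Suc n) ?u ?v"
    using * assms unfolding interval_fam_def disjoint_family_on_def
    by (fastforce simp: less_Suc_eq)
  from pos_var_upper [OF this] pos_var_upper [OF fam]
  show "pos_var f x + max 0 (f y - f x) \<le> pos_var f y + \<eta>" using *(2) by auto
qed

text \<open>The parts of a nearly optimal family below \<open>x\<close> contribute at most
  \<open>pos_var f x\<close>, so the parts above \<open>x\<close> must carry the increment.\<close>

lemma pos_var_increment_approx: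
  assumes "x \<le> y" "\<eta> > 0"
  obtains n u v where "interval_fam y n u v" "\<And>i. i < n \<Longrightarrow> x \<le> u i"
    "pos_var f y - pos_var f x - \<eta> < (\<Sum>i<n. f (v i) - f (u i))"
proof -
  obtain n u v where *: "interval_fam y n u v" "pos_var f y - \<eta> < (\<Sum>i<n. f (v i) - f (u i))"
    by (rule pos_var_approx [OF assms(2)]) blast
  have "(\<Sum>i<n. f (min (v i) x) - f (min (u i) x)) \<le> pos_var f x"
    by (rule pos_var_upper [OF interval_fam_min [OF *(1)]])
  then show thesis
    using *(2) sum_split_at [of f v u n x]
    by (intro that [OF interval_fam_max [OF *(1) assms(1)]]) auto
qed

text \<open>On each interval the increment is nearly attained by a family inside it. All these
  families together are again disjoint and no longer in total, so absolute continuity of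
  \<open>f\<close> applies to their union.\<close>

lemma abs_cont_pos_var: "abs_cont (pos_var f)"
  unfolding abs_cont_def
proof (intro allI impI)
  fix \<epsilon> :: real assume "\<epsilon> > 0"
  then have "\<epsilon>/2 > 0" by simp
  obtain d where d: "d > 0" "\<And>(I::(nat\<times>nat) set) a b. finite I \<Longrightarrow> (\<And>i. i \<in> I \<Longrightarrow> a i \<le> b i) \<Longrightarrow>
       disjoint_family_on (\<lambda>i. {a i<..<b i}) I \<Longrightarrow> (\<Sum>i\<in>I. b i - a i) < d \<Longrightarrow>
       (\<Sum>i\<in>I. \<bar>f (b i) - f (a i)\<bar>) < \<epsilon>/2"
    by (rule abs_cont_index [OF ac \<open>\<epsilon>/2 > 0\<close>]) blast
  show "\<exists>\<delta>>0. \<forall>(n::nat) a b. (\<forall>i<n. a i \<le> b i) \<longrightarrow>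
       disjoint_family_on (\<lambda>i. {a i<..<b i}) {..<n} \<longrightarrow> (\<Sum>i<n. b i - a i) < \<delta> \<longrightarrow>
       (\<Sum>i<n. \<bar>pos_var f (b i) - pos_var f (a i)\<bar>) < \<epsilon>"
  proof (intro exI [of _ d] conjI allI impI d)
    fix m :: nat and a b :: "nat \<Rightarrow> real"
    assume *: "\<forall>i<m. a i \<le> b i" "disjoint_family_on (\<lambda>i. {a i<..<b i}) {..<m}"
      "(\<Sum>i<m. b i - a i) < d"
    \<comment> \<open>The \<open>m\<close> approximation errors may cost \<epsilon>/2 in total; the
      1 covers \<open>m = 0\<close>.\<close>
    define \<eta> where "\<eta> = \<epsilon> / (2 * (real m + 1))"
    have "\<eta> > 0" using \<open>\<epsilon> > 0\<close> by (simp add: \<eta>_def)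
    define Q where "Q i n u v \<longleftrightarrow> interval_fam (b i) n u v \<and> (\<forall>j<n. a i \<le> u j) \<and>
        pos_var f (b i) - pos_var f (a i) - \<eta> < (\<Sum>j<n. f (v j) - f (u j))" for i n u v
    have "\<exists>n u v. i < m \<longrightarrow> Q i n u v" for i
    proof (cases "i < m")
      case True
      then have "a i \<le> b i" using * by auto
      from this \<open>\<eta> > 0\<close> show ?thesis unfolding Q_def
        by (rule pos_var_increment_approx) blast
    qed auto
    then have "\<forall>i. \<exists>t. i < m \<longrightarrow> Q i (fst t) (fst (snd t)) (snd (snd t))"
      by simp
    from choice [OF this] obtain t
      where t: "\<And>i. i < m \<Longrightarrow> Q i (fst (t i)) (fst (snd (t i))) (snd (snd (t i)))" by blast
    define N U V where "N i = fst (t i)" and "U i = fst (snd (t i))" and "V i = snd (snd (t i))" for i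
    have Q: "\<And>i. i < m \<Longrightarrow> Q i (N i) (U i) (V i)"
      using t by (simp add: N_def U_def V_def)
    have NUV: "\<And>i. i < m \<Longrightarrow> interval_fam (b i) (N i) (U i) (V i)"
        "\<And>i j. i < m \<Longrightarrow> j < N i \<Longrightarrow> a i \<le> U i j"
        "\<And>i. i < m \<Longrightarrow> pos_var f (b i) - pos_var f (a i) - \<eta> < (\<Sum>j<N i. f (V i j) - f (U i j))"
      using Q by (auto simp: Q_def)
    let ?I = "SIGMA i:{..<m}. {..<N i}"
    have UV: "a i \<le> U i j \<and> U i j \<le> V i j \<and> V i j \<le> b i" if "i < m" "j < N i" for i j
      using NUV(1,2) that by (auto simp: interval_fam_def)
    have "(\<Sum>p\<in>?I. V (fst p) (snd p) - U (fst p) (snd p)) = (\<Sum>i<m. \<Sum>j<N i. V i j - U i j)"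
      by (simp add: sum.Sigma split_def)
    also have "\<dots> \<le> (\<Sum>i<m. b i - a i)"
      using NUV(1) UV * by (intro sum_mono sum_length_disjoint_le) (auto simp: interval_fam_def)
    finally have len: "(\<Sum>p\<in>?I. V (fst p) (snd p) - U (fst p) (snd p)) < d" using * by simp
    have disj: "disjoint_family_on (\<lambda>p. {U (fst p) (snd p)<..<V (fst p) (snd p)}) ?I"
      unfolding disjoint_family_on_def
    proof (intro ballI impI)
      fix p q assume pq: "p \<in> ?I" "q \<in> ?I" "p \<noteq> q"
      obtain i j k l where [simp]: "p = (i,j)" "q = (k,l)" by (cases p, cases q)
      show "{U (fst p) (snd p)<..<V (fst p) (snd p)} \<inter> {U (fst q) (snd q)<..<V (fst q) (snd q)} = {}"
      proof (cases "i = k")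
        case True
        then show ?thesis using pq NUV(1) [of i] by (auto simp: interval_fam_def disjoint_family_on_def)
      next
        case False
        have "{a i<..<b i} \<inter> {a k<..<b k} = {}"
          using * False pq by (auto simp: disjoint_family_on_def)
        moreover have "{U i j<..<V i j} \<subseteq> {a i<..<b i}" "{U k l<..<V k l} \<subseteq> {a k<..<b k}"
          using UV [of i j] UV [of k l] pq by auto
        ultimately show ?thesis by (simp only: \<open>p = (i,j)\<close> \<open>q = (k,l)\<close> fst_conv snd_conv) blast
      qed
    qed
    have "(\<Sum>p\<in>?I. \<bar>f (V (fst p) (snd p)) - f (U (fst p) (snd p))\<bar>) < \<epsilon>/2"
      using UV len disj by (intro d) auto
    moreover have "(\<Sum>p\<in>?I. f (V (fst p) (snd p)) - f (U (fst p) (snd p))) \<le>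
        (\<Sum>p\<in>?I. \<bar>f (V (fst p) (snd p)) - f (U (fst p) (snd p))\<bar>)"
      by (intro sum_mono) auto
    moreover have "(\<Sum>p\<in>?I. f (V (fst p) (snd p)) - f (U (fst p) (snd p))) = (\<Sum>i<m. \<Sum>j<N i. f (V i j) - f (U i j))"
      by (simp add: sum.Sigma split_def)
    moreover have "(\<Sum>i<m. pos_var f (b i) - pos_var f (a i) - \<eta>) \<le> (\<Sum>i<m. \<Sum>j<N i. f (V i j) - f (U i j))"
      using NUV(3) by (intro sum_mono less_imp_le) auto
    moreover have "(\<Sum>i<m. pos_var f (b i) - pos_var f (a i) - \<eta>) = (\<Sum>i<m. pos_var f (b i) - pos_var f (a i)) - m * \<eta>"
      by (simp add: sum_subtractf)
    moreover have "m * \<eta> \<le> \<epsilon>/2"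
      using \<open>\<epsilon> > 0\<close> by (simp add: \<eta>_def field_simps)
    moreover have "(\<Sum>i<m. \<bar>pos_var f (b i) - pos_var f (a i)\<bar>) = (\<Sum>i<m. pos_var f (b i) - pos_var f (a i))"
    proof (intro sum.cong refl abs_of_nonneg)
      fix i assume "i \<in> {..<m}"
      then show "0 \<le> pos_var f (b i) - pos_var f (a i)"
        using pos_var_increment [of "a i" "b i"] * by auto
    qed
    ultimately show "(\<Sum>i<m. \<bar>pos_var f (b i) - pos_var f (a i)\<bar>) < \<epsilon>" by linarith
  qed
qed

end

text \<open>Absolute continuity of the Stieltjes measure gives both the differentiability almost everywhere
  and the integral formula.  The former matters because \<open>vector_derivative\<close> has an arbitrary value
  where the derivative does not exist.\<close>

lemma null_set_interval_measure:
  assumes ac: "abs_cont F" and mono: "mono F" and N: "N \<in> null_sets lborel" "N \<subseteq> {a..b}" "a < b"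
  shows "emeasure (interval_measure F) N = 0"
proof -
  have cont: "continuous_on UNIV F" by (rule abs_cont_imp_continuous [OF ac])
  have Icc: "emeasure (interval_measure F) {c..d} = F d - F c" if "c \<le> d" for c d
    using emeasure_interval_measure_Icc [OF that _ cont] mono by (simp add: monoD)
  have "emeasure (interval_measure F) N \<le> ennreal \<epsilon>" if \<epsilon>: "\<epsilon> > 0" for \<epsilon>
  proof -
    obtain \<delta> where \<delta>: "\<delta> > 0" "\<And>(I::real set set) a b. finite I \<Longrightarrow> (\<And>i. i \<in> I \<Longrightarrow> a i \<le> b i) \<Longrightarrow>
       disjoint_family_on (\<lambda>i. {a i<..<b i}) I \<Longrightarrow> (\<Sum>i\<in>I. b i - a i) < \<delta> \<Longrightarrow>
       (\<Sum>i\<in>I. \<bar>F (b i) - F (a i)\<bar>) < \<epsilon>"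
      by (rule abs_cont_index [where 'i = "real set", OF ac \<epsilon>]) blast
    obtain U where U: "open U" "N \<subseteq> U" "emeasure lborel (U - N) < ennreal \<delta>"
      using outer_regular_lborel [of N \<delta>] null_setsD2 [OF N(1)] \<delta>(1) by auto
    have "emeasure lborel U = emeasure lborel (U - N)"
      using N U by (intro emeasure_Diff_null_set [symmetric]) auto
    with U have Um: "emeasure lborel U < ennreal \<delta>" by simp
    \<comment> \<open>Each covering interval meets \<open>N\<close>, hence this gauge forces it into
      \<open>U\<close>; finite subfamilies then have total length below \<delta>.\<close>
    have gauge: "gauge (\<lambda>x. if x \<in> U then U else UNIV)" using U by (auto simp: gauge_def)
    have "N \<subseteq> cbox a b" "box a b \<noteq> {}" using N by auto
    from this gauge obtain D where D: "countable D" "\<And>K. K \<in> D \<Longrightarrow> interior K \<noteq> {} \<and> (\<exists>c d. K = cbox c d)"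
        "pairwise (\<lambda>A B. interior A \<inter> interior B = {}) D"
        "\<And>K. K \<in> D \<Longrightarrow> \<exists>x \<in> N \<inter> K. K \<subseteq> (if x \<in> U then U else UNIV)"
        "N \<subseteq> \<Union>D"
      by (rule covering_lemma) blast
    define lo hi where "lo K = Inf K" and "hi K = Sup K" for K :: "real set"
    have K: "lo K < hi K" "K = {lo K..hi K}" "interior K = {lo K<..<hi K}" "K \<subseteq> U" if KD: "K \<in> D" for K
    proof -
      obtain c d where cd: "K = {c..d}" "interior K \<noteq> {}" using D(2) [OF KD] by auto
      then have "c < d" by (auto simp: interior_atLeastAtMost_real)
      then show "lo K < hi K" "K = {lo K..hi K}" "interior K = {lo K<..<hi K}"
        using cd by (auto simp: lo_def hi_def)
      show "K \<subseteq> U" using D(4) [OF KD] U(2) by (auto split: if_splits)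
    qed
    have fin: "(\<Sum>K\<in>G. F (hi K) - F (lo K)) < \<epsilon>" if G: "finite G" "G \<subseteq> D" for G
    proof -
      have disj: "disjoint_family_on (\<lambda>K. {lo K<..<hi K}) G"
        unfolding disjoint_family_on_def
      proof (intro ballI impI)
        fix A B assume "A \<in> G" "B \<in> G" "A \<noteq> B"
        then show "{lo A<..<hi A} \<inter> {lo B<..<hi B} = {}"
          using D(3) K(3) [of A] K(3) [of B] G(2) unfolding pairwise_def by (metis subsetD)
      qed
      have "ennreal (\<Sum>K\<in>G. hi K - lo K) = (\<Sum>K\<in>G. ennreal (hi K - lo K))"
        using K(1) G(2) by (intro sum_ennreal [symmetric]) (force intro: less_imp_le)
      also have "\<dots> = (\<Sum>K\<in>G. emeasure lborel {lo K<..<hi K})"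
        using K(1) G(2) by (intro sum.cong) (force intro: less_imp_le)+
      also have "\<dots> = emeasure lborel (\<Union>K\<in>G. {lo K<..<hi K})"
        using disj G by (intro sum_emeasure) auto
      also have "\<dots> \<le> emeasure lborel U"
      proof (rule emeasure_mono)
        show "(\<Union>K\<in>G. {lo K<..<hi K}) \<subseteq> U"
          using K(3,4) G(2) interior_subset by blast
      qed (use U in auto)
      finally have "ennreal (\<Sum>K\<in>G. hi K - lo K) < ennreal \<delta>" using Um by simp
      then have "(\<Sum>K\<in>G. hi K - lo K) < \<delta>"
        by (meson ennreal_leI linorder_not_less)
      then have "(\<Sum>K\<in>G. \<bar>F (hi K) - F (lo K)\<bar>) < \<epsilon>"
        using K(1) G disj by (intro \<delta>) (force intro: less_imp_le)+
      then show ?thesis by (smt (verit) sum_mono)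
    qed
    show ?thesis
    proof (cases "D = {}")
      case True
      then show ?thesis using D(5) by simp
    next
      case False
      define A where "A n = \<Union>(from_nat_into D ` {..<n})" for n
      have sets: "K \<in> sets (interval_measure F)" if "K \<in> D" for K
        using D(2) [OF that] by auto
      have fromD: "from_nat_into D i \<in> D" for i by (rule from_nat_into [OF False])
      have UA: "(\<Union>n. A n) = \<Union>D"
      proof -
        have "\<Union>D = (\<Union>i. from_nat_into D i)" using range_from_nat_into [OF False D(1)] by simp
        also have "\<dots> = (\<Union>n. A n)" unfolding A_def by (auto; meson lessI)
        finally show ?thesis by simp
      qed
      have setsA: "A n \<in> sets (interval_measure F)" for n
        unfolding A_def using sets fromD by (intro sets.finite_UN) auto
      have bound: "emeasure (interval_measure F) (A n) \<le> ennreal \<epsilon>" for n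
      proof -
        let ?G = "from_nat_into D ` {..<n}"
        have G: "finite ?G" "?G \<subseteq> D" using fromD by auto
        have "emeasure (interval_measure F) (\<Union>K\<in>?G. K) \<le> (\<Sum>K\<in>?G. emeasure (interval_measure F) K)"
          using G sets by (intro emeasure_subadditive_finite) auto
        also have "\<dots> = (\<Sum>K\<in>?G. ennreal (F (hi K) - F (lo K)))"
          using G K(1,2) Icc by (intro sum.cong) (metis less_imp_le subsetD)+
        also have "\<dots> = ennreal (\<Sum>K\<in>?G. F (hi K) - F (lo K))"
          using K(1) G mono by (intro sum_ennreal) (force intro: less_imp_le monoD)
        also have "\<dots> \<le> ennreal \<epsilon>" using fin [OF G] by (intro ennreal_leI) simp
        finally show ?thesis by (simp add: A_def)
      qed
      have "emeasure (interval_measure F) N \<le> emeasure (interval_measure F) (\<Union>n. A n)"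
        using D(5) setsA unfolding UA [symmetric] by (intro emeasure_mono) auto
      also have "\<dots> = (SUP n. emeasure (interval_measure F) (A n))"
      proof (rule SUP_emeasure_incseq [symmetric])
        show "incseq A" unfolding A_def by (intro monoI Union_mono image_mono) auto
      qed (use setsA in auto)
      also have "\<dots> \<le> ennreal \<epsilon>" using bound by (intro SUP_least)
      finally show ?thesis .
    qed
  qed
  then have "emeasure (interval_measure F) N \<le> 0 + ennreal e" if "e > 0" for e
    using that by simp
  then have "emeasure (interval_measure F) N \<le> 0"
    using ennreal_le_epsilon by blast
  then show ?thesis by simp
qed

text \<open>The integrand is the Radon-Nikodym density of the Stieltjes measure. It is finite almost
  everywhere on bounded intervals because these have finite measure, so \<open>enn2real\<close> does
  not change the integral.\<close>

lemma abs_cont_mono_imp_integral: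
  assumes ac: "abs_cont F" and mono: "mono F"
  obtains g where "\<And>a b. a \<le> b \<Longrightarrow> g absolutely_integrable_on {a..b} \<and> (g has_integral (F b - F a)) {a..b}"
proof -
  let ?M = "interval_measure F"
  have cont: "continuous_on UNIV F" by (rule abs_cont_imp_continuous [OF ac])
  have Icc: "emeasure ?M {c..d} = F d - F c" if "c \<le> d" for c d
    using emeasure_interval_measure_Icc [OF that _ cont] mono by (simp add: monoD)
  have "absolutely_continuous lborel ?M"
    unfolding absolutely_continuous_def
  proof
    fix N assume N: "N \<in> null_sets (lborel :: real measure)"
    have "emeasure ?M (N \<inter> {- real n - 1..real n + 1}) = 0" for n
      by (rule null_set_interval_measure [OF ac mono, of _ "- real n - 1" "real n + 1"])
         (use N in \<open>auto intro: null_set_Int2\<close>)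
    moreover have "N \<inter> {- real n - 1..real n + 1} \<in> sets ?M" for n
      using N by (auto dest: null_setsD2)
    ultimately have "(\<Union>n. N \<inter> {- real n - 1..real n + 1}) \<in> null_sets ?M"
      by (intro null_sets_UN) (auto intro: null_setsI)
    moreover have "(\<Union>n. N \<inter> {- real n - 1..real n + 1}) = N"
    proof -
      have "\<exists>n. - real n - 1 \<le> x \<and> x \<le> real n + 1" for x
      proof -
        obtain n :: nat where "\<bar>x\<bar> \<le> real n" using real_arch_simple by blast
        then show ?thesis by (intro exI [of _ n]) linarith
      qed
      then show ?thesis by auto
    qed
    ultimately show "N \<in> null_sets ?M" by simp
  qed
  then obtain h where h: "h \<in> borel_measurable lborel" "density lborel h = ?M"
    using sigma_finite_measure.Radon_Nikodym [OF sigma_finite_lborel, of ?M] by auto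
  define g where "g x = enn2real (h x)" for x
  have gm: "g \<in> borel_measurable lborel" using h(1) unfolding g_def by measurable
  show thesis
  proof
    fix a b :: real assume ab: "a \<le> b"
    have int: "(\<integral>\<^sup>+x. h x * indicator {a..b} x \<partial>lborel) = ennreal (F b - F a)"
      using emeasure_density [OF h(1), of "{a..b}"] Icc [OF ab] h(2) by simp
    then have fin: "AE x in lborel. h x * indicator {a..b} x \<noteq> \<infinity>"
      using h(1) by (intro nn_integral_PInf_AE) auto
    have "(\<integral>\<^sup>+x. ennreal (indicator {a..b} x * g x) \<partial>lborel) = (\<integral>\<^sup>+x. h x * indicator {a..b} x \<partial>lborel)"
      using fin by (intro nn_integral_cong_AE) (auto simp: g_def indicator_def less_top elim!: eventually_mono)
    then have "has_bochner_integral lborel (\<lambda>x. indicator {a..b} x * g x) (F b - F a)"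
      using int ab mono
      by (intro has_bochner_integral_nn_integral borel_measurable_times) (use gm in \<open>auto simp: g_def [abs_def] monoD\<close>)
    then have si: "set_integrable lborel {a..b} g" "(LINT x:{a..b}|lborel. g x) = F b - F a"
      by (auto simp: set_integrable_def set_lebesgue_integral_def has_bochner_integral_iff)
    then have "g absolutely_integrable_on {a..b}"
      unfolding set_integrable_def by (intro integrable_completion [THEN iffD2]) auto
    moreover have "(g has_integral (F b - F a)) {a..b}"
      using set_borel_integral_eq_integral [OF si(1)] si(2) by (simp add: has_integral_iff)
    ultimately show "g absolutely_integrable_on {a..b} \<and> (g has_integral (F b - F a)) {a..b}" by blast
  qed
qed


text \<open>Jordan decomposition: \<open>f\<close> is the difference of the increasing functions
  \<open>pos_var f\<close> and \<open>pos_var f - f\<close>, both absolutely continuous.\<close>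

lemma abs_cont_imp_integral:
  assumes ac: "abs_cont f" and const: "\<And>x. x \<le> 0 \<Longrightarrow> f x = f 0"
  obtains g where "\<And>a b. a \<le> b \<Longrightarrow> g absolutely_integrable_on {a..b} \<and> (g has_integral (f b - f a)) {a..b}"
proof -
  let ?P = "pos_var f"
  have inc: "?P x + max 0 (f y - f x) \<le> ?P y" if "x \<le> y" for x y
    by (rule pos_var_increment [OF ac const that])
  have acP: "abs_cont ?P" by (rule abs_cont_pos_var [OF ac const])
  have acN: "abs_cont (\<lambda>x. ?P x - f x)" by (rule abs_cont_diff [OF acP ac])
  have "mono ?P" by (intro monoI) (use inc in fastforce)
  from acP this obtain g where g: "\<And>a b. a \<le> b \<Longrightarrow> g absolutely_integrable_on {a..b} \<and> (g has_integral (?P b - ?P a)) {a..b}"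
    by (rule abs_cont_mono_imp_integral) blast
  have "mono (\<lambda>x. ?P x - f x)" by (intro monoI) (use inc in fastforce)
  from acN this obtain h where h: "\<And>a b. a \<le> b \<Longrightarrow> h absolutely_integrable_on {a..b} \<and>
      (h has_integral ((?P b - f b) - (?P a - f a))) {a..b}"
    by (rule abs_cont_mono_imp_integral) blast
  show thesis
  proof
    fix a b :: real assume ab: "a \<le> b"
    show "(\<lambda>x. g x - h x) absolutely_integrable_on {a..b} \<and> ((\<lambda>x. g x - h x) has_integral (f b - f a)) {a..b}"
      using g [OF ab] h [OF ab] has_integral_diff [of g _ "{a..b}" h] 
      by (force intro: set_integral_diff)
  qed
qed

section \<open>Absolute continuity in integral form, with the derivative named\<close>

definition primitive :: "(real \<Rightarrow> 'b::euclidean_space) \<Rightarrow> (real \<Rightarrow> 'b) \<Rightarrow> bool" where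
  "primitive F f \<longleftrightarrow> f absolutely_integrable_on {0..1} \<and> (\<forall>x\<in>{0..1}. F x = F 0 + integral {0..x} f)"

lemma primitive_eq: "primitive F f \<Longrightarrow> x \<in> {0..1} \<Longrightarrow> F x = F 0 + integral {0..x} f"
  and primitive_abs: "primitive F f \<Longrightarrow> f absolutely_integrable_on {0..1}"
  unfolding primitive_def by blast+

lemma primitive_integrable:
  "primitive F f \<Longrightarrow> 0 \<le> a \<Longrightarrow> b \<le> 1 \<Longrightarrow> f integrable_on {a..b}"
  using primitive_abs [of F f]
  by (auto simp: absolutely_integrable_on_def intro: integrable_on_subinterval)

lemma AC01_D:
  assumes "f \<in> AC01" "\<epsilon> > 0"
  obtains \<delta> where "\<delta> > 0" "\<And>(n::nat) a b. (\<And>i. i < n \<Longrightarrow> 0 \<le> a i \<and> a i \<le> b i \<and> b i \<le> 1) \<Longrightarrow>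
     disjoint_family_on (\<lambda>i. {a i<..<b i}) {..<n} \<Longrightarrow>
     (\<Sum>i<n. b i - a i) < \<delta> \<Longrightarrow> (\<Sum>i<n. norm (f (b i) - f (a i))) < \<epsilon>"
proof -
  from assms have "\<exists>\<delta>>0. \<forall>(n::nat) (a::nat \<Rightarrow> real) b.
     (\<forall>i<n. 0 \<le> a i \<and> a i \<le> b i \<and> b i \<le> 1) \<longrightarrow>
     disjoint_family_on (\<lambda>i. {a i<..<b i}) {..<n} \<longrightarrow>
     (\<Sum>i<n. b i - a i) < \<delta> \<longrightarrow> (\<Sum>i<n. norm (f (b i) - f (a i))) < \<epsilon>"
    unfolding AC01_def by auto
  then show thesis using that by auto
qed

text \<open>Covers products, with the two factors as \<open>F\<close> and \<open>G\<close>, and the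
  exponential of a primitive, with \<open>F = G\<close>.\<close>

lemma AC01_dominated:
  assumes F: "F \<in> AC01" and G: "G \<in> AC01" and L: "L \<ge> 0"
    and le: "\<And>s t. s \<in> {0..1} \<Longrightarrow> t \<in> {0..1} \<Longrightarrow>
      norm (H s - H t) \<le> L * (norm (F s - F t) + norm (G s - G t))"
  shows "H \<in> AC01"
  unfolding AC01_def
proof (intro CollectI allI impI)
  fix \<epsilon> :: real assume "\<epsilon> > 0"
  define \<eta> where "\<eta> = \<epsilon> / (2 * (L + 1))"
  have \<eta>: "\<eta> > 0" using \<open>\<epsilon> > 0\<close> L by (simp add: \<eta>_def)
  obtain d1 where d1: "d1 > 0" "\<And>(n::nat) a b. (\<And>i. i < n \<Longrightarrow> 0 \<le> a i \<and> a i \<le> b i \<and> b i \<le> 1) \<Longrightarrow>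
     disjoint_family_on (\<lambda>i. {a i<..<b i}) {..<n} \<Longrightarrow>
     (\<Sum>i<n. b i - a i) < d1 \<Longrightarrow> (\<Sum>i<n. norm (F (b i) - F (a i))) < \<eta>"
    by (rule AC01_D [OF F \<eta>]) blast
  obtain d2 where d2: "d2 > 0" "\<And>(n::nat) a b. (\<And>i. i < n \<Longrightarrow> 0 \<le> a i \<and> a i \<le> b i \<and> b i \<le> 1) \<Longrightarrow>
     disjoint_family_on (\<lambda>i. {a i<..<b i}) {..<n} \<Longrightarrow>
     (\<Sum>i<n. b i - a i) < d2 \<Longrightarrow> (\<Sum>i<n. norm (G (b i) - G (a i))) < \<eta>"
    by (rule AC01_D [OF G \<eta>]) blast
  show "\<exists>\<delta>>0. \<forall>(n::nat) (a::nat \<Rightarrow> real) b.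
     (\<forall>i<n. 0 \<le> a i \<and> a i \<le> b i \<and> b i \<le> 1) \<longrightarrow>
     disjoint_family_on (\<lambda>i. {a i<..<b i}) {..<n} \<longrightarrow>
     (\<Sum>i<n. b i - a i) < \<delta> \<longrightarrow> (\<Sum>i<n. norm (H (b i) - H (a i))) < \<epsilon>"
  proof (intro exI [of _ "min d1 d2"] conjI allI impI)
    fix n :: nat and a b :: "nat \<Rightarrow> real"
    assume *: "\<forall>i<n. 0 \<le> a i \<and> a i \<le> b i \<and> b i \<le> 1" "disjoint_family_on (\<lambda>i. {a i<..<b i}) {..<n}"
      "(\<Sum>i<n. b i - a i) < min d1 d2"
    have "norm (H (b i) - H (a i)) \<le> L * (norm (F (b i) - F (a i)) + norm (G (b i) - G (a i)))" if "i < n" for i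
      using * that by (intro le) (auto intro: order_trans)
    then have "(\<Sum>i<n. norm (H (b i) - H (a i)))
        \<le> (\<Sum>i<n. L * (norm (F (b i) - F (a i)) + norm (G (b i) - G (a i))))"
      by (intro sum_mono) auto
    also have "\<dots> = L * ((\<Sum>i<n. norm (F (b i) - F (a i))) + (\<Sum>i<n. norm (G (b i) - G (a i))))"
      by (simp add: sum_distrib_left sum.distrib ring_distribs)
    also have "\<dots> \<le> L * (\<eta> + \<eta>)"
      using * by (intro mult_left_mono add_mono less_imp_le [OF d1(2)] less_imp_le [OF d2(2)] L) auto
    also have "\<dots> = L / (L + 1) * \<epsilon>" using L by (simp add: \<eta>_def divide_simps)
    also have "\<dots> < 1 * \<epsilon>" using L \<open>\<epsilon> > 0\<close> by (intro mult_strict_right_mono) auto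
    finally show "(\<Sum>i<n. norm (H (b i) - H (a i))) < \<epsilon>" by simp
  qed (use d1 d2 in auto)
qed

text \<open>\<open>g\<close> will be \<open>Re\<close> or \<open>Im\<close>. Clamping the argument
  neither lengthens intervals nor makes disjoint ones overlap.\<close>

lemma AC01_clamp_abs_cont:
  fixes g :: "complex \<Rightarrow> real"
  assumes f: "f \<in> AC01" and g: "\<And>z w. \<bar>g z - g w\<bar> \<le> norm (z - w)"
  shows "abs_cont (\<lambda>x. g (f (max 0 (min 1 x))))"
  unfolding abs_cont_def
proof (intro allI impI)
  fix \<epsilon> :: real assume "\<epsilon> > 0"
  then obtain d where d: "d > 0" "\<And>(n::nat) a b. (\<And>i. i < n \<Longrightarrow> 0 \<le> a i \<and> a i \<le> b i \<and> b i \<le> 1) \<Longrightarrow>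
     disjoint_family_on (\<lambda>i. {a i<..<b i}) {..<n} \<Longrightarrow>
     (\<Sum>i<n. b i - a i) < d \<Longrightarrow> (\<Sum>i<n. norm (f (b i) - f (a i))) < \<epsilon>"
    by (rule AC01_D [OF f]) blast
  let ?c = "\<lambda>x::real. max 0 (min 1 x)"
  show "\<exists>\<delta>>0. \<forall>(n::nat) a b. (\<forall>i<n. a i \<le> b i) \<longrightarrow>
       disjoint_family_on (\<lambda>i. {a i<..<b i}) {..<n} \<longrightarrow> (\<Sum>i<n. b i - a i) < \<delta> \<longrightarrow>
       (\<Sum>i<n. \<bar>g (f (?c (b i))) - g (f (?c (a i)))\<bar>) < \<epsilon>"
  proof (intro exI [of _ d] conjI allI impI d(1))
    fix n :: nat and a b :: "nat \<Rightarrow> real"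
    assume *: "\<forall>i<n. a i \<le> b i" "disjoint_family_on (\<lambda>i. {a i<..<b i}) {..<n}"
      "(\<Sum>i<n. b i - a i) < d"
    have "(\<Sum>i<n. \<bar>g (f (?c (b i))) - g (f (?c (a i)))\<bar>) \<le> (\<Sum>i<n. norm (f (?c (b i)) - f (?c (a i))))"
      by (intro sum_mono g)
    also have "\<dots> < \<epsilon>"
    proof (rule d(2))
      show "0 \<le> ?c (a i) \<and> ?c (a i) \<le> ?c (b i) \<and> ?c (b i) \<le> 1" if "i < n" for i
        using * that by (auto simp: max_def min_def)
      show "disjoint_family_on (\<lambda>i. {?c (a i)<..<?c (b i)}) {..<n}"
        by (rule disjoint_family_on_sub [OF *(2)]) (auto simp: max_def min_def split: if_splits)
      have "(\<Sum>i<n. ?c (b i) - ?c (a i)) \<le> (\<Sum>i<n. b i - a i)"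
        using * by (intro sum_mono) (auto simp: max_def min_def)
      then show "(\<Sum>i<n. ?c (b i) - ?c (a i)) < d" using * by simp
    qed
    finally show "(\<Sum>i<n. \<bar>g (f (?c (b i))) - g (f (?c (a i)))\<bar>) < \<epsilon>" .
  qed
qed

lemma AC01_imp_primitive:
  assumes "f \<in> AC01"
  obtains g where "primitive f g"
proof -
  let ?c = "\<lambda>x::real. max 0 (min 1 x)"
  have "abs_cont (\<lambda>x. Re (f (?c x)))"
    by (rule AC01_clamp_abs_cont [OF assms]) (metis abs_Re_le_cmod minus_complex.sel(1))
  then obtain g where g: "\<And>a b. a \<le> b \<Longrightarrow> g absolutely_integrable_on {a..b} \<and>
      (g has_integral (Re (f (?c b)) - Re (f (?c a)))) {a..b}"
    by (rule abs_cont_imp_integral) (auto simp: max_def min_def)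
  have "abs_cont (\<lambda>x. Im (f (?c x)))"
    by (rule AC01_clamp_abs_cont [OF assms]) (metis abs_Im_le_cmod minus_complex.sel(2))
  then obtain h where h: "\<And>a b. a \<le> b \<Longrightarrow> h absolutely_integrable_on {a..b} \<and>
      (h has_integral (Im (f (?c b)) - Im (f (?c a)))) {a..b}"
    by (rule abs_cont_imp_integral) (auto simp: max_def min_def)
  have abs: "(\<lambda>x. Complex (g x) (h x)) absolutely_integrable_on {0..1}"
  proof -
    have "(\<lambda>x. of_real (g x) + \<i> * of_real (h x)) absolutely_integrable_on {0..1}"
      using g [of 0 1] h [of 0 1]
      by (intro set_integral_add set_integrable_mult_right absolutely_integrable_linear [of _ _ of_real, unfolded o_def])
         (auto intro: bounded_linear_of_real)
    then show ?thesis by (simp add: Complex_eq)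
  qed
  have "f x = f 0 + integral {0..x} (\<lambda>x. Complex (g x) (h x))" if "x \<in> {0..1}" for x
  proof -
    have "((\<lambda>x. of_real (g x) + \<i> * of_real (h x)) has_integral
        (of_real (Re (f x) - Re (f 0)) + \<i> * of_real (Im (f x) - Im (f 0)))) {0..x}"
      using g [of 0 x] h [of 0 x] that
      by (intro has_integral_add has_integral_mult_right has_integral_of_real) auto
    moreover have "of_real (Re (f x) - Re (f 0)) + \<i> * of_real (Im (f x) - Im (f 0)) = f x - f 0"
      by (simp add: complex_eq_iff)
    ultimately have "((\<lambda>x. Complex (g x) (h x)) has_integral (f x - f 0)) {0..x}"
      by (simp only: Complex_eq)
    then show ?thesis by (simp add: integral_unique)
  qed
  with abs show thesis by (intro that [of "\<lambda>x. Complex (g x) (h x)"]) (unfold primitive_def, blast)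
qed

text \<open>Lebesgue differentiation. \<open>integrable_ccontinuous_explicit\<close> controls
  averages over intervals to the right of a point; applied to the reflected function it controls
  those to the left, and both give the two-sided derivative.\<close>

lemma has_vector_derivative_integral_AE:
  fixes g :: "real \<Rightarrow> 'b::euclidean_space"
  assumes g: "g integrable_on {0..1}"
  obtains N where "negligible N"
    "\<And>x. x \<in> {0<..<1} - N \<Longrightarrow> ((\<lambda>x. integral {0..x} g) has_vector_derivative g x) (at x)"
proof -
  \<comment> \<open>Extended by zero, because integrability on every interval is required
    below.\<close>
  define G where "G = (\<lambda>x. if x \<in> {0..1} then g x else 0)"
  have GU: "G integrable_on UNIV" unfolding G_def using g by (simp only: integrable_restrict_UNIV)
  have Gi: "G integrable_on {a..b}" for a b
    using integrable_on_subcbox [OF GU, of a b] by simp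
  have Gi': "(\<lambda>x. G (- x)) integrable_on {a..b}" for a b
    using Gi [of "-b" "-a"] Henstock_Kurzweil_Integration.integrable_reflect_real [where f = G and a = "-b" and b = "-a"] by simp
  obtain N1 where N1: "negligible N1" "\<And>x e. \<lbrakk>x \<notin> N1; 0 < e\<rbrakk> \<Longrightarrow> \<exists>d>0. \<forall>h. 0 < h \<and> h < d \<longrightarrow>
      norm (integral (cbox x (x + h *\<^sub>R One)) G /\<^sub>R h ^ DIM(real) - G x) < e"
    using integrable_ccontinuous_explicit [of G] Gi by (metis cbox_interval)
  obtain N2 where N2: "negligible N2" "\<And>x e. \<lbrakk>x \<notin> N2; 0 < e\<rbrakk> \<Longrightarrow> \<exists>d>0. \<forall>h. 0 < h \<and> h < d \<longrightarrow>
      norm (integral (cbox x (x + h *\<^sub>R One)) (\<lambda>x. G (- x)) /\<^sub>R h ^ DIM(real) - G (- x)) < e"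
    using integrable_ccontinuous_explicit [of "\<lambda>x. G (- x)"] Gi' by (metis cbox_interval)
  show thesis
  proof
    show "negligible (N1 \<union> uminus ` N2)"
      using N1 N2 by (intro negligible_Un negligible_differentiable_image_negligible)
        (auto intro!: derivative_intros)
    fix x assume x: "x \<in> {0<..<1} - (N1 \<union> uminus ` N2)"
    then have "x \<notin> N1" "- x \<notin> N2" by (auto simp: image_iff)
    have Gx: "G x = g x" using x by (simp add: G_def)
    have int: "integral {0..y} g - integral {0..x} g = (if x \<le> y then integral {x..y} G else - integral {y..x} G)"
      if "y \<in> {0..1}" for y
    proof -
      have "integral {0..z} g = integral {0..z} G" if "z \<in> {0..1}" for z
        using that by (intro integral_cong) (auto simp: G_def)
      moreover have "integral {0..x} G + integral {x..y} G = integral {0..y} G" if "x \<le> y"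
        using x that Gi by (intro Henstock_Kurzweil_Integration.integral_combine) auto
      moreover have "integral {0..y} G + integral {y..x} G = integral {0..x} G" if "y \<le> x"
        using \<open>y \<in> {0..1}\<close> that Gi by (intro Henstock_Kurzweil_Integration.integral_combine) auto
      ultimately show ?thesis using x that by (auto simp: algebra_simps)
    qed
    show "((\<lambda>x. integral {0..x} g) has_vector_derivative g x) (at x)"
      unfolding has_vector_derivative_def has_derivative_at_alt
    proof (intro conjI allI impI)
      show "bounded_linear (\<lambda>h. h *\<^sub>R g x)" by (rule bounded_linear_scaleR_left)
      fix e :: real assume "e > 0"
      obtain d1 where d1: "d1 > 0" "\<And>h. 0 < h \<Longrightarrow> h < d1 \<Longrightarrow> norm (integral {x..x + h} G /\<^sub>R h - G x) < e"
        using N1(2) [OF \<open>x \<notin> N1\<close> \<open>e > 0\<close>] by (auto simp: cbox_interval)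
      obtain d2 where d2: "d2 > 0" "\<And>h. 0 < h \<Longrightarrow> h < d2 \<Longrightarrow> norm (integral {-x..-x + h} (\<lambda>x. G (- x)) /\<^sub>R h - G x) < e"
        using N2(2) [OF \<open>- x \<notin> N2\<close> \<open>e > 0\<close>] by (auto simp: cbox_interval)
      have scale: "norm (I - h *\<^sub>R c) \<le> e * h" if "norm (I /\<^sub>R h - c) < e" "h > 0" for I c :: 'b and h
      proof -
        have "I - h *\<^sub>R c = h *\<^sub>R (I /\<^sub>R h - c)" using that by (simp add: algebra_simps)
        then have "norm (I - h *\<^sub>R c) = h * norm (I /\<^sub>R h - c)" using that by (metis abs_of_pos norm_scaleR)
        then show ?thesis using that by (simp add: mult.commute)
      qed
      show "\<exists>d>0. \<forall>y. norm (y - x) < d \<longrightarrow>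
          norm (integral {0..y} g - integral {0..x} g - (y - x) *\<^sub>R g x) \<le> e * norm (y - x)"
      proof (intro exI [of _ "Min {d1, d2, x, 1 - x}"] conjI allI impI)
        show "0 < Min {d1, d2, x, 1 - x}" using d1 d2 x by auto
        fix y assume y: "norm (y - x) < Min {d1, d2, x, 1 - x}"
        then have y01: "y \<in> {0..1}" by auto
        consider "y = x" | "y > x" | "y < x" by linarith
        then show "norm (integral {0..y} g - integral {0..x} g - (y - x) *\<^sub>R g x) \<le> e * norm (y - x)"
        proof cases
          case 2
          then show ?thesis
            using scale [OF d1(2) [of "y - x"]] y by (simp add: int [OF y01] Gx)
        next
          case 3
          have "integral {-x..-x + (x - y)} (\<lambda>x. G (- x)) = integral {y..x} G"
            using Henstock_Kurzweil_Integration.integral_reflect_real [where f = G and a = y and b = x] by simp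
          then have "norm (integral {y..x} G - (x - y) *\<^sub>R G x) \<le> e * (x - y)"
            using scale [OF d2(2) [of "x - y"]] y 3 by simp
          then have "norm (- (integral {y..x} G - (x - y) *\<^sub>R G x)) \<le> e * (x - y)"
            by (simp only: norm_minus_cancel)
          moreover have "- (integral {y..x} G - (x - y) *\<^sub>R G x) =
              integral {0..y} g - integral {0..x} g - (y - x) *\<^sub>R g x"
            using 3 by (simp add: int [OF y01] Gx algebra_simps)
          ultimately show ?thesis using 3 by simp
        qed simp
      qed
    qed
  qed
qed


text \<open>Split the norm of \<open>g\<close> into a part at most \<open>M\<close> and the excess
  \<open>k M\<close>. By dominated convergence the excess has integral below \<epsilon>/2 for large
  \<open>M\<close>, and the bounded part contributes at most \<open>M\<close> times the total
  length.\<close>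

lemma absolute_continuity_of_integral:
  fixes g :: "real \<Rightarrow> 'b::euclidean_space"
  assumes g: "g absolutely_integrable_on {0..1}" and "\<epsilon> > 0"
  obtains \<delta> where "\<delta> > 0" "\<And>(n::nat) a b. (\<And>i. i < n \<Longrightarrow> 0 \<le> a i \<and> a i \<le> b i \<and> b i \<le> 1) \<Longrightarrow>
     disjoint_family_on (\<lambda>i. {a i<..<b i}) {..<n} \<Longrightarrow>
     (\<Sum>i<n. b i - a i) < \<delta> \<Longrightarrow> (\<Sum>i<n. norm (integral {a i..b i} g)) < \<epsilon>"
proof -
  define k where "k M x = max 0 (norm (g x) - real M)" for M x
  have ng: "(\<lambda>x. norm (g x)) absolutely_integrable_on {0..1}"
    by (rule absolutely_integrable_norm [unfolded o_def, OF g])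
  have k_abs: "k M absolutely_integrable_on {0..1}" for M
    unfolding k_def using ng
    by (intro absolutely_integrable_max_1 set_integral_diff absolutely_integrable_on_const) auto
  have "(\<lambda>M. integral {0..1} (k M)) \<longlonglongrightarrow> integral {0..1} (\<lambda>x::real. 0)"
  proof (rule Equivalence_Lebesgue_Henstock_Integration.dominated_convergence(2) [where h = "\<lambda>x. norm (g x)"])
    show "k M integrable_on {0..1}" for M using k_abs [of M] by (simp add: absolutely_integrable_on_def)
    show "(\<lambda>x. norm (g x)) integrable_on {0..1}" using g by (simp add: absolutely_integrable_on_def)
    show "(\<lambda>M. k M x) \<longlonglongrightarrow> 0" for x
    proof (rule tendsto_eventually)
      obtain m :: nat where "norm (g x) \<le> real m" using real_arch_simple by blast
      then have "k M x = 0" if "M \<ge> m" for M using that by (auto simp: k_def)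
      then show "\<forall>\<^sub>F M in sequentially. k M x = 0" by (auto simp: eventually_sequentially)
    qed
  qed (auto simp: k_def)
  then have "(\<lambda>M. integral {0..1} (k M)) \<longlonglongrightarrow> 0" by simp
  then have "\<forall>\<^sub>F M in sequentially. integral {0..1} (k M) < \<epsilon>/2"
    by (rule order_tendstoD) (use \<open>\<epsilon> > 0\<close> in auto)
  then obtain M where M: "integral {0..1} (k M) < \<epsilon>/2"
    by (auto simp: eventually_sequentially)
  show thesis
  proof
    show "\<epsilon> / (2 * (real M + 1)) > 0" using \<open>\<epsilon> > 0\<close> by simp
    fix n :: nat and a b :: "nat \<Rightarrow> real"
    assume ab: "\<And>i. i < n \<Longrightarrow> 0 \<le> a i \<and> a i \<le> b i \<and> b i \<le> 1"
      and disj: "disjoint_family_on (\<lambda>i. {a i<..<b i}) {..<n}"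
      and len: "(\<Sum>i<n. b i - a i) < \<epsilon> / (2 * (real M + 1))"
    have sub: "{a i..b i} \<subseteq> {0..1}" if "i < n" for i using ab [OF that] by auto
    have kint: "k M integrable_on {a i..b i}" if "i < n" for i
      using integrable_on_subinterval [OF _ sub [OF that]] k_abs [of M]
      by (auto simp: absolutely_integrable_on_def)
    have bnd: "norm (integral {a i..b i} g) \<le> real M * (b i - a i) + integral {a i..b i} (k M)" if "i < n" for i
    proof -
      have gi: "g integrable_on {a i..b i}"
        using integrable_on_subinterval [OF _ sub [OF that]] g by (auto simp: absolutely_integrable_on_def)
      have "norm (integral {a i..b i} g) \<le> integral {a i..b i} (\<lambda>x. real M + k M x)"
        using gi kint [OF that] by (intro integral_norm_bound_integral integrable_add) (auto, simp add: k_def)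
      also have "\<dots> = real M * (b i - a i) + integral {a i..b i} (k M)"
        using kint [OF that] ab [OF that] by (subst integral_add) auto
      finally show ?thesis .
    qed
    \<comment> \<open>Open intervals have the same integrals and are truly disjoint, so at each
      point at most one summand is nonzero.\<close>
    have "(\<Sum>i<n. integral {a i..b i} (k M)) = (\<Sum>i<n. integral {0..1} (\<lambda>x. if x \<in> {a i<..<b i} then k M x else 0))"
    proof (intro sum.cong refl)
      fix i assume "i \<in> {..<n}"
      then have "{a i<..<b i} \<inter> {0..1} = {a i<..<b i}" using sub [of i] by auto
      then show "integral {a i..b i} (k M) = integral {0..1} (\<lambda>x. if x \<in> {a i<..<b i} then k M x else 0)"
        unfolding integral_restrict_Int by (simp add: integral_open_interval_real)
    qed
    also have "\<dots> = integral {0..1} (\<lambda>x. \<Sum>i<n. if x \<in> {a i<..<b i} then k M x else 0)"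
    proof (rule integral_sum [symmetric])
      fix i assume "i \<in> {..<n}"
      then have "{a i<..<b i} \<inter> {0..1} = {a i<..<b i}" "k M integrable_on {a i<..<b i}"
        using sub [of i] kint [of i] by (auto simp: integrable_on_open_interval_real)
      then show "(\<lambda>x. if x \<in> {a i<..<b i} then k M x else 0) integrable_on {0..1}"
        unfolding integrable_restrict_Int by simp
    qed auto
    also have "\<dots> \<le> integral {0..1} (k M)"
    proof (rule integral_le)
      show "(\<lambda>x. \<Sum>i<n. if x \<in> {a i<..<b i} then k M x else 0) integrable_on {0..1}"
      proof (rule integrable_sum)
        fix i assume "i \<in> {..<n}"
        then have "{a i<..<b i} \<inter> {0..1} = {a i<..<b i}" "k M integrable_on {a i<..<b i}"
          using sub [of i] kint [of i] by (auto simp: integrable_on_open_interval_real)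
        then show "(\<lambda>x. if x \<in> {a i<..<b i} then k M x else 0) integrable_on {0..1}"
          unfolding integrable_restrict_Int by simp
      qed auto
      show "k M integrable_on {0..1}" using k_abs [of M] by (simp add: absolutely_integrable_on_def)
      fix x :: real
      show "(\<Sum>i<n. if x \<in> {a i<..<b i} then k M x else 0) \<le> k M x"
      proof (cases "\<exists>j<n. x \<in> {a j<..<b j}")
        case True
        then obtain j where j: "j < n" "x \<in> {a j<..<b j}" by blast
        have "x \<notin> {a i<..<b i}" if "i < n" "i \<noteq> j" for i
          using disj j that unfolding disjoint_family_on_def by blast
        then have "(\<Sum>i<n. if x \<in> {a i<..<b i} then k M x else 0) = (\<Sum>i<n. if i = j then k M x else 0)"
          using j by (intro sum.cong) auto
        then show ?thesis using j by simp
      next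
        case False
        then have "(\<Sum>i<n. if x \<in> {a i<..<b i} then k M x else 0) = 0" by (intro sum.neutral) auto
        then show ?thesis by (simp add: k_def)
      qed
    qed
    finally have K: "(\<Sum>i<n. integral {a i..b i} (k M)) < \<epsilon>/2" using M by simp
    have "(\<Sum>i<n. norm (integral {a i..b i} g)) \<le> (\<Sum>i<n. real M * (b i - a i) + integral {a i..b i} (k M))"
      using bnd by (intro sum_mono) auto
    also have "\<dots> = real M * (\<Sum>i<n. b i - a i) + (\<Sum>i<n. integral {a i..b i} (k M))"
      by (simp add: sum.distrib sum_distrib_left)
    also have "\<dots> < \<epsilon>/2 + \<epsilon>/2"
    proof (rule add_le_less_mono [OF _ K])
      have "real M * (\<Sum>i<n. b i - a i) \<le> real M * (\<epsilon> / (2 * (real M + 1)))"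
        using len by (intro mult_left_mono) auto
      also have "\<dots> \<le> \<epsilon>/2" using \<open>\<epsilon> > 0\<close> by (simp add: field_simps)
      finally show "real M * (\<Sum>i<n. b i - a i) \<le> \<epsilon>/2" .
    qed
    finally show "(\<Sum>i<n. norm (integral {a i..b i} g)) < \<epsilon>" by simp
  qed
qed

lemma primitive_diff:
  assumes "primitive F f" "0 \<le> a" "a \<le> b" "b \<le> 1"
  shows "F b - F a = integral {a..b} f"
proof -
  have "f integrable_on {0..b}"
    using primitive_integrable [OF assms(1), of 0 b] assms by simp
  then have "integral {0..a} f + integral {a..b} f = integral {0..b} f"
    using assms by (intro Henstock_Kurzweil_Integration.integral_combine) auto
  moreover have "F a = F 0 + integral {0..a} f" "F b = F 0 + integral {0..b} f"
    using assms by (intro primitive_eq [OF assms(1)]; simp)+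
  ultimately show ?thesis by (simp add: algebra_simps)
qed

lemma primitive_imp_AC01:
  assumes "primitive F f"
  shows "F \<in> AC01"
  unfolding AC01_def
proof (intro CollectI allI impI)
  fix \<epsilon> :: real assume "\<epsilon> > 0"
  then obtain d where d: "d > 0" "\<And>(n::nat) a b. (\<And>i. i < n \<Longrightarrow> 0 \<le> a i \<and> a i \<le> b i \<and> b i \<le> 1) \<Longrightarrow>
     disjoint_family_on (\<lambda>i. {a i<..<b i}) {..<n} \<Longrightarrow>
     (\<Sum>i<n. b i - a i) < d \<Longrightarrow> (\<Sum>i<n. norm (integral {a i..b i} f)) < \<epsilon>"
    using absolute_continuity_of_integral [OF assms [unfolded primitive_def, THEN conjunct1], of \<epsilon>] by blast
  show "\<exists>\<delta>>0. \<forall>(n::nat) (a::nat \<Rightarrow> real) b.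
     (\<forall>i<n. 0 \<le> a i \<and> a i \<le> b i \<and> b i \<le> 1) \<longrightarrow>
     disjoint_family_on (\<lambda>i. {a i<..<b i}) {..<n} \<longrightarrow>
     (\<Sum>i<n. b i - a i) < \<delta> \<longrightarrow> (\<Sum>i<n. norm (F (b i) - F (a i))) < \<epsilon>"
  proof (intro exI [of _ d] conjI allI impI d(1))
    fix n :: nat and a b :: "nat \<Rightarrow> real"
    assume *: "\<forall>i<n. 0 \<le> a i \<and> a i \<le> b i \<and> b i \<le> 1" "disjoint_family_on (\<lambda>i. {a i<..<b i}) {..<n}"
      "(\<Sum>i<n. b i - a i) < d"
    have "(\<Sum>i<n. norm (F (b i) - F (a i))) = (\<Sum>i<n. norm (integral {a i..b i} f))"
      using * by (intro sum.cong refl arg_cong [of _ _ norm] primitive_diff [OF assms]) auto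
    then show "(\<Sum>i<n. norm (F (b i) - F (a i))) < \<epsilon>" using d(2) [of n a b] * by simp
  qed
qed

lemma primitive_deriv:
  assumes "primitive F f"
  obtains N where "negligible N" "\<And>x. x \<in> {0<..<1} - N \<Longrightarrow> (F has_vector_derivative f x) (at x)"
proof -
  obtain N where N: "negligible N"
    "\<And>x. x \<in> {0<..<1} - N \<Longrightarrow> ((\<lambda>x. integral {0..x} f) has_vector_derivative f x) (at x)"
    using has_vector_derivative_integral_AE [of f] primitive_integrable [OF assms, of 0 1] by auto
  show thesis
  proof (rule that [OF N(1)])
    fix x assume x: "x \<in> {0<..<1} - N"
    have "((\<lambda>x. F 0 + integral {0..x} f) has_vector_derivative f x) (at x)"
      using has_vector_derivative_add [OF has_vector_derivative_const [of "F 0"] N(2) [OF x]] by simp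
    then show "(F has_vector_derivative f x) (at x)"
      by (rule has_vector_derivative_transform_within_open [of _ _ _ "{0<..<1}"])
         (use x in \<open>auto intro!: primitive_eq [OF assms, symmetric]\<close>)
  qed
qed

lemma primitive_cong_AE:
  assumes F: "primitive F f" and N: "negligible N" "\<And>x. x \<in> {0<..<1} - N \<Longrightarrow> f x = g x"
  shows "primitive F g"
proof -
  have N': "negligible (N \<union> {0, 1})" using N by (simp add: negligible_Un)
  have eq: "g x = f x" if "x \<in> {0..1} - (N \<union> {0, 1})" for x
  proof -
    have "x \<in> {0<..<1} - N" using that by (auto simp: less_le)
    then show ?thesis using N(2) by simp
  qed
  have "g absolutely_integrable_on {0..1}"
    using F unfolding primitive_def
    by (elim conjE) (rule absolutely_integrable_spike [OF _ N' eq])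
  moreover have "integral {0..x} f = integral {0..x} g" if "x \<in> {0..1}" for x
    by (rule integral_spike [OF N']) (use eq that in auto)
  ultimately show ?thesis using F unfolding primitive_def by metis
qed

text \<open>The way back from pointwise calculus to integral formulas: product and chain rule are
  applied almost everywhere, and absolute continuity is proved separately.\<close>

lemma primitive_of_AC01:
  assumes "F \<in> AC01" "negligible N" "\<And>x. x \<in> {0<..<1} - N \<Longrightarrow> (F has_vector_derivative f x) (at x)"
  shows "primitive F f"
proof -
  obtain g where g: "primitive F g" by (rule AC01_imp_primitive [OF assms(1)])
  obtain M where M: "negligible M" "\<And>x. x \<in> {0<..<1} - M \<Longrightarrow> (F has_vector_derivative g x) (at x)"
    by (rule primitive_deriv [OF g]) blast
  show ?thesis
  proof (rule primitive_cong_AE [OF g])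
    show "negligible (M \<union> N)" using M assms by (simp add: negligible_Un)
    fix x assume "x \<in> {0<..<1} - (M \<union> N)"
    then show "g x = f x" using M(2) [of x] assms(3) [of x] by (auto intro: vector_derivative_unique_at)
  qed
qed

lemma primitive_continuous_on:
  assumes "primitive F f"
  shows "continuous_on {0..1} F"
proof -
  have "continuous_on {0..1} (\<lambda>x. F 0 + integral {0..x} f)"
    by (intro continuous_intros indefinite_integral_continuous_1 primitive_integrable [OF assms]) auto
  then show ?thesis
    by (rule continuous_on_eq) (rule primitive_eq [OF assms, symmetric])
qed

lemma continuous_on_01_bounded:
  fixes F :: "real \<Rightarrow> 'b::real_normed_vector"
  assumes "continuous_on {0..1} F"
  obtains K where "K > 0" "\<And>x. x \<in> {0..1} \<Longrightarrow> norm (F x) \<le> K"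
proof -
  have "bounded (F ` {0..1})"
    by (intro compact_imp_bounded compact_continuous_image assms) auto
  then show thesis using that unfolding bounded_pos by auto
qed

lemma primitive_mult:
  fixes F G :: "real \<Rightarrow> complex"
  assumes F: "primitive F f" and G: "primitive G g"
  shows "primitive (\<lambda>x. F x * G x) (\<lambda>x. F x * g x + f x * G x)"
proof -
  obtain K where K: "K > 0" "\<And>x. x \<in> {0..1} \<Longrightarrow> norm (F x) \<le> K"
    by (rule continuous_on_01_bounded [OF primitive_continuous_on [OF F]]) blast
  obtain L where L: "L > 0" "\<And>x. x \<in> {0..1} \<Longrightarrow> norm (G x) \<le> L"
    by (rule continuous_on_01_bounded [OF primitive_continuous_on [OF G]]) blast
  have AC: "(\<lambda>x. F x * G x) \<in> AC01"
  proof (rule AC01_dominated [OF primitive_imp_AC01 [OF F] primitive_imp_AC01 [OF G]])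
    show "K + L \<ge> 0" using K L by simp
    fix s t :: real assume st: "s \<in> {0..1}" "t \<in> {0..1}"
    have "F s * G s - F t * G t = F s * (G s - G t) + (F s - F t) * G t" by (simp add: algebra_simps)
    then have "norm (F s * G s - F t * G t) \<le> norm (F s) * norm (G s - G t) + norm (F s - F t) * norm (G t)"
      by (metis norm_mult norm_triangle_ineq)
    also have "\<dots> \<le> (K + L) * norm (G s - G t) + norm (F s - F t) * (K + L)"
      using K L st by (intro add_mono mult_left_mono mult_right_mono) (auto intro: add_increasing add_increasing2 less_imp_le)
    finally show "norm (F s * G s - F t * G t) \<le> (K + L) * (norm (F s - F t) + norm (G s - G t))"
      by (simp add: algebra_simps)
  qed
  obtain N where N: "negligible N" "\<And>x. x \<in> {0<..<1} - N \<Longrightarrow> (F has_vector_derivative f x) (at x)"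
    by (rule primitive_deriv [OF F]) blast
  obtain M where M: "negligible M" "\<And>x. x \<in> {0<..<1} - M \<Longrightarrow> (G has_vector_derivative g x) (at x)"
    by (rule primitive_deriv [OF G]) blast
  show ?thesis
  proof (rule primitive_of_AC01 [OF AC])
    show "negligible (M \<union> N)" using M N by (simp add: negligible_Un)
    fix x assume "x \<in> {0<..<1} - (M \<union> N)"
    then show "((\<lambda>x. F x * G x) has_vector_derivative F x * g x + f x * G x) (at x)"
      using M(2) [of x] N(2) [of x] by (intro has_vector_derivative_mult) auto
  qed
qed

lemma primitive_linear:
  assumes F: "primitive F f" and h: "bounded_linear h"
  shows "primitive (\<lambda>x. h (F x)) (\<lambda>x. h (f x))"
  unfolding primitive_def
proof (intro conjI ballI)
  show "(\<lambda>x. h (f x)) absolutely_integrable_on {0..1}"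
    using absolutely_integrable_linear [OF primitive_abs [OF F] h] by (simp add: o_def)
  fix x :: real assume x: "x \<in> {0..1}"
  then have "f integrable_on {0..x}" by (intro primitive_integrable [OF F]) auto
  then have "integral {0..x} (\<lambda>t. h (f t)) = h (integral {0..x} f)"
    using integral_linear [OF _ h] by (simp add: o_def)
  then show "h (F x) = h (F 0) + integral {0..x} (\<lambda>t. h (f t))"
    using primitive_eq [OF F x] linear_add [OF bounded_linear.linear [OF h]] by simp
qed

lemma primitive_add:
  assumes F: "primitive F f" and G: "primitive G g"
  shows "primitive (\<lambda>x. F x + G x) (\<lambda>x. f x + g x)"
  unfolding primitive_def
proof (intro conjI ballI)
  show "(\<lambda>x. f x + g x) absolutely_integrable_on {0..1}"
    using F G by (intro set_integral_add primitive_abs)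
  fix x :: real assume x: "x \<in> {0..1}"
  then have "integral {0..x} (\<lambda>t. f t + g t) = integral {0..x} f + integral {0..x} g"
    by (intro integral_add primitive_integrable [OF F] primitive_integrable [OF G]) auto
  then show "F x + G x = F 0 + G 0 + integral {0..x} (\<lambda>t. f t + g t)"
    using primitive_eq [OF F x] primitive_eq [OF G x] by simp
qed

section \<open>Square integrable functions\<close>

lemma integrable_leb01_iff:
  fixes f :: "real \<Rightarrow> 'b::euclidean_space"
  shows "integrable leb01 f \<longleftrightarrow> f absolutely_integrable_on {0..1}"
  by (simp add: set_integrable_def integrable_restrict_space)

lemma ae_eq_iff:
  "f =\<^sub>a\<^sub>e g \<longleftrightarrow> (\<exists>N. negligible N \<and> (\<forall>x\<in>{0..1} - N. f x = g x))"
proof -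
  have "f =\<^sub>a\<^sub>e g \<longleftrightarrow> (AE x in lebesgue. x \<in> {0..1} \<longrightarrow> f x = g x)"
    unfolding ae_eq_def by (subst AE_restrict_space_iff) auto
  also have "\<dots> \<longleftrightarrow> negligible {x. \<not> (x \<in> {0..1} \<longrightarrow> f x = g x)}"
    by (simp add: completion.AE_iff_null_sets negligible_iff_null_sets)
  also have "\<dots> \<longleftrightarrow> (\<exists>N. negligible N \<and> (\<forall>x\<in>{0..1} - N. f x = g x))"
  proof
    assume "negligible {x. \<not> (x \<in> {0..1} \<longrightarrow> f x = g x)}"
    then show "\<exists>N. negligible N \<and> (\<forall>x\<in>{0..1} - N. f x = g x)"
      by (intro exI conjI) auto
  next
    assume "\<exists>N. negligible N \<and> (\<forall>x\<in>{0..1} - N. f x = g x)"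
    then show "negligible {x. \<not> (x \<in> {0..1} \<longrightarrow> f x = g x)}"
      by (elim exE conjE) (rule negligible_subset, auto)
  qed
  finally show ?thesis .
qed

lemma ae_eq_refl: "f =\<^sub>a\<^sub>e f"
  and ae_eq_sym: "f =\<^sub>a\<^sub>e g \<Longrightarrow> g =\<^sub>a\<^sub>e f"
  and ae_eq_trans: "f =\<^sub>a\<^sub>e g \<Longrightarrow> g =\<^sub>a\<^sub>e h \<Longrightarrow> f =\<^sub>a\<^sub>e h"
  unfolding ae_eq_def by auto

lemma ae_eq_comp2: "f =\<^sub>a\<^sub>e f' \<Longrightarrow> g =\<^sub>a\<^sub>e g' \<Longrightarrow> (\<lambda>x. h x (f x) (g x)) =\<^sub>a\<^sub>e (\<lambda>x. h x (f' x) (g' x))"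
  unfolding ae_eq_def by (elim AE_mp, rule AE_I2) auto

lemma ae_eq_comp: "f =\<^sub>a\<^sub>e f' \<Longrightarrow> (\<lambda>x. h x (f x)) =\<^sub>a\<^sub>e (\<lambda>x. h x (f' x))"
  unfolding ae_eq_def by (elim AE_mp, rule AE_I2) auto

lemma ae_eq_on: "(\<And>x. x \<in> {0..1} \<Longrightarrow> f x = g x) \<Longrightarrow> f =\<^sub>a\<^sub>e g"
  unfolding ae_eq_def by (intro AE_I2) auto

lemma integral_ae_cong:
  fixes f g :: "real \<Rightarrow> 'b::euclidean_space"
  assumes "f =\<^sub>a\<^sub>e g"
  shows "integral {0..1} f = integral {0..1} g"
proof -
  obtain N where N: "negligible N" "\<And>x. x \<in> {0..1} - N \<Longrightarrow> f x = g x"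
    using assms by (auto simp: ae_eq_iff)
  show ?thesis by (rule integral_spike [OF N(1)]) (simp add: N(2))
qed

text \<open>Turns identities in L_2 into pointwise ones, on which every argument with boundary or
  initial values depends.\<close>

lemma continuous_ae_eq_imp_eq:
  fixes f g :: "real \<Rightarrow> complex"
  assumes f: "continuous_on {0..1} f" and g: "continuous_on {0..1} g"
    and ae: "f =\<^sub>a\<^sub>e g" and x: "x \<in> {0..1}"
  shows "f x = g x"
proof -
  have cont: "continuous_on {0..1} (\<lambda>x. norm (f x - g x))"
    by (intro continuous_intros f g)
  have "(\<lambda>x. norm (f x - g x)) =\<^sub>a\<^sub>e (\<lambda>x. norm (g x - g x))"
    by (rule ae_eq_comp [OF ae])
  then have "integral {0..1} (\<lambda>x. norm (f x - g x)) = 0"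
    using integral_ae_cong by fastforce
  then have "((\<lambda>x. norm (f x - g x)) has_integral 0) (cbox 0 1)"
    using integrable_continuous_real [OF cont] by (simp add: has_integral_iff)
  then have "norm (f x - g x) = 0"
    by (rule has_integral_0_cbox_imp_0 [rotated 2]) (use cont x in auto)
  then show ?thesis by simp
qed

lemma L2_measurable: "f \<in> L2 \<Longrightarrow> f \<in> borel_measurable leb01"
  by (simp add: L2_def)

lemma L2_norm_sq_integrable:
  "f \<in> L2 \<Longrightarrow> (\<lambda>x. (norm (f x))\<^sup>2) absolutely_integrable_on {0..1}"
  by (simp add: L2_def integrable_leb01_iff)

lemma L2_I:
  fixes f :: "real \<Rightarrow> 'b::euclidean_space"
  assumes "f \<in> borel_measurable leb01" "g integrable_on {0..1}"
    "\<And>x. x \<in> {0..1} \<Longrightarrow> (norm (f x))\<^sup>2 \<le> g x"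
  shows "f \<in> L2"
proof -
  have "(\<lambda>x. (norm (f x))\<^sup>2) absolutely_integrable_on {0..1}"
    using assms
    by (intro measurable_bounded_by_integrable_imp_absolutely_integrable [of _ "{0..1}" g]) auto
  then show ?thesis using assms(1) by (simp add: L2_def integrable_leb01_iff)
qed

lemma L2_mult_absolutely_integrable:
  fixes f g :: "real \<Rightarrow> complex"
  assumes "f \<in> L2" "g \<in> L2"
  shows "(\<lambda>x. f x * g x) absolutely_integrable_on {0..1}"
proof (rule measurable_bounded_by_integrable_imp_absolutely_integrable)
  show "(\<lambda>x. f x * g x) \<in> borel_measurable leb01"
    using assms by (intro borel_measurable_times L2_measurable)
  show "(\<lambda>x. (norm (f x))\<^sup>2 + (norm (g x))\<^sup>2) integrable_on {0..1}"
    using assms [THEN L2_norm_sq_integrable]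
    by (intro integrable_add) (auto simp: absolutely_integrable_on_def)
  show "norm (f x * g x) \<le> (norm (f x))\<^sup>2 + (norm (g x))\<^sup>2" for x
  proof -
    have "0 \<le> (norm (f x) - norm (g x))\<^sup>2" "0 \<le> (norm (f x))\<^sup>2 + (norm (g x))\<^sup>2" by simp_all
    then show ?thesis unfolding norm_mult power2_diff by linarith
  qed
qed auto

lemma L2_cnj: "f \<in> L2 \<Longrightarrow> (\<lambda>x. cnj (f x)) \<in> L2"
  using borel_measurable_continuous_onI [OF continuous_on_cnj [OF continuous_on_id]]
  by (auto simp: L2_def intro: measurable_compose)

lemma continuous_imp_L2:
  fixes f :: "real \<Rightarrow> 'b::euclidean_space"
  assumes "continuous_on {0..1} f"
  shows "f \<in> L2"
proof (rule L2_I)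
  show "f \<in> borel_measurable leb01" by (rule continuous_imp_measurable_on_sets_lebesgue [OF assms]) auto
  show "(\<lambda>x. (norm (f x))\<^sup>2) integrable_on {0..1}"
    by (intro integrable_continuous_real continuous_intros assms)
qed simp

lemma L2_imp_absolutely_integrable:
  fixes f :: "real \<Rightarrow> complex"
  assumes "f \<in> L2"
  shows "f absolutely_integrable_on {0..1}"
  using L2_mult_absolutely_integrable [OF assms continuous_imp_L2 [of "\<lambda>x. 1"]] by simp

lemma L2_of_real: "r \<in> L2 \<Longrightarrow> (\<lambda>x. complex_of_real (r x)) \<in> L2"
  by (auto simp: L2_def)

lemma L2_mult_continuous:
  fixes f g :: "real \<Rightarrow> complex"
  assumes f: "f \<in> L2" and g: "continuous_on {0..1} g"
  shows "(\<lambda>x. f x * g x) \<in> L2"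
proof -
  obtain K where K: "K > 0" "\<And>x. x \<in> {0..1} \<Longrightarrow> norm (g x) \<le> K"
    by (rule continuous_on_01_bounded [OF g]) blast
  show ?thesis
  proof (rule L2_I)
    show "(\<lambda>x. f x * g x) \<in> borel_measurable leb01"
      by (intro borel_measurable_times L2_measurable f continuous_imp_L2 g)
    show "(\<lambda>x. (norm (f x))\<^sup>2 * K\<^sup>2) integrable_on {0..1}"
      using L2_norm_sq_integrable [OF f] by (intro integrable_on_mult_left) (auto simp: absolutely_integrable_on_def)
    show "(norm (f x * g x))\<^sup>2 \<le> (norm (f x))\<^sup>2 * K\<^sup>2" if "x \<in> {0..1}" for x
      using K(2) [OF that] by (auto simp: norm_mult power_mult_distrib intro!: mult_left_mono power_mono)
  qed
qed

lemma L2_add: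
  fixes f g :: "real \<Rightarrow> complex"
  assumes f: "f \<in> L2" and g: "g \<in> L2"
  shows "(\<lambda>x. f x + g x) \<in> L2"
proof (rule L2_I)
  show "(\<lambda>x. f x + g x) \<in> borel_measurable leb01"
    using assms by (intro borel_measurable_add L2_measurable)
  show "(\<lambda>x. 2 * (norm (f x))\<^sup>2 + 2 * (norm (g x))\<^sup>2) integrable_on {0..1}"
    using assms [THEN L2_norm_sq_integrable]
    by (intro integrable_add integrable_on_mult_right) (auto simp: absolutely_integrable_on_def)
  show "(norm (f x + g x))\<^sup>2 \<le> 2 * (norm (f x))\<^sup>2 + 2 * (norm (g x))\<^sup>2" for x
  proof -
    have "(norm (f x + g x))\<^sup>2 \<le> (norm (f x) + norm (g x))\<^sup>2"
      by (intro power_mono norm_triangle_ineq) auto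
    moreover have "0 \<le> (norm (f x) - norm (g x))\<^sup>2" by simp
    ultimately show ?thesis unfolding power2_sum power2_diff by linarith
  qed
qed

lemma L2_scale: "f \<in> L2 \<Longrightarrow> (\<lambda>x. (c::complex) * f x) \<in> L2"
  using L2_mult_continuous [of f "\<lambda>_. c"] by (simp add: mult.commute)

lemma L2_diff:
  fixes f g :: "real \<Rightarrow> complex"
  shows "f \<in> L2 \<Longrightarrow> g \<in> L2 \<Longrightarrow> (\<lambda>x. f x - g x) \<in> L2"
  using L2_add [of f "\<lambda>x. -1 * g x"] L2_scale [of g "-1"] by simp

lemma L2_sum:
  "(\<And>i. i \<in> I \<Longrightarrow> f i \<in> L2) \<Longrightarrow> (\<lambda>x. \<Sum>i\<in>I. (f i x :: complex)) \<in> L2"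
  by (induction I rule: infinite_finite_induct) (auto intro: L2_add continuous_imp_L2)

lemma L2_ae_cong:
  fixes f g :: "real \<Rightarrow> complex"
  assumes f: "f \<in> L2" and ae: "f =\<^sub>a\<^sub>e g"
  shows "g \<in> L2"
proof -
  obtain N where N: "negligible N" "\<And>x. x \<in> {0..1} - N \<Longrightarrow> g x = f x"
    using ae by (auto simp: ae_eq_iff)
  have "g absolutely_integrable_on {0..1}"
    using absolutely_integrable_spike [OF L2_imp_absolutely_integrable [OF f] N] .
  then have "g \<in> borel_measurable leb01"
    by (rule absolutely_integrable_imp_borel_measurable) auto
  moreover have "(\<lambda>x. (norm (g x))\<^sup>2) absolutely_integrable_on {0..1}"
    by (rule absolutely_integrable_spike [OF L2_norm_sq_integrable [OF f] N(1)]) (simp add: N(2))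
  ultimately show ?thesis by (simp add: L2_def integrable_leb01_iff)
qed

section \<open>Inner product and norm\<close>

lemma L2_inner_integral:
  assumes "f \<in> L2" "g \<in> L2"
  shows "L2_inner f g = integral {0..1} (\<lambda>x. f x * cnj (g x))"
  unfolding L2_inner_def using L2_mult_absolutely_integrable [OF assms(1) L2_cnj [OF assms(2)]]
  by (intro lebesgue_integral_eq_integral) (simp_all add: integrable_leb01_iff)

lemma L2_norm_sq: "(L2_norm f)\<^sup>2 = (LINT x|leb01. (norm (f x))\<^sup>2)"
  unfolding L2_norm_def by (rule real_sqrt_pow2) (rule integral_nonneg_AE, simp)

lemma L2_norm_nonneg: "L2_norm f \<ge> 0"
  by (simp add: L2_norm_def)

lemma L2_norm_sq_integral: "f \<in> L2 \<Longrightarrow> (L2_norm f)\<^sup>2 = integral {0..1} (\<lambda>x. (norm (f x))\<^sup>2)"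
  unfolding L2_norm_sq by (intro lebesgue_integral_eq_integral)
    (auto simp: L2_def)

lemma L2_inner_self: "L2_inner f f = of_real ((L2_norm f)\<^sup>2)"
  unfolding L2_norm_sq L2_inner_def
  by (simp add: complex_norm_square [symmetric] flip: of_real_power)

lemma L2_inner_cnj: "cnj (L2_inner f g) = L2_inner g f"
  unfolding L2_inner_def by (subst Bochner_Integration.integral_cnj [symmetric]) (simp add: mult.commute)

lemma L2_inner_add_left:
  assumes "f \<in> L2" "g \<in> L2" "h \<in> L2"
  shows "L2_inner (\<lambda>x. f x + g x) h = L2_inner f h + L2_inner g h"
  unfolding L2_inner_def
  using L2_mult_absolutely_integrable [OF assms(1) L2_cnj [OF assms(3)]]
    L2_mult_absolutely_integrable [OF assms(2) L2_cnj [OF assms(3)]]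
  by (simp add: ring_distribs integrable_leb01_iff)

lemma L2_inner_scale_left: "L2_inner (\<lambda>x. c * f x) g = c * L2_inner f g"
  unfolding L2_inner_def by (simp add: mult.assoc)

lemma L2_inner_add_right:
  assumes "f \<in> L2" "g \<in> L2" "h \<in> L2"
  shows "L2_inner h (\<lambda>x. f x + g x) = L2_inner h f + L2_inner h g"
  by (metis L2_inner_add_left [OF assms] L2_inner_cnj complex_cnj_add)

lemma L2_inner_scale_right: "L2_inner f (\<lambda>x. c * g x) = cnj c * L2_inner f g"
  by (metis L2_inner_scale_left L2_inner_cnj complex_cnj_mult)

lemma L2_inner_diff_left:
  assumes "f \<in> L2" "g \<in> L2" "h \<in> L2"
  shows "L2_inner (\<lambda>x. f x - g x) h = L2_inner f h - L2_inner g h"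
  using L2_inner_add_left [OF assms(1) L2_scale [OF assms(2), of "-1"] assms(3)]
    L2_inner_scale_left [of "-1" g h] by simp

lemma L2_inner_ae_cong: 
  fixes f :: "real \<Rightarrow> complex"
  assumes "f =\<^sub>a\<^sub>e f'" "g =\<^sub>a\<^sub>e g'" "f \<in> L2" "g \<in> L2"
  shows "L2_inner f g = L2_inner f' g'"
proof -
  have "f' \<in> L2" "g' \<in> L2" using assms L2_ae_cong by blast+
  then show ?thesis
    using assms by (simp add: L2_inner_integral integral_ae_cong [OF ae_eq_comp2 [OF assms(1,2), of "\<lambda>_ a b. a * cnj b"]])
qed

lemma L2_norm_ae_cong:
  fixes f :: "real \<Rightarrow> complex"
  assumes "f =\<^sub>a\<^sub>e f'" "f \<in> L2"
  shows "L2_norm f = L2_norm f'"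
proof -
  have "complex_of_real ((L2_norm f)\<^sup>2) = of_real ((L2_norm f')\<^sup>2)"
    unfolding L2_inner_self [symmetric] by (rule L2_inner_ae_cong [OF assms(1,1,2,2)])
  then show ?thesis
    unfolding of_real_eq_iff by (metis L2_norm_nonneg power2_eq_iff_nonneg)
qed

text \<open>Only the expansion of a nonnegative form along a line enters, so the lemma serves the
  inner product, the shifted form in \<open>residual_le\<close> and the energy on an orthogonal
  complement. The optimal parameter is t = - cnj B / C.\<close>

lemma hermitian_Cauchy_Schwarz:
  fixes B :: complex
  assumes pos: "\<And>t::complex. 0 \<le> A + 2 * Re (t * B) + (norm t)\<^sup>2 * C" and C: "C \<ge> 0"
  shows "(norm B)\<^sup>2 \<le> A * C"
proof -
  have BB: "Re (cnj B * B) = (norm B)\<^sup>2"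
    by (metis Re_complex_of_real complex_norm_square mult.commute of_real_power)
  have *: "0 \<le> A - 2 * s * (norm B)\<^sup>2 + s\<^sup>2 * (norm B)\<^sup>2 * C" for s
  proof -
    have "- of_real s * cnj B * B = of_real (- s * (norm B)\<^sup>2)"
      by (simp add: complex_norm_square [symmetric] mult.assoc mult.commute [of "cnj B"])
    then have "Re (- of_real s * cnj B * B) = - s * (norm B)\<^sup>2"
      by (metis Re_complex_of_real)
    then show ?thesis
      using pos [of "- of_real s * cnj B"] by (simp add: norm_mult power_mult_distrib)
  qed
  show ?thesis
  proof (cases "C = 0")
    case True
    have "(norm B)\<^sup>2 = 0"
    proof (rule ccontr)
      assume "(norm B)\<^sup>2 \<noteq> 0"
      \<comment> \<open>For \<open>C = 0\<close> the expansion is linear in \<open>s\<close>, and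
        this \<open>s\<close> gives it the value -1.\<close>
      then show False using * [of "(A + 1) / (2 * (norm B)\<^sup>2)"] True by (simp add: field_simps)
    qed
    then show ?thesis using True by simp
  next
    case False
    with C have "C > 0" by simp
    then have "0 \<le> (A - 2 * (1/C) * (norm B)\<^sup>2 + (1/C)\<^sup>2 * (norm B)\<^sup>2 * C) * C"
      using * [of "1/C"] by simp
    also have "\<dots> = A * C - (norm B)\<^sup>2"
      using \<open>C > 0\<close> by (simp add: field_simps power2_eq_square)
    finally show ?thesis by simp
  qed
qed

lemma L2_norm_add_sq:
  assumes "f \<in> L2" "g \<in> L2"
  shows "(L2_norm (\<lambda>x. f x + c * g x))\<^sup>2 =
    (L2_norm f)\<^sup>2 + 2 * Re (c * L2_inner g f) + (norm c)\<^sup>2 * (L2_norm g)\<^sup>2"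
proof -
  have g: "(\<lambda>x. c * g x) \<in> L2" by (rule L2_scale [OF assms(2)])
  have "complex_of_real ((L2_norm (\<lambda>x. f x + c * g x))\<^sup>2) =
      L2_inner f f + c * L2_inner g f + cnj c * L2_inner f g + c * cnj c * L2_inner g g"
    unfolding L2_inner_self [symmetric]
    using assms g L2_add [OF assms(1) g]
    by (simp add: L2_inner_add_left L2_inner_add_right L2_inner_scale_left L2_inner_scale_right algebra_simps)
  also have "cnj c * L2_inner f g = cnj (c * L2_inner g f)" by (simp add: L2_inner_cnj)
  also have "c * cnj c = of_real ((norm c)\<^sup>2)" using complex_norm_square [of c] by simp
  finally have "complex_of_real ((L2_norm (\<lambda>x. f x + c * g x))\<^sup>2) =
      of_real ((L2_norm f)\<^sup>2) + (c * L2_inner g f + cnj (c * L2_inner g f)) + of_real ((norm c)\<^sup>2 * (L2_norm g)\<^sup>2)"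
    by (simp add: L2_inner_self)
  then show ?thesis
    unfolding complex_add_cnj of_real_add [symmetric] of_real_eq_iff by simp
qed

lemma L2_Cauchy_Schwarz:
  assumes "f \<in> L2" "g \<in> L2"
  shows "norm (L2_inner f g) \<le> L2_norm f * L2_norm g"
proof -
  have "(norm (L2_inner g f))\<^sup>2 \<le> (L2_norm f)\<^sup>2 * (L2_norm g)\<^sup>2"
    by (rule hermitian_Cauchy_Schwarz) (simp_all only: L2_norm_add_sq [OF assms, symmetric] zero_le_power2)
  then have "norm (L2_inner g f) \<le> L2_norm f * L2_norm g"
    unfolding power_mult_distrib [symmetric]
    by (rule power2_le_imp_le) (simp add: L2_norm_nonneg)
  moreover have "norm (L2_inner f g) = norm (L2_inner g f)"
    by (metis L2_inner_cnj complex_mod_cnj)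
  ultimately show ?thesis by simp
qed

lemma L2_norm_scale: "L2_norm (\<lambda>x. c * f x) = norm c * L2_norm f"
  by (simp add: L2_norm_def norm_mult power_mult_distrib real_sqrt_mult)

lemma L2_norm_triangle:
  assumes "f \<in> L2" "g \<in> L2"
  shows "L2_norm (\<lambda>x. f x + g x) \<le> L2_norm f + L2_norm g"
proof (rule power2_le_imp_le)
  have "Re (L2_inner g f) \<le> L2_norm g * L2_norm f"
    using L2_Cauchy_Schwarz [OF assms(2,1)] complex_Re_le_cmod order_trans by blast
  then show "(L2_norm (\<lambda>x. f x + g x))\<^sup>2 \<le> (L2_norm f + L2_norm g)\<^sup>2"
    using L2_norm_add_sq [OF assms, of 1] by (simp add: power2_sum mult.commute)
qed (simp add: L2_norm_nonneg)

lemma L2_norm_le_sup: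
  assumes f: "continuous_on {0..1} f" and K: "\<And>x. x \<in> {0..1} \<Longrightarrow> norm (f x) \<le> K"
  shows "L2_norm f \<le> K"
proof (rule power2_le_imp_le)
  have "integral {0..1} (\<lambda>x. (norm (f x))\<^sup>2) \<le> integral {0..1} (\<lambda>x::real. K\<^sup>2)"
    using K by (intro integral_le integrable_continuous_real continuous_intros f power_mono) auto
  then show "(L2_norm f)\<^sup>2 \<le> K\<^sup>2"
    using L2_norm_sq_integral [OF continuous_imp_L2 [OF f]] by simp
  show "0 \<le> K" using order_trans [OF norm_ge_zero K [of 0]] by simp
qed

lemma L1_norm_le_L2_norm:
  assumes "f \<in> L2"
  shows "integral {0..1} (\<lambda>x. norm (f x)) \<le> L2_norm f"
proof -
  let ?g = "\<lambda>x. complex_of_real (norm (f x))"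
  have g: "?g \<in> L2" using assms by (auto simp: L2_def)
  have "((\<lambda>x. norm (f x)) has_integral integral {0..1} (\<lambda>x. norm (f x))) {0..1}"
    using L2_imp_absolutely_integrable [OF assms]
    by (auto simp: absolutely_integrable_on_def has_integral_iff)
  then have "(?g has_integral of_real (integral {0..1} (\<lambda>x. norm (f x)))) {0..1}"
    by (rule has_integral_of_real)
  then have "L2_inner ?g (\<lambda>_. 1) = of_real (integral {0..1} (\<lambda>x. norm (f x)))"
    using L2_inner_integral [OF g continuous_imp_L2 [of "\<lambda>_. 1"]] by (simp add: integral_unique)
  moreover have "norm (L2_inner ?g (\<lambda>_. 1)) \<le> L2_norm ?g * L2_norm (\<lambda>_. 1)"
    by (intro L2_Cauchy_Schwarz g continuous_imp_L2 continuous_intros)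
  moreover have "L2_norm (\<lambda>_. 1) \<le> 1" by (rule L2_norm_le_sup) auto
  moreover have "L2_norm ?g = L2_norm f" by (simp add: L2_norm_def)
  ultimately show ?thesis
    using L2_norm_nonneg [of f] mult_left_le [of "L2_norm (\<lambda>_. 1)" "L2_norm f"] by auto
qed

lemma L2_norm_zero_imp_ae:
  fixes f :: "real \<Rightarrow> complex"
  assumes "f \<in> L2" "L2_norm f = 0"
  shows "f =\<^sub>a\<^sub>e (\<lambda>_. 0)"
proof -
  have "(LINT x|leb01. (norm (f x))\<^sup>2) = 0" using L2_norm_sq [of f] assms by simp
  then have "AE x in leb01. (norm (f x))\<^sup>2 = 0"
    using assms by (subst (asm) integral_nonneg_eq_0_iff_AE) (auto simp: L2_def)
  then show ?thesis by (simp add: ae_eq_def)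
qed

section \<open>Linear systems with integrable coefficients\<close>

text \<open>\<open>k\<close> is merely integrable, so the chain rule holds almost everywhere only;
  the integral formula follows because exp is Lipschitz on the bounded range of the exponent. The
  detour through complex values is due to the type of \<open>AC01\<close>.\<close>

lemma exp_primitive:
  fixes k :: "real \<Rightarrow> real"
  assumes k: "k absolutely_integrable_on {0..1}"
  defines "E \<equiv> (\<lambda>x. exp (2 * integral {0..x} k))"
  shows "primitive E (\<lambda>x. 2 * k x * E x)"
proof -
  let ?\<Phi> = "\<lambda>x. complex_of_real (2 * integral {0..x} k)"
  have "primitive (\<lambda>x. integral {0..x} k) k"
    using k by (simp add: primitive_def)
  then have \<Phi>: "primitive ?\<Phi> (\<lambda>x. complex_of_real (2 * k x))"
    by (rule primitive_linear)
      (intro bounded_linear_compose [OF bounded_linear_of_real] bounded_linear_mult_right)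
  obtain K where K: "K > 0" "\<And>x. x \<in> {0..1} \<Longrightarrow> norm (?\<Phi> x) \<le> K"
    by (rule continuous_on_01_bounded [OF primitive_continuous_on [OF \<Phi>]]) blast
  have exp_lip: "\<bar>exp a - exp b\<bar> \<le> exp K * \<bar>a - b\<bar>" if "a \<le> K" "b \<le> K" for a b
  proof -
    have *: "exp b - exp a \<le> exp K * (b - a)" if "a \<le> b" "b \<le> K" for a b
    proof -
      have "1 + (a - b) \<le> exp (a - b)" by (rule exp_ge_add_one_self)
      then have "exp b * (1 - exp (a - b)) \<le> exp b * (b - a)" by (intro mult_left_mono) (linarith, simp)
      also have "\<dots> \<le> exp K * (b - a)" using that by (intro mult_right_mono) auto
      finally show ?thesis by (simp add: right_diff_distrib flip: exp_add)
    qed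
    show ?thesis using * [of a b] * [of b a] that by (cases "a \<le> b") auto
  qed
  have EAC: "(\<lambda>x. complex_of_real (E x)) \<in> AC01"
  proof (rule AC01_dominated [OF primitive_imp_AC01 [OF \<Phi>] primitive_imp_AC01 [OF \<Phi>]])
    show "exp K \<ge> 0" by simp
    fix s t :: real assume "s \<in> {0..1}" "t \<in> {0..1}"
    then have "\<bar>E s - E t\<bar> \<le> exp K * \<bar>2 * integral {0..s} k - 2 * integral {0..t} k\<bar>"
      unfolding E_def using K(2) [of s] K(2) [of t] by (intro exp_lip) auto
    also have "\<dots> = exp K * norm (?\<Phi> s - ?\<Phi> t)"
      by (metis norm_of_real of_real_diff)
    also have "\<dots> \<le> exp K * (norm (?\<Phi> s - ?\<Phi> t) + norm (?\<Phi> s - ?\<Phi> t))"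
      by (intro mult_left_mono) auto
    finally show "norm (complex_of_real (E s) - complex_of_real (E t)) \<le> \<dots>"
      by (metis norm_of_real of_real_diff)
  qed
  obtain N where N: "negligible N" "\<And>x. x \<in> {0<..<1} - N \<Longrightarrow> ((\<lambda>x. integral {0..x} k) has_vector_derivative k x) (at x)"
    using has_vector_derivative_integral_AE [of k] k by (auto simp: absolutely_integrable_on_def)
  have "primitive (\<lambda>x. complex_of_real (E x)) (\<lambda>x. complex_of_real (2 * k x * E x))"
  proof (rule primitive_of_AC01 [OF EAC N(1)])
    fix x assume "x \<in> {0<..<1} - N"
    from N(2) [OF this] have "((\<lambda>x. integral {0..x} k) has_real_derivative k x) (at x)"
      by (simp add: has_real_derivative_iff_has_vector_derivative)
    then have "(E has_real_derivative 2 * k x * E x) (at x)"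
      unfolding E_def by (auto intro!: derivative_eq_intros)
    then have "(E has_vector_derivative 2 * k x * E x) (at x)"
      by (simp add: has_real_derivative_iff_has_vector_derivative)
    then show "((\<lambda>x. complex_of_real (E x)) has_vector_derivative complex_of_real (2 * k x * E x)) (at x)"
      by (rule bounded_linear.has_vector_derivative [OF bounded_linear_of_real])
  qed
  then have "primitive (\<lambda>x. Re (complex_of_real (E x))) (\<lambda>x. Re (complex_of_real (2 * k x * E x)))"
    by (rule primitive_linear) (rule bounded_linear_Re)
  then show ?thesis by simp
qed

text \<open>The gain is the factor 1/2: relative to the weight
  \<open>exp (2 * integral {0..x} k)\<close>, integration against \<open>k\<close> has norm at most
  1/2.\<close>

lemma integral_weight:
  fixes k :: "real \<Rightarrow> real"
  assumes k: "k absolutely_integrable_on {0..1}" and x: "x \<in> {0..1}"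
  shows "integral {0..x} (\<lambda>t. k t * exp (2 * integral {0..t} k)) = (exp (2 * integral {0..x} k) - 1) / 2"
proof -
  have "exp (2 * integral {0..x} k) = 1 + integral {0..x} (\<lambda>t. 2 * k t * exp (2 * integral {0..t} k))"
    using primitive_eq [OF exp_primitive [OF k] x] by simp
  also have "integral {0..x} (\<lambda>t. 2 * k t * exp (2 * integral {0..t} k))
      = 2 * integral {0..x} (\<lambda>t. k t * exp (2 * integral {0..t} k))"
    by (subst integral_mult_right [symmetric]) (simp add: mult.assoc)
  finally show ?thesis by simp
qed

text \<open>Gronwall's inequality with a crude constant. At a point \<open>z\<close> where the
  weighted norm of \<open>W\<close> attains its maximum \<open>s\<close>, the hypothesis and
  \<open>integral_weight\<close> give \<open>s * E z \<le> a + s * E z / 2\<close>; this produces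
  the factor 2.\<close>

lemma volterra_bound:
  fixes W :: "real \<Rightarrow> 'e::euclidean_space" and k :: "real \<Rightarrow> real"
  assumes k: "k absolutely_integrable_on {0..1}" "\<And>x. k x \<ge> 0" and W: "continuous_on {0..1} W"
    and a: "a \<ge> 0"
    and le: "\<And>x. x \<in> {0..1} \<Longrightarrow> norm (W x) \<le> a + integral {0..x} (\<lambda>t. k t * norm (W t))"
    and x: "x \<in> {0..1}"
  shows "norm (W x) \<le> 2 * a * exp (2 * integral {0..1} k)"
proof -
  define E where "E x = exp (2 * integral {0..x} k)" for x
  have k0: "k integrable_on {0..y}" if "y \<le> 1" for y
    using k(1) that by (auto simp: absolutely_integrable_on_def intro: integrable_on_subinterval)
  have kE: "primitive E (\<lambda>x. 2 * k x * E x)" using exp_primitive [OF k(1)] by (simp add: E_def [abs_def])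
  have contE: "continuous_on {0..1} E" by (rule primitive_continuous_on [OF kE])
  have Epos: "E y > 0" for y by (simp add: E_def)
  have "continuous_on {0..1} (\<lambda>x. norm (W x) / E x)"
    by (intro continuous_intros W contE) (use Epos in \<open>auto simp: less_imp_neq [symmetric]\<close>)
  then obtain z where z: "z \<in> {0..1}" "\<And>y. y \<in> {0..1} \<Longrightarrow> norm (W y) / E y \<le> norm (W z) / E z"
    using continuous_attains_sup [of "{0..1}" "\<lambda>x. norm (W x) / E x"] by auto
  define s where "s = norm (W z) / E z"
  have s: "s \<ge> 0" "norm (W y) \<le> s * E y" if "y \<in> {0..1}" for y
  proof -
    show "s \<ge> 0" using Epos [of z] by (simp add: s_def)
    show "norm (W y) \<le> s * E y" using z(2) [OF that] Epos [of y] by (simp add: s_def [symmetric] pos_divide_le_eq)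
  qed
  have kEint: "(\<lambda>t. k t * E t) integrable_on {0..z}"
    using integrable_on_mult_right [OF primitive_integrable [OF kE, of 0 z], of "1/2"] z(1)
    by (simp add: mult.assoc)
  have kWint: "(\<lambda>t. k t * norm (W t)) integrable_on {0..z}"
  proof -
    have "(\<lambda>t. norm (W t) * k t) absolutely_integrable_on {0..1}"
    proof (rule absolutely_integrable_bounded_measurable_product_real [OF _ _ _ k(1)])
      show "(\<lambda>t. norm (W t)) \<in> borel_measurable leb01"
        by (intro continuous_imp_measurable_on_sets_lebesgue continuous_intros W) auto
      show "bounded ((\<lambda>t. norm (W t)) ` {0..1})"
        by (intro compact_imp_bounded compact_continuous_image continuous_intros W) auto
    qed auto
    then show ?thesis
      using z(1) by (auto simp: mult.commute absolutely_integrable_on_def intro: integrable_on_subinterval)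
  qed
  have "norm (W z) \<le> a + integral {0..z} (\<lambda>t. k t * norm (W t))" by (rule le [OF z(1)])
  also have "\<dots> \<le> a + integral {0..z} (\<lambda>t. s * (k t * E t))"
  proof (intro add_left_mono integral_le kWint integrable_on_mult_right kEint)
    fix t assume "t \<in> {0..z}"
    then have "norm (W t) \<le> s * E t" using s(2) z(1) by auto
    then show "k t * norm (W t) \<le> s * (k t * E t)"
      using k(2) [of t] mult_left_mono [of "norm (W t)" "s * E t" "k t"] by (simp add: algebra_simps)
  qed
  also have "integral {0..z} (\<lambda>t. s * (k t * E t)) = s * ((E z - 1) / 2)"
    using integral_weight [OF k(1) z(1)] by (simp add: E_def)
  also have "\<dots> \<le> s * E z / 2" using s(1) [OF z(1)] by (simp add: field_simps)
  finally have "s * E z \<le> a + s * E z / 2" using Epos [of z] by (simp add: s_def)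
  then have "s * E z \<le> 2 * a" by simp
  moreover have "integral {0..z} k \<ge> 0" using k(2) by (intro integral_nonneg k0) (use z in auto)
  then have "E z \<ge> 1" by (simp add: E_def)
  then have "s * 1 \<le> s * E z" using s(1) [OF z(1)] by (intro mult_left_mono)
  ultimately have s2: "s \<le> 2 * a" by simp
  have "integral {0..x} k \<le> integral {0..1} k"
    using k x by (intro integral_subset_le k0) auto
  then have "E x \<le> exp (2 * integral {0..1} k)" by (simp add: E_def)
  moreover have "norm (W x) \<le> s * E x" using s(2) [OF x] .
  ultimately show ?thesis
    using s2 s(1) [OF x] Epos [of x] mult_mono [of s "2*a" "E x" "exp (2 * integral {0..1} k)"] a
    by linarith
qed

text \<open>The weight \<open>exp (2 \<integral>k)\<close> makes the Volterra operator a contraction with constant \<open>1/2\<close> on the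
  whole interval.\<close>

lemma volterra_exists:
  fixes N :: "real \<Rightarrow> 'e::euclidean_space \<Rightarrow> 'e" and k :: "real \<Rightarrow> real"
  assumes k: "k absolutely_integrable_on {0..1}" "\<And>x. k x \<ge> 0"
    and int: "\<And>W. continuous_on {0..1} W \<Longrightarrow> (\<lambda>t. N t (W t)) absolutely_integrable_on {0..1}"
    and lip: "\<And>t a b. norm (N t a - N t b) \<le> k t * norm (a - b)"
  obtains W where "primitive W (\<lambda>t. N t (W t))" "W 0 = w0"
proof -
  define E where "E x = exp (2 * integral {0..x} k)" for x
  have kE: "primitive E (\<lambda>x. 2 * k x * E x)" using exp_primitive [OF k(1)] by (simp add: E_def [abs_def])
  have contE: "continuous_on {0..1} E" by (rule primitive_continuous_on [OF kE])
  have Epos: "E y > 0" for y by (simp add: E_def)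
  \<comment> \<open>The fixed point theorem is used on bounded continuous functions on the whole
    line, so functions on [0,1] are extended constantly.\<close>
  define c where "c x = max 0 (min 1 x)" for x :: real
  have c01: "c x \<in> {0..1}" and c_id: "x \<in> {0..1} \<Longrightarrow> c x = x" for x by (auto simp: c_def)
  \<comment> \<open>The unknown is divided by the weight \<open>E\<close>, which turns the ordinary
    supremum distance into the weighted one.\<close>
  define S where "S w x = (1 / E x) *\<^sub>R (w0 + integral {0..x} (\<lambda>t. N t (E t *\<^sub>R w t)))"
    for w :: "real \<Rightarrow> 'e" and x
  have intw: "(\<lambda>t. N t (E t *\<^sub>R w t)) absolutely_integrable_on {0..1}" if "continuous_on UNIV w" for w :: "real \<Rightarrow> 'e"
    by (intro int continuous_intros contE continuous_on_subset [OF that]) auto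
  have contS: "continuous_on {0..1} (S w)" if "continuous_on UNIV w" for w
    unfolding S_def using intw [OF that] Epos
    by (intro continuous_intros contE indefinite_integral_continuous_1)
      (auto simp: absolutely_integrable_on_def less_imp_neq [symmetric])
  have inS: "(\<lambda>x. S w (c x)) \<in> bcontfun" if "continuous_on UNIV w" for w
    unfolding bcontfun_def
  proof (intro CollectI conjI)
    show "continuous_on UNIV (\<lambda>x. S w (c x))"
      by (rule continuous_on_compose2 [OF contS [OF that]])
        (auto simp: c_def intro!: continuous_intros)
    have "bounded (S w ` {0..1})"
      by (intro compact_imp_bounded compact_continuous_image contS that) auto
    then show "bounded (range (\<lambda>x. S w (c x)))"
      by (rule bounded_subset) (use c01 in auto)
  qed
  define T where "T w = Bcontfun (\<lambda>x. S (apply_bcontfun w) (c x))" for w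
  have T: "apply_bcontfun (T w) x = S (apply_bcontfun w) (c x)" for w x
    unfolding T_def by (subst Bcontfun_inverse) (auto intro: inS)
  have "dist (T v) (T w) \<le> 1/2 * dist v w" for v w
  proof (rule dist_bound)
    fix x
    let ?d = "dist v w" and ?x = "c x"
    have i: "(\<lambda>t. N t (E t *\<^sub>R apply_bcontfun u t)) integrable_on {0..?x}" for u
      using intw [of "apply_bcontfun u"] c01 [of x]
      by (auto simp: absolutely_integrable_on_def intro: integrable_on_subinterval)
    have kEint: "(\<lambda>t. k t * E t) integrable_on {0..?x}"
      using integrable_on_mult_right [OF primitive_integrable [OF kE, of 0 ?x], of "1/2"] c01 [of x]
      by (simp add: mult.assoc)
    have "norm (integral {0..?x} (\<lambda>t. N t (E t *\<^sub>R apply_bcontfun v t)) - integral {0..?x} (\<lambda>t. N t (E t *\<^sub>R apply_bcontfun w t)))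
        = norm (integral {0..?x} (\<lambda>t. N t (E t *\<^sub>R apply_bcontfun v t) - N t (E t *\<^sub>R apply_bcontfun w t)))"
      by (simp add: integral_diff i)
    also have "\<dots> \<le> integral {0..?x} (\<lambda>t. ?d * (k t * E t))"
    proof (intro integral_norm_bound_integral integrable_diff i integrable_on_mult_right kEint)
      fix t
      have "norm (N t (E t *\<^sub>R apply_bcontfun v t) - N t (E t *\<^sub>R apply_bcontfun w t))
          \<le> k t * norm (E t *\<^sub>R apply_bcontfun v t - E t *\<^sub>R apply_bcontfun w t)" by (rule lip)
      also have "\<dots> = k t * (E t * dist (apply_bcontfun v t) (apply_bcontfun w t))"
        using Epos [of t] by (simp add: dist_norm flip: scaleR_diff_right)
      also have "\<dots> \<le> k t * (E t * ?d)"
        using Epos [of t] k(2) [of t] by (intro mult_left_mono dist_bounded) auto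
      finally show "norm (N t (E t *\<^sub>R apply_bcontfun v t) - N t (E t *\<^sub>R apply_bcontfun w t)) \<le> ?d * (k t * E t)"
        by (simp add: algebra_simps)
    qed
    also have "\<dots> = ?d * ((E ?x - 1) / 2)"
      using integral_weight [OF k(1) c01 [of x]] by (simp add: E_def)
    also have "\<dots> \<le> ?d * (E ?x / 2)" by (intro mult_left_mono) auto
    finally have *: "norm (integral {0..?x} (\<lambda>t. N t (E t *\<^sub>R apply_bcontfun v t)) - integral {0..?x} (\<lambda>t. N t (E t *\<^sub>R apply_bcontfun w t)))
        \<le> ?d * (E ?x / 2)" .
    have "dist (apply_bcontfun (T v) x) (apply_bcontfun (T w) x)
        = (1 / E ?x) * norm (integral {0..?x} (\<lambda>t. N t (E t *\<^sub>R apply_bcontfun v t)) - integral {0..?x} (\<lambda>t. N t (E t *\<^sub>R apply_bcontfun w t)))"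
      unfolding T S_def dist_norm scaleR_diff_right [symmetric] using Epos [of ?x] by simp
    also have "\<dots> \<le> (1 / E ?x) * (?d * (E ?x / 2))"
      using * Epos [of ?x] by (intro mult_left_mono) auto
    finally show "dist (apply_bcontfun (T v) x) (apply_bcontfun (T w) x) \<le> 1/2 * ?d"
      using Epos [of ?x] by simp
  qed
  then obtain w where w: "T w = w" using banach_fix_type [of "1/2" T] by auto
  define W where "W x = E x *\<^sub>R apply_bcontfun w x" for x
  have Weq: "W x = w0 + integral {0..x} (\<lambda>t. N t (W t))" if "x \<in> {0..1}" for x
  proof -
    have "apply_bcontfun w x = S (apply_bcontfun w) x" using T [of w x] w c_id [OF that] by simp
    then show ?thesis using Epos [of x] by (simp add: W_def S_def)
  qed
  have W0: "W 0 = w0" using Weq [of 0] by simp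
  show thesis
  proof (rule that [of W, OF _ W0])
    show "primitive W (\<lambda>t. N t (W t))"
      unfolding primitive_def W0
    proof (intro conjI ballI Weq)
      show "(\<lambda>t. N t (W t)) absolutely_integrable_on {0..1}"
        unfolding W_def by (rule intw) auto
    qed
  qed
qed

section \<open>The operator \<open>A\<close>\<close>

text \<open>The system states \<open>\<ell>(y) = g\<close> with \<open>u = y\<^sup>[\<^sup>1\<^sup>]\<close>, without reference to the choice operator in
  \<open>AC_rep\<close>.\<close>

definition quasi_system :: "(real \<Rightarrow> real) \<Rightarrow> (real \<Rightarrow> complex) \<Rightarrow> (real \<Rightarrow> complex) \<Rightarrow> (real \<Rightarrow> complex) \<Rightarrow> bool" where
  "quasi_system r y u g \<longleftrightarrow> primitive y (\<lambda>x. of_real (r x) * y x + u x) \<and>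
     primitive u (\<lambda>x. - of_real (r x) * u x - (of_real (r x))\<^sup>2 * y x - g x)"

lemma primitive_cong:
  assumes "primitive F f" "\<And>x. x \<in> {0..1} \<Longrightarrow> F x = G x"
  shows "primitive G f"
  unfolding primitive_def
proof (intro conjI ballI)
  fix x :: real assume x: "x \<in> {0..1}"
  then show "G x = G 0 + integral {0..x} f"
    using primitive_eq [OF assms(1) x] assms(2) [OF x] assms(2) [of 0] by simp
qed (rule primitive_abs [OF assms(1)])

lemma primitive_ae_cong:
  assumes "primitive F f" "f =\<^sub>a\<^sub>e g"
  shows "primitive F g"
proof -
  obtain N where "negligible N" "\<And>x. x \<in> {0..1} - N \<Longrightarrow> f x = g x"
    using assms(2) by (auto simp: ae_eq_iff)
  then show ?thesis using assms(1) by (intro primitive_cong_AE [of F f N g]) auto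
qed

lemma primitive_vector_derivative:
  assumes "primitive F f"
  shows "(\<lambda>x. vector_derivative F (at x)) =\<^sub>a\<^sub>e f"
proof -
  obtain N where N: "negligible N" "\<And>x. x \<in> {0<..<1} - N \<Longrightarrow> (F has_vector_derivative f x) (at x)"
    by (rule primitive_deriv [OF assms]) blast
  \<comment> \<open>The endpoints join the exceptional set: \<open>at x\<close> is two-sided, and
    \<open>F\<close> is arbitrary outside [0,1].\<close>
  have "vector_derivative F (at x) = f x" if "x \<in> {0..1} - (N \<union> {0, 1})" for x
  proof -
    have "x \<in> {0<..<1} - N" using that by (auto simp: less_le)
    from N(2) [OF this] show ?thesis by (rule vector_derivative_at)
  qed
  moreover have "negligible (N \<union> {0, 1})" using N by (simp add: negligible_Un)
  ultimately show ?thesis unfolding ae_eq_iff by blast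
qed

lemma AC_rep:
  assumes "has_AC_rep f"
  shows "AC_rep f \<in> AC01" "AC_rep f =\<^sub>a\<^sub>e f"
proof -
  have "\<exists>u. u \<in> AC01 \<and> u =\<^sub>a\<^sub>e f" using assms by (auto simp: has_AC_rep_def)
  then have "AC_rep f \<in> AC01 \<and> AC_rep f =\<^sub>a\<^sub>e f"
    unfolding AC_rep_def by (rule someI_ex)
  then show "AC_rep f \<in> AC01" "AC_rep f =\<^sub>a\<^sub>e f" by auto
qed

lemma AC01_continuous_on: "f \<in> AC01 \<Longrightarrow> continuous_on {0..1} f"
  by (elim AC01_imp_primitive) (rule primitive_continuous_on)

lemma dom_ell_imp_quasi_system:
  assumes "y \<in> dom_ell r"
  shows "quasi_system r y (quasi_deriv r y) (ell r y)"
proof -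
  let ?u = "quasi_deriv r y"
  have y: "y \<in> AC01" and rep: "has_AC_rep (pre_quasi_deriv r y)" using assms by (auto simp: dom_ell_def)
  have u: "?u \<in> AC01" "?u =\<^sub>a\<^sub>e pre_quasi_deriv r y" using AC_rep [OF rep] by (auto simp: quasi_deriv_def)
  obtain g where g: "primitive y g" by (rule AC01_imp_primitive [OF y])
  obtain h where h: "primitive ?u h" by (rule AC01_imp_primitive [OF u(1)])
  have "(\<lambda>x. of_real (r x) * y x + ?u x) =\<^sub>a\<^sub>e (\<lambda>x. of_real (r x) * y x + pre_quasi_deriv r y x)"
    by (rule ae_eq_comp [OF u(2)])
  also have "\<dots> = (\<lambda>x. vector_derivative y (at x))" by (simp add: pre_quasi_deriv_def)
  finally have "g =\<^sub>a\<^sub>e (\<lambda>x. of_real (r x) * y x + ?u x)"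
    using primitive_vector_derivative [OF g] ae_eq_sym ae_eq_trans by blast
  with g have 1: "primitive y (\<lambda>x. of_real (r x) * y x + ?u x)" by (rule primitive_ae_cong)
  have "(\<lambda>x. vector_derivative ?u (at x)) = (\<lambda>x. - of_real (r x) * ?u x - (of_real (r x))\<^sup>2 * y x - ell r y x)"
    by (simp add: ell_def)
  with primitive_vector_derivative [OF h]
  have "h =\<^sub>a\<^sub>e (\<lambda>x. - of_real (r x) * ?u x - (of_real (r x))\<^sup>2 * y x - ell r y x)"
    by (metis ae_eq_sym)
  with h have "primitive ?u (\<lambda>x. - of_real (r x) * ?u x - (of_real (r x))\<^sup>2 * y x - ell r y x)"
    by (rule primitive_ae_cong)
  with 1 show ?thesis by (simp add: quasi_system_def)
qed

text \<open>\<open>quasi_deriv\<close> involves a choice, but whatever is chosen is continuous on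
  [0,1] and almost everywhere equal to \<open>u\<close>, hence equal to \<open>u\<close> there. So
  solving the system produces elements of the domain.\<close>

lemma quasi_system_imp_dom_ell:
  assumes s: "quasi_system r y u g" and g: "g \<in> L2"
  shows "y \<in> dom_ell r" "ell r y =\<^sub>a\<^sub>e g" "\<And>x. x \<in> {0..1} \<Longrightarrow> quasi_deriv r y x = u x"
proof -
  have y: "primitive y (\<lambda>x. of_real (r x) * y x + u x)"
    and u: "primitive u (\<lambda>x. - of_real (r x) * u x - (of_real (r x))\<^sup>2 * y x - g x)"
    using s by (auto simp: quasi_system_def)
  have uAC: "u \<in> AC01" by (rule primitive_imp_AC01 [OF u])
  have "pre_quasi_deriv r y =\<^sub>a\<^sub>e (\<lambda>x. (of_real (r x) * y x + u x) - of_real (r x) * y x)"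
    unfolding pre_quasi_deriv_def by (rule ae_eq_comp [OF primitive_vector_derivative [OF y]])
  then have pre: "u =\<^sub>a\<^sub>e pre_quasi_deriv r y" by (simp add: ae_eq_sym)
  then have rep: "has_AC_rep (pre_quasi_deriv r y)" using uAC by (auto simp: has_AC_rep_def)
  have qd: "quasi_deriv r y \<in> AC01" "quasi_deriv r y =\<^sub>a\<^sub>e u"
    using AC_rep [OF rep] pre ae_eq_sym ae_eq_trans unfolding quasi_deriv_def by blast+
  show eq: "quasi_deriv r y x = u x" if "x \<in> {0..1}" for x
    by (rule continuous_ae_eq_imp_eq [OF AC01_continuous_on [OF qd(1)] AC01_continuous_on [OF uAC] qd(2) that])
  then have "primitive (quasi_deriv r y) (\<lambda>x. - of_real (r x) * u x - (of_real (r x))\<^sup>2 * y x - g x)"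
    by (intro primitive_cong [OF u]) auto
  from primitive_vector_derivative [OF this]
  have "ell r y =\<^sub>a\<^sub>e (\<lambda>x. - (- of_real (r x) * u x - (of_real (r x))\<^sup>2 * y x - g x)
      - of_real (r x) * u x - (of_real (r x))\<^sup>2 * y x)"
    unfolding ell_def
    by (rule ae_eq_comp2 [OF _ qd(2), where h = "\<lambda>x a b. - a - of_real (r x) * b - (of_real (r x))\<^sup>2 * y x"])
  then show ell: "ell r y =\<^sub>a\<^sub>e g" by simp
  then have "ell r y \<in> L2" using L2_ae_cong [OF g] ae_eq_sym by blast
  then show "y \<in> dom_ell r"
    using rep primitive_imp_AC01 [OF y] by (simp add: dom_ell_def)
qed

lemma quasi_system_continuous:
  assumes "quasi_system r y u g"
  shows "continuous_on {0..1} y" "continuous_on {0..1} u"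
  using assms by (auto simp: quasi_system_def intro: primitive_continuous_on)

lemma quasi_system_ae_cong:
  assumes "quasi_system r y u g" "g =\<^sub>a\<^sub>e h"
  shows "quasi_system r y u h"
  using assms primitive_ae_cong [OF _ ae_eq_comp [OF assms(2)],
      of u "\<lambda>x a. - of_real (r x) * u x - (of_real (r x))\<^sup>2 * y x - a"]
  by (simp add: quasi_system_def)

lemma primitive_scale:
  fixes F :: "real \<Rightarrow> complex"
  shows "primitive F f \<Longrightarrow> primitive (\<lambda>x. c * F x) (\<lambda>x. c * f x)"
  by (rule primitive_linear [OF _ bounded_linear_mult_right])

lemma quasi_system_lincomb:
  assumes "quasi_system r y u g" "quasi_system r z v h"
  shows "quasi_system r (\<lambda>x. y x + c * z x) (\<lambda>x. u x + c * v x) (\<lambda>x. g x + c * h x)"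
proof -
  have "primitive (\<lambda>x. y x + c * z x) (\<lambda>x. (of_real (r x) * y x + u x) + c * (of_real (r x) * z x + v x))"
    "primitive (\<lambda>x. u x + c * v x) (\<lambda>x. (- of_real (r x) * u x - (of_real (r x))\<^sup>2 * y x - g x)
       + c * (- of_real (r x) * v x - (of_real (r x))\<^sup>2 * z x - h x))"
    using assms by (auto simp: quasi_system_def intro!: primitive_add primitive_scale)
  then show ?thesis by (simp add: quasi_system_def algebra_simps)
qed

lemma dom_A_lincomb:
  assumes "y \<in> dom_A r" "z \<in> dom_A r"
  shows "(\<lambda>x. y x + c * z x) \<in> dom_A r" "op_A r (\<lambda>x. y x + c * z x) =\<^sub>a\<^sub>e (\<lambda>x. op_A r y x + c * op_A r z x)"
proof -
  have "quasi_system r (\<lambda>x. y x + c * z x) (\<lambda>x. quasi_deriv r y x + c * quasi_deriv r z x) (\<lambda>x. ell r y x + c * ell r z x)"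
    using assms by (intro quasi_system_lincomb dom_ell_imp_quasi_system) (auto simp: dom_A_def)
  moreover have "(\<lambda>x. ell r y x + c * ell r z x) \<in> L2"
    using assms by (intro L2_add L2_scale) (auto simp: dom_A_def dom_ell_def)
  ultimately show "(\<lambda>x. y x + c * z x) \<in> dom_A r" "op_A r (\<lambda>x. y x + c * z x) =\<^sub>a\<^sub>e (\<lambda>x. op_A r y x + c * op_A r z x)"
    using quasi_system_imp_dom_ell [of r "\<lambda>x. y x + c * z x"] assms
    by (auto simp: dom_A_def op_A_def)
qed

lemma zero_in_dom_A: "(\<lambda>_. 0) \<in> dom_A r" and op_A_zero: "op_A r (\<lambda>_. 0) =\<^sub>a\<^sub>e (\<lambda>_. 0)"
proof -
  have "quasi_system r (\<lambda>_. 0) (\<lambda>_. 0) (\<lambda>_. 0)" by (simp add: quasi_system_def primitive_def)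
  from quasi_system_imp_dom_ell [OF this]
  show "(\<lambda>_. 0) \<in> dom_A r" "op_A r (\<lambda>_. 0) =\<^sub>a\<^sub>e (\<lambda>_. 0)"
    by (auto simp: dom_A_def op_A_def continuous_imp_L2)
qed

lemma dom_A_scale:
  assumes "y \<in> dom_A r"
  shows "(\<lambda>x. c * y x) \<in> dom_A r" "op_A r (\<lambda>x. c * y x) =\<^sub>a\<^sub>e (\<lambda>x. c * op_A r y x)"
  using dom_A_lincomb [OF zero_in_dom_A assms, of c]
    ae_eq_comp [OF op_A_zero [of r], of "\<lambda>x a. a + c * op_A r y x"] ae_eq_trans by simp_all blast

lemma dom_A_sum:
  assumes "finite I" "\<And>i. i \<in> I \<Longrightarrow> y i \<in> dom_A r"
  shows "(\<lambda>x. \<Sum>i\<in>I. c i * y i x) \<in> dom_A r \<and>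
    op_A r (\<lambda>x. \<Sum>i\<in>I. c i * y i x) =\<^sub>a\<^sub>e (\<lambda>x. \<Sum>i\<in>I. c i * op_A r (y i) x)"
  using assms
proof (induction I rule: finite_induct)
  case empty
  then show ?case by (simp add: zero_in_dom_A op_A_zero)
next
  case (insert j I)
  let ?s = "\<lambda>x. \<Sum>i\<in>I. c i * y i x"
  have IH: "?s \<in> dom_A r" "op_A r ?s =\<^sub>a\<^sub>e (\<lambda>x. \<Sum>i\<in>I. c i * op_A r (y i) x)" using insert by auto
  have "(\<lambda>x. ?s x + c j * y j x) \<in> dom_A r"
    "op_A r (\<lambda>x. ?s x + c j * y j x) =\<^sub>a\<^sub>e (\<lambda>x. op_A r ?s x + c j * op_A r (y j) x)"
    using dom_A_lincomb [OF IH(1), of "y j" "c j"] insert by auto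
  moreover have "(\<lambda>x. op_A r ?s x + c j * op_A r (y j) x) =\<^sub>a\<^sub>e
      (\<lambda>x. (\<Sum>i\<in>I. c i * op_A r (y i) x) + c j * op_A r (y j) x)"
    by (rule ae_eq_comp [OF IH(2)])
  ultimately show ?case using insert(1,2) ae_eq_trans by (simp add: add.commute) blast
qed

lemma dom_A_L2: "y \<in> dom_A r \<Longrightarrow> op_A r y \<in> L2"
  and dom_A_continuous: "y \<in> dom_A r \<Longrightarrow> continuous_on {0..1} y"
  by (auto simp: dom_A_def dom_ell_def op_A_def AC01_continuous_on)

lemma dom_A_in_L2: "y \<in> dom_A r \<Longrightarrow> y \<in> L2"
  by (intro continuous_imp_L2 dom_A_continuous)

text \<open>Integration by parts: the derivative of \<open>u * cnj z\<close> integrates to a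
  boundary term, which vanishes with \<open>z\<close> at the endpoints. With z' = r z + v the mixed
  terms r u cnj z cancel.\<close>

lemma form_A:
  assumes r: "r \<in> L2" and y: "quasi_system r y u g" and z: "quasi_system r z v h"
    and g: "g \<in> L2" and z01: "z 0 = 0" "z 1 = 0"
  shows "L2_inner g z = integral {0..1} (\<lambda>x. u x * cnj (v x) - (of_real (r x))\<^sup>2 * (y x * cnj (z x)))"
proof -
  let ?r = "\<lambda>x. complex_of_real (r x)"
  have cont: "continuous_on {0..1} y" "continuous_on {0..1} u" "continuous_on {0..1} z" "continuous_on {0..1} v"
    using quasi_system_continuous [OF y] quasi_system_continuous [OF z] by auto
  have pu: "primitive u (\<lambda>x. - ?r x * u x - (?r x)\<^sup>2 * y x - g x)"
    using y by (simp add: quasi_system_def)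
  have "primitive z (\<lambda>x. ?r x * z x + v x)" using z by (simp add: quasi_system_def)
  then have pz: "primitive (\<lambda>x. cnj (z x)) (\<lambda>x. cnj (?r x * z x + v x))"
    by (rule primitive_linear) (rule bounded_linear_cnj)
  let ?d = "\<lambda>x. u x * cnj (?r x * z x + v x) + (- ?r x * u x - (?r x)\<^sup>2 * y x - g x) * cnj (z x)"
  have pd: "primitive (\<lambda>x. u x * cnj (z x)) ?d" by (rule primitive_mult [OF pu pz])
  have "u 1 * cnj (z 1) = u 0 * cnj (z 0) + integral {0..1} ?d" by (rule primitive_eq [OF pd]) simp
  then have 0: "integral {0..1} ?d = 0" using z01 by simp
  have gz: "(\<lambda>x. g x * cnj (z x)) integrable_on {0..1}"
    using L2_mult_absolutely_integrable [OF g L2_cnj [OF continuous_imp_L2 [OF cont(3)]]]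
    by (simp add: absolutely_integrable_on_def)
  have "?d integrable_on {0..1}" using primitive_integrable [OF pd, of 0 1] by simp
  then have "integral {0..1} (\<lambda>x. ?d x + g x * cnj (z x)) = integral {0..1} ?d + integral {0..1} (\<lambda>x. g x * cnj (z x))"
    by (rule integral_add [OF _ gz])
  moreover have "(\<lambda>x. ?d x + g x * cnj (z x)) = (\<lambda>x. u x * cnj (v x) - (?r x)\<^sup>2 * (y x * cnj (z x)))"
    by (simp add: algebra_simps power2_eq_square)
  ultimately show ?thesis
    using 0 L2_inner_integral [OF g continuous_imp_L2 [OF cont(3)]] by simp
qed

text \<open>The right-hand side of \<open>form_A\<close> is Hermitian.\<close>

lemma op_A_symmetric:
  assumes r: "r \<in> L2" and y: "y \<in> dom_A r" and z: "z \<in> dom_A r"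
  shows "L2_inner (op_A r y) z = L2_inner y (op_A r z)"
proof -
  have sy: "quasi_system r y (quasi_deriv r y) (op_A r y)" and sz: "quasi_system r z (quasi_deriv r z) (op_A r z)"
    using y z by (auto simp: dom_A_def op_A_def dom_ell_imp_quasi_system)
  have 0: "y 0 = 0" "y 1 = 0" "z 0 = 0" "z 1 = 0" using y z by (auto simp: dom_A_def)
  have "L2_inner (op_A r y) z = integral {0..1} (\<lambda>x. cnj (quasi_deriv r z x * cnj (quasi_deriv r y x) -
      (of_real (r x))\<^sup>2 * (z x * cnj (y x))))"
    using form_A [OF r sy sz dom_A_L2 [OF y] 0(3,4)] by (simp add: mult.commute)
  also have "\<dots> = cnj (L2_inner (op_A r z) y)"
    unfolding form_A [OF r sz sy dom_A_L2 [OF z] 0(1,2)] by (rule Henstock_Kurzweil_Integration.integral_cnj [symmetric])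
  finally show ?thesis by (simp add: L2_inner_cnj)
qed

section \<open>The first order system: initial values, uniqueness, resolvent\<close>

definition coeff_bound :: "(real \<Rightarrow> real) \<Rightarrow> (real \<Rightarrow> complex) \<Rightarrow> real \<Rightarrow> real" where
  "coeff_bound r Q x = 2 * \<bar>r x\<bar> + 1 + (r x)\<^sup>2 + norm (Q x)"

lemma coeff_bound_integrable:
  assumes "r \<in> L2" "Q \<in> L2"
  shows "coeff_bound r Q absolutely_integrable_on {0..1}"
proof -
  have "(\<lambda>x. norm (complex_of_real (r x))) absolutely_integrable_on {0..1}"
    "(\<lambda>x. norm (Q x)) absolutely_integrable_on {0..1}"
    by (intro absolutely_integrable_norm [unfolded o_def] L2_imp_absolutely_integrable L2_of_real assms)+
  moreover have "(\<lambda>x. (r x)\<^sup>2) absolutely_integrable_on {0..1}"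
    using L2_norm_sq_integrable [OF assms(1)] by simp
  ultimately show ?thesis
    unfolding coeff_bound_def
    by (intro set_integral_add set_integrable_mult_right absolutely_integrable_on_const) auto
qed

lemma coeff_bound_nonneg: "coeff_bound r Q x \<ge> 0"
  by (simp add: coeff_bound_def add_nonneg_nonneg)

text \<open>Explains the terms of \<open>coeff_bound\<close>: |r| and 1 come from the first
  component, |Q|, |r| and r^2 from the second.\<close>

lemma system_norm_le:
  fixes y u Q :: complex and r :: real
  shows "norm (of_real r * y + u, Q * y - of_real r * u - (of_real r)\<^sup>2 * y)
    \<le> (2 * \<bar>r\<bar> + 1 + r\<^sup>2 + norm Q) * norm (y, u)"
proof -
  let ?n = "norm (y, u)"
  have yu: "norm y \<le> ?n" "norm u \<le> ?n" by (auto intro: norm_fst_le norm_snd_le)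
  have "norm (of_real r * y + u) \<le> \<bar>r\<bar> * norm y + norm u"
    by (metis norm_triangle_ineq norm_mult norm_of_real)
  also have "\<dots> \<le> \<bar>r\<bar> * ?n + ?n" using yu by (intro add_mono mult_left_mono) auto
  finally have 1: "norm (of_real r * y + u) \<le> \<bar>r\<bar> * ?n + ?n" .
  have "norm (Q * y - of_real r * u - (of_real r)\<^sup>2 * y) \<le> norm (Q * y) + norm (of_real r * u) + norm ((of_real r)\<^sup>2 * y)"
    using norm_triangle_ineq4 [of "Q * y - of_real r * u" "(of_real r)\<^sup>2 * y"]
      norm_triangle_ineq4 [of "Q * y" "of_real r * u"] by linarith
  also have "\<dots> = norm Q * norm y + \<bar>r\<bar> * norm u + r\<^sup>2 * norm y"
    by (simp add: norm_mult norm_power)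
  also have "\<dots> \<le> norm Q * ?n + \<bar>r\<bar> * ?n + r\<^sup>2 * ?n"
    using yu by (intro add_mono mult_left_mono) auto
  finally have 2: "norm (Q * y - of_real r * u - (of_real r)\<^sup>2 * y) \<le> norm Q * ?n + \<bar>r\<bar> * ?n + r\<^sup>2 * ?n" .
  have "norm (of_real r * y + u, Q * y - of_real r * u - (of_real r)\<^sup>2 * y)
      \<le> norm (of_real r * y + u) + norm (Q * y - of_real r * u - (of_real r)\<^sup>2 * y)"
    by (rule norm_Pair_le)
  with 1 2 show ?thesis by (simp add: algebra_simps)
qed

lemma quasi_system_pair:
  fixes y u :: "real \<Rightarrow> complex"
  assumes "quasi_system r y u (\<lambda>x. f x - Q x * y x)"
  shows "primitive (\<lambda>x. (y x, u x)) (\<lambda>x. (of_real (r x) * y x + u x,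
    Q x * y x - of_real (r x) * u x - (of_real (r x))\<^sup>2 * y x - f x))"
proof -
  have "primitive (\<lambda>x. (y x, 0) :: complex \<times> complex) (\<lambda>x. (of_real (r x) * y x + u x, 0))"
    using assms by (intro primitive_linear [where h = "\<lambda>a. (a, 0)"])
      (auto simp: quasi_system_def intro!: bounded_linear_Pair bounded_linear_ident bounded_linear_zero)
  moreover have "primitive (\<lambda>x. (0, u x) :: complex \<times> complex)
      (\<lambda>x. (0, - of_real (r x) * u x - (of_real (r x))\<^sup>2 * y x - (f x - Q x * y x)))"
    using assms by (intro primitive_linear [where h = "\<lambda>a. (0, a)"])
      (auto simp: quasi_system_def intro!: bounded_linear_Pair bounded_linear_ident bounded_linear_zero)
  ultimately have "primitive (\<lambda>x. (y x, 0) + (0, u x)) (\<lambda>x. (of_real (r x) * y x + u x, 0) +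
      (0, - of_real (r x) * u x - (of_real (r x))\<^sup>2 * y x - (f x - Q x * y x)))"
    by (rule primitive_add)
  then show ?thesis by (simp add: algebra_simps)
qed

lemma pair_imp_quasi_system:
  fixes W :: "real \<Rightarrow> complex \<times> complex"
  assumes "primitive W (\<lambda>x. (of_real (r x) * fst (W x) + snd (W x),
    Q x * fst (W x) - of_real (r x) * snd (W x) - (of_real (r x))\<^sup>2 * fst (W x) - f x))"
  shows "quasi_system r (\<lambda>x. fst (W x)) (\<lambda>x. snd (W x)) (\<lambda>x. f x - Q x * fst (W x))"
  using primitive_linear [OF assms bounded_linear_fst] primitive_linear [OF assms bounded_linear_snd]
  by (simp add: quasi_system_def algebra_simps)

text \<open>The potential \<open>Q\<close> treats three equations at once: it is 0 for
  \<open>A\<close> itself, a constant for the eigenvalue equation of \<open>A\<close>, and 2 \<zeta>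
  p - \<zeta>^2 for the pencil.\<close>

lemma quasi_system_exists:
  fixes Q f :: "real \<Rightarrow> complex"
  assumes r: "r \<in> L2" and Q: "Q \<in> L2" and f: "f \<in> L2"
  obtains y u where "quasi_system r y u (\<lambda>x. f x - Q x * y x)" "y 0 = y0" "u 0 = u0"
proof -
  let ?r = "\<lambda>x. complex_of_real (r x)"
  define N :: "real \<Rightarrow> complex \<times> complex \<Rightarrow> complex \<times> complex"
    where "N x w = (?r x * fst w + snd w, Q x * fst w - ?r x * snd w - (?r x)\<^sup>2 * fst w - f x)" for x w
  have lip: "norm (N t a - N t b) \<le> coeff_bound r Q t * norm (a - b)" for t a b
  proof -
    have "N t a - N t b = (?r t * fst (a - b) + snd (a - b),
        Q t * fst (a - b) - ?r t * snd (a - b) - (?r t)\<^sup>2 * fst (a - b))"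
      by (simp add: N_def algebra_simps)
    then show ?thesis
      using system_norm_le [of "r t" "fst (a - b)" "snd (a - b)" "Q t"]
      by (simp only: coeff_bound_def prod.collapse)
  qed
  have int: "(\<lambda>t. N t (W t)) absolutely_integrable_on {0..1}" if W: "continuous_on {0..1} W" for W
  proof -
    have c: "continuous_on {0..1} (\<lambda>t. fst (W t))" "continuous_on {0..1} (\<lambda>t. snd (W t))"
      by (intro continuous_intros W)+
    have rL: "?r \<in> L2" by (rule L2_of_real [OF r])
    have 1: "(\<lambda>t. ?r t * fst (W t) + snd (W t)) absolutely_integrable_on {0..1}"
      by (intro L2_imp_absolutely_integrable L2_add L2_mult_continuous rL c continuous_imp_L2)
    \<comment> \<open>The coefficient \<open>r\<^sup>2\<close> need not be square integrable, so
      this term is integrated as a product of two L_2 functions.\<close>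
    have "(\<lambda>t. ?r t * (?r t * fst (W t))) absolutely_integrable_on {0..1}"
      by (intro L2_mult_absolutely_integrable L2_mult_continuous rL c)
    moreover have "(\<lambda>t. Q t * fst (W t)) absolutely_integrable_on {0..1}"
      "(\<lambda>t. ?r t * snd (W t)) absolutely_integrable_on {0..1}"
      by (intro L2_imp_absolutely_integrable L2_mult_continuous rL c Q)+
    moreover have "f absolutely_integrable_on {0..1}" by (rule L2_imp_absolutely_integrable [OF f])
    ultimately have 2: "(\<lambda>t. Q t * fst (W t) - ?r t * snd (W t) - ?r t * (?r t * fst (W t)) - f t) absolutely_integrable_on {0..1}"
      by (intro set_integral_diff)
    have "(\<lambda>t. (?r t * fst (W t) + snd (W t), 0) + (0, Q t * fst (W t) - ?r t * snd (W t) - ?r t * (?r t * fst (W t)) - f t))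
       absolutely_integrable_on {0..1}"
    proof (rule set_integral_add)
      show "(\<lambda>t. (?r t * fst (W t) + snd (W t), 0::complex)) absolutely_integrable_on {0..1}"
        by (rule absolutely_integrable_linear [OF 1, where h = "\<lambda>a. (a, 0)", unfolded o_def])
          (intro bounded_linear_Pair bounded_linear_ident bounded_linear_zero)
      show "(\<lambda>t. (0::complex, Q t * fst (W t) - ?r t * snd (W t) - ?r t * (?r t * fst (W t)) - f t)) absolutely_integrable_on {0..1}"
        by (rule absolutely_integrable_linear [OF 2, where h = "\<lambda>a. (0, a)", unfolded o_def])
          (intro bounded_linear_Pair bounded_linear_ident bounded_linear_zero)
    qed
    then show ?thesis by (simp add: N_def power2_eq_square mult.assoc)
  qed
  obtain W where W: "primitive W (\<lambda>t. N t (W t))" "W 0 = (y0, u0)"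
    by (rule volterra_exists [OF coeff_bound_integrable [OF r Q] coeff_bound_nonneg int lip]) auto
  have "quasi_system r (\<lambda>x. fst (W x)) (\<lambda>x. snd (W x)) (\<lambda>x. f x - Q x * fst (W x))"
    by (rule pair_imp_quasi_system) (use W(1) in \<open>simp add: N_def\<close>)
  then show thesis by (rule that) (use W(2) in auto)
qed

text \<open>Gronwall for the pair \<open>(y, u)\<close>. The constant is uniform in the source and
  the initial values, so one estimate gives both uniqueness and the bound of the resolvent.\<close>

lemma quasi_system_bound:
  fixes Q :: "real \<Rightarrow> complex"
  assumes r: "r \<in> L2" and Q: "Q \<in> L2"
  obtains C where "C > 0" "\<And>y u f x. f \<in> L2 \<Longrightarrow> quasi_system r y u (\<lambda>x. f x - Q x * y x) \<Longrightarrow>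
    x \<in> {0..1} \<Longrightarrow> norm (y x) \<le> C * (norm (y 0) + norm (u 0) + L2_norm f) \<and>
      norm (u x) \<le> C * (norm (y 0) + norm (u 0) + L2_norm f)"
proof
  let ?k = "coeff_bound r Q"
  let ?C = "2 * exp (2 * integral {0..1} ?k)"
  show "?C > 0" by simp
  fix y u f x
  assume f: "f \<in> L2" and s: "quasi_system r y u (\<lambda>x. f x - Q x * y x)" and x: "x \<in> {0..1::real}"
  let ?W = "\<lambda>x. (y x, u x)"
  let ?N = "\<lambda>x. (of_real (r x) * y x + u x,
    Q x * y x - of_real (r x) * u x - (of_real (r x))\<^sup>2 * y x - f x)"
  let ?a = "norm (y 0) + norm (u 0) + L2_norm f"
  have W: "primitive ?W ?N" by (rule quasi_system_pair [OF s])
  have contW: "continuous_on {0..1} ?W" by (rule primitive_continuous_on [OF W])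
  have nf: "(\<lambda>t. norm (f t)) integrable_on {0..1}"
    using L2_imp_absolutely_integrable [OF f] by (simp add: absolutely_integrable_on_def)
  have kW: "(\<lambda>t. ?k t * norm (?W t)) integrable_on {0..1}"
  proof -
    have "(\<lambda>t. norm (?W t) * ?k t) absolutely_integrable_on {0..1}"
    proof (rule absolutely_integrable_bounded_measurable_product_real [OF _ _ _ coeff_bound_integrable [OF r Q]])
      show "(\<lambda>t. norm (?W t)) \<in> borel_measurable leb01"
        by (intro continuous_imp_measurable_on_sets_lebesgue continuous_on_norm contW) auto
      show "bounded ((\<lambda>t. norm (?W t)) ` {0..1})"
        by (intro compact_imp_bounded compact_continuous_image continuous_on_norm contW) auto
    qed auto
    then show ?thesis by (simp add: mult.commute absolutely_integrable_on_def)
  qed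
  have "norm (?W x) \<le> 2 * ?a * exp (2 * integral {0..1} ?k)"
  proof (rule volterra_bound [OF coeff_bound_integrable [OF r Q] coeff_bound_nonneg contW _ _ x])
    show "?a \<ge> 0" using L2_norm_nonneg [of f] by simp
    fix x :: real assume x: "x \<in> {0..1}"
    have sub: "{0..x} \<subseteq> {0..1}" using x by auto
    have "norm (?W x) = norm (?W 0 + integral {0..x} ?N)"
      by (rule arg_cong [OF primitive_eq [OF W x]])
    also have "\<dots> \<le> norm (?W 0) + norm (integral {0..x} ?N)"
      by (rule norm_triangle_ineq)
    also have "norm (?W 0) \<le> norm (y 0) + norm (u 0)" by (rule norm_Pair_le)
    also have "norm (integral {0..x} ?N) \<le> integral {0..x} (\<lambda>t. ?k t * norm (?W t) + norm (f t))"
    proof (intro integral_norm_bound_integral integrable_add)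
      show "?N integrable_on {0..x}" using x by (intro primitive_integrable [OF W]) auto
      show "(\<lambda>t. ?k t * norm (?W t)) integrable_on {0..x}" "(\<lambda>t. norm (f t)) integrable_on {0..x}"
        using kW nf sub by (auto intro: integrable_on_subinterval)
      fix t
      have "?N t = (of_real (r t) * y t + u t, Q t * y t - of_real (r t) * u t - (of_real (r t))\<^sup>2 * y t) - (0, f t)"
        by simp
      then have "norm (?N t) \<le> norm (of_real (r t) * y t + u t, Q t * y t - of_real (r t) * u t - (of_real (r t))\<^sup>2 * y t) + norm (0::complex, f t)"
        by (metis norm_triangle_ineq4)
      then show "norm (?N t) \<le> ?k t * norm (?W t) + norm (f t)"
        using system_norm_le [of "r t" "y t" "u t" "Q t"] by (simp add: coeff_bound_def norm_Pair)
    qed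
    also have "\<dots> = integral {0..x} (\<lambda>t. ?k t * norm (?W t)) + integral {0..x} (\<lambda>t. norm (f t))"
      using kW nf sub by (intro integral_add) (auto intro: integrable_on_subinterval)
    also have "integral {0..x} (\<lambda>t. norm (f t)) \<le> integral {0..1} (\<lambda>t. norm (f t))"
      using nf sub by (intro integral_subset_le) (auto intro: integrable_on_subinterval)
    also have "\<dots> \<le> L2_norm f" by (rule L1_norm_le_L2_norm [OF f])
    finally show "norm (?W x) \<le> ?a + integral {0..x} (\<lambda>t. ?k t * norm (?W t))" by simp
  qed
  also have "2 * ?a * exp (2 * integral {0..1} ?k) = ?C * ?a" by (simp only: mult_ac)
  finally have le: "norm (?W x) \<le> ?C * ?a" .
  show "norm (y x) \<le> ?C * ?a \<and> norm (u x) \<le> ?C * ?a"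
    by (intro conjI order_trans [OF _ le] norm_fst_le norm_snd_le)
qed

lemma quasi_system_unique:
  assumes r: "r \<in> L2" and Q: "Q \<in> L2" and s: "quasi_system r y u (\<lambda>x. - (Q x * y x))"
    and 0: "y 0 = 0" "u 0 = 0" and x: "x \<in> {0..1}"
  shows "y x = 0" "u x = 0"
proof -
  obtain C where C: "\<And>y u f x. f \<in> L2 \<Longrightarrow> quasi_system r y u (\<lambda>x. f x - Q x * y x) \<Longrightarrow>
    x \<in> {0..1} \<Longrightarrow> norm (y x) \<le> C * (norm (y 0) + norm (u 0) + L2_norm f) \<and>
      norm (u x) \<le> C * (norm (y 0) + norm (u 0) + L2_norm f)"
    by (rule quasi_system_bound [OF r Q]) blast
  have "(\<lambda>_. 0) \<in> (L2 :: (real \<Rightarrow> complex) set)" by (rule continuous_imp_L2) auto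
  from C [OF this, of y u x] s x 0 show "y x = 0" "u x = 0"
    by (auto simp: L2_norm_def)
qed

lemma dom_A_quasi_system:
  assumes "y \<in> dom_A r" "op_A r y =\<^sub>a\<^sub>e g"
  shows "quasi_system r y (quasi_deriv r y) g"
  using assms quasi_system_ae_cong [OF dom_ell_imp_quasi_system, of y r g] by (auto simp: dom_A_def op_A_def)

lemma dom_A_ae_zero:
  assumes "y \<in> dom_A r" "y =\<^sub>a\<^sub>e (\<lambda>_. 0)" "x \<in> {0..1}"
  shows "y x = 0"
  using continuous_ae_eq_imp_eq [OF dom_A_continuous [OF assms(1)] _ assms(2,3)] by simp

text \<open>Both solutions vanish at 0, and such a solution is determined by its quasi-derivative
  there, a single number.\<close>

lemma eigenspace_one_dim:
  assumes r: "r \<in> L2" and Q: "Q \<in> L2"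
    and y: "y \<in> dom_A r" "op_A r y =\<^sub>a\<^sub>e (\<lambda>x. - (Q x * y x))"
    and z: "z \<in> dom_A r" "op_A r z =\<^sub>a\<^sub>e (\<lambda>x. - (Q x * z x))" "\<not> z =\<^sub>a\<^sub>e (\<lambda>_. 0)"
  obtains c where "\<And>x. x \<in> {0..1} \<Longrightarrow> y x = c * z x"
proof -
  let ?uy = "quasi_deriv r y" and ?uz = "quasi_deriv r z"
  have sy: "quasi_system r y ?uy (\<lambda>x. - (Q x * y x))" and sz: "quasi_system r z ?uz (\<lambda>x. - (Q x * z x))"
    using y z by (auto intro: dom_A_quasi_system)
  have 0: "y 0 = 0" "z 0 = 0" using y z by (auto simp: dom_A_def)
  have uz: "?uz 0 \<noteq> 0"
  proof
    assume "?uz 0 = 0"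
    then have "z x = 0" if "x \<in> {0..1}" for x
      using quasi_system_unique [OF r Q sz 0(2) _ that] by simp
    then show False using z(3) by (auto intro: ae_eq_on)
  qed
  let ?c = "?uy 0 / ?uz 0"
  have "quasi_system r (\<lambda>x. y x + (- ?c) * z x) (\<lambda>x. ?uy x + (- ?c) * ?uz x)
      (\<lambda>x. - (Q x * y x) + (- ?c) * - (Q x * z x))"
    by (rule quasi_system_lincomb [OF sy sz])
  then have "quasi_system r (\<lambda>x. y x + (- ?c) * z x) (\<lambda>x. ?uy x + (- ?c) * ?uz x)
      (\<lambda>x. - (Q x * (y x + (- ?c) * z x)))"
    by (simp add: algebra_simps)
  from quasi_system_unique(1) [OF r Q this] 0 uz have "y x = ?c * z x" if "x \<in> {0..1}" for x
    using that by simp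
  then show thesis by (rule that)
qed

text \<open>Fredholm alternative by shooting: let \<phi> solve the homogeneous equation with value 0
  and quasi-derivative 1 at 0. Injectivity means \<phi> 1 \<noteq> 0, so a multiple of \<phi>
  corrects the value at 1 of any solution that starts from 0.\<close>

lemma resolvent:
  assumes r: "r \<in> L2" and Q: "Q \<in> L2"
    and inj: "\<And>y. y \<in> dom_A r \<Longrightarrow> op_A r y =\<^sub>a\<^sub>e (\<lambda>x. - (Q x * y x)) \<Longrightarrow> y =\<^sub>a\<^sub>e (\<lambda>_. 0)"
  obtains C where "C > 0"
    "\<And>f. f \<in> L2 \<Longrightarrow> \<exists>y\<in>dom_A r. op_A r y =\<^sub>a\<^sub>e (\<lambda>x. f x - Q x * y x)"
    "\<And>y f x. y \<in> dom_A r \<Longrightarrow> f \<in> L2 \<Longrightarrow> op_A r y =\<^sub>a\<^sub>e (\<lambda>x. f x - Q x * y x) \<Longrightarrow> x \<in> {0..1} \<Longrightarrow>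
      norm (y x) \<le> C * L2_norm f \<and> norm (quasi_deriv r y x) \<le> C * L2_norm f"
proof -
  obtain C where C: "C > 0" "\<And>y u f x. f \<in> L2 \<Longrightarrow> quasi_system r y u (\<lambda>x. f x - Q x * y x) \<Longrightarrow>
    x \<in> {0..1} \<Longrightarrow> norm (y x) \<le> C * (norm (y 0) + norm (u 0) + L2_norm f) \<and>
      norm (u x) \<le> C * (norm (y 0) + norm (u 0) + L2_norm f)"
    by (rule quasi_system_bound [OF r Q]) blast
  have zero_L2: "(\<lambda>_. 0) \<in> (L2 :: (real \<Rightarrow> complex) set)" by (rule continuous_imp_L2) auto
  have Qy: "(\<lambda>x. f x - Q x * y x) \<in> L2" if "f \<in> L2" "quasi_system r y u g" for f y u g
    by (intro L2_diff L2_mult_continuous Q that quasi_system_continuous(1) [OF that(2)])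
  obtain \<phi> w where \<phi>: "quasi_system r \<phi> w (\<lambda>x. 0 - Q x * \<phi> x)" "\<phi> 0 = 0" "w 0 = 1"
    by (rule quasi_system_exists [OF r Q zero_L2])
  have \<phi>1: "\<phi> 1 \<noteq> 0"
  proof
    assume \<phi>1: "\<phi> 1 = 0"
    note \<phi>D = quasi_system_imp_dom_ell [OF \<phi>(1) Qy [OF zero_L2 \<phi>(1)]]
    have dom: "\<phi> \<in> dom_A r" using \<phi>D(1) \<phi>(2) \<phi>1 by (simp add: dom_A_def)
    have "\<phi> =\<^sub>a\<^sub>e (\<lambda>_. 0)" using inj [OF dom] \<phi>D(2) by (simp add: op_A_def)
    from dom_A_ae_zero [OF dom this] have z: "\<phi> x = 0" if "x \<in> {0..1}" for x using that by simp
    \<comment> \<open>If \<phi> vanishes on [0,1], then so does its quasi-derivative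
      \<open>w\<close>, against \<open>w 0 = 1\<close>.\<close>
    have "primitive \<phi> (\<lambda>x. of_real (r x) * \<phi> x + w x)" using \<phi>(1) by (simp add: quasi_system_def)
    then have "primitive (\<lambda>_. 0) (\<lambda>x. of_real (r x) * \<phi> x + w x)"
      by (rule primitive_cong) (simp add: z)
    then have "(\<lambda>x. 0) =\<^sub>a\<^sub>e (\<lambda>x. of_real (r x) * \<phi> x + w x)"
      using primitive_vector_derivative by fastforce
    moreover have "(\<lambda>x. of_real (r x) * \<phi> x + w x) =\<^sub>a\<^sub>e w" by (rule ae_eq_on) (simp add: z)
    ultimately have "(\<lambda>_. 0) =\<^sub>a\<^sub>e w" by (rule ae_eq_trans)
    from continuous_ae_eq_imp_eq [OF _ quasi_system_continuous(2) [OF \<phi>(1)] this, of 0] \<phi>(3)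
    show False by simp
  qed
  show thesis
  proof
    show "C * (C / norm (\<phi> 1) + 1) > 0" using C(1) \<phi>1 by (intro mult_pos_pos add_pos_pos divide_pos_pos) auto
  next
    fix f :: "real \<Rightarrow> complex" assume f: "f \<in> L2"
    obtain \<psi> v where \<psi>: "quasi_system r \<psi> v (\<lambda>x. f x - Q x * \<psi> x)" "\<psi> 0 = 0" "v 0 = 0"
      by (rule quasi_system_exists [OF r Q f])
    let ?c = "- (\<psi> 1 / \<phi> 1)"
    let ?y = "\<lambda>x. \<psi> x + ?c * \<phi> x"
    have "quasi_system r ?y (\<lambda>x. v x + ?c * w x) (\<lambda>x. (f x - Q x * \<psi> x) + ?c * (0 - Q x * \<phi> x))"
      by (rule quasi_system_lincomb [OF \<psi>(1) \<phi>(1)])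
    moreover have "(\<lambda>x. (f x - Q x * \<psi> x) + ?c * (0 - Q x * \<phi> x)) = (\<lambda>x. f x - Q x * ?y x)"
      by (simp add: algebra_simps)
    ultimately have s: "quasi_system r ?y (\<lambda>x. v x + ?c * w x) (\<lambda>x. f x - Q x * ?y x)"
      by simp
    note yD = quasi_system_imp_dom_ell [OF s Qy [OF f s]]
    have "?y \<in> dom_A r" using yD(1) \<psi>(2) \<phi>(2) \<phi>1 by (simp add: dom_A_def)
    then show "\<exists>y\<in>dom_A r. op_A r y =\<^sub>a\<^sub>e (\<lambda>x. f x - Q x * y x)"
      using yD(2) by (intro bexI [of _ ?y]) (simp add: op_A_def)
  next
    fix y f :: "real \<Rightarrow> complex" and x :: real
    assume y: "y \<in> dom_A r" "op_A r y =\<^sub>a\<^sub>e (\<lambda>x. f x - Q x * y x)" and f: "f \<in> L2" and x: "x \<in> {0..1}"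
    let ?u = "quasi_deriv r y"
    have s: "quasi_system r y ?u (\<lambda>x. f x - Q x * y x)" using y by (rule dom_A_quasi_system)
    have y01: "y 0 = 0" "y 1 = 0" using y by (auto simp: dom_A_def)
    \<comment> \<open>This multiple of \<phi> removes all initial data of \<open>y\<close>;
      evaluating the bound at 1, where \<open>y\<close> vanishes, then estimates \<open>?u 0\<close>
      itself.\<close>
    let ?c = "- ?u 0"
    have "quasi_system r (\<lambda>x. y x + ?c * \<phi> x) (\<lambda>x. ?u x + ?c * w x) (\<lambda>x. (f x - Q x * y x) + ?c * (0 - Q x * \<phi> x))"
      by (rule quasi_system_lincomb [OF s \<phi>(1)])
    moreover have "(\<lambda>x. (f x - Q x * y x) + ?c * (0 - Q x * \<phi> x)) = (\<lambda>x. f x - Q x * (y x + ?c * \<phi> x))"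
      by (simp add: algebra_simps)
    ultimately have "quasi_system r (\<lambda>x. y x + ?c * \<phi> x) (\<lambda>x. ?u x + ?c * w x) (\<lambda>x. f x - Q x * (y x + ?c * \<phi> x))"
      by simp
    from C(2) [OF f this, of 1] have "norm (?u 0) * norm (\<phi> 1) \<le> C * L2_norm f"
      using y01 \<phi> by (simp add: norm_mult)
    then have u0: "norm (?u 0) \<le> C / norm (\<phi> 1) * L2_norm f" using \<phi>1 by (simp add: field_simps)
    have "C * (norm (y 0) + norm (?u 0) + L2_norm f) \<le> C * (C / norm (\<phi> 1) * L2_norm f + L2_norm f)"
      using u0 y01 C(1) by (intro mult_left_mono) auto
    also have "\<dots> = C * (C / norm (\<phi> 1) + 1) * L2_norm f" by (simp add: algebra_simps)
    finally show "norm (y x) \<le> C * (C / norm (\<phi> 1) + 1) * L2_norm f \<and>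
        norm (?u x) \<le> C * (C / norm (\<phi> 1) + 1) * L2_norm f"
      using C(2) [OF f s x] by linarith
  qed
qed

lemma quasi_system_cnj:
  assumes "quasi_system r y u g"
  shows "quasi_system r (\<lambda>x. cnj (y x)) (\<lambda>x. cnj (u x)) (\<lambda>x. cnj (g x))"
proof -
  have "primitive (\<lambda>x. cnj (y x)) (\<lambda>x. cnj (of_real (r x) * y x + u x))"
    "primitive (\<lambda>x. cnj (u x)) (\<lambda>x. cnj (- of_real (r x) * u x - (of_real (r x))\<^sup>2 * y x - g x))"
    using assms by (auto simp only: quasi_system_def intro!: primitive_linear [OF _ bounded_linear_cnj])
  then show ?thesis by (simp add: quasi_system_def)
qed

lemma dom_A_cnj:
  assumes "y \<in> dom_A r"
  shows "(\<lambda>x. cnj (y x)) \<in> dom_A r" "op_A r (\<lambda>x. cnj (y x)) =\<^sub>a\<^sub>e (\<lambda>x. cnj (op_A r y x))"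
proof -
  have "quasi_system r (\<lambda>x. cnj (y x)) (\<lambda>x. cnj (quasi_deriv r y x)) (\<lambda>x. cnj (op_A r y x))"
    by (rule quasi_system_cnj [OF dom_A_quasi_system [OF assms ae_eq_refl]])
  from quasi_system_imp_dom_ell [OF this L2_cnj [OF dom_A_L2 [OF assms]]] assms
  show "(\<lambda>x. cnj (y x)) \<in> dom_A r" "op_A r (\<lambda>x. cnj (y x)) =\<^sub>a\<^sub>e (\<lambda>x. cnj (op_A r y x))"
    by (auto simp: dom_A_def op_A_def)
qed

section \<open>Negative eigenvalues of \<open>A\<close>\<close>

text \<open>Gaussian elimination with \<open>k\<close> equations and \<open>k + 1\<close> unknowns:
  a pivot row \<open>p\<close> eliminates the last unknown, and \<sigma> enumerates the other
  rows.\<close>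

lemma homogeneous_system_nontrivial:
  fixes a :: "nat \<Rightarrow> nat \<Rightarrow> complex"
  shows "\<exists>c. (\<exists>j\<le>k. c j \<noteq> 0) \<and> (\<forall>i<k. (\<Sum>j\<le>k. a i j * c j) = 0)"
proof (induction k arbitrary: a)
  case 0
  show ?case by (intro exI [of _ "\<lambda>_. 1"]) auto
next
  case (Suc k)
  show ?case
  proof (cases "\<forall>i<Suc k. a i (Suc k) = 0")
    case True
    show ?thesis
      by (intro exI [of _ "\<lambda>j. if j = Suc k then 1 else 0"] conjI) (use True in auto)
  next
    case False
    then obtain p where p: "p < Suc k" "a p (Suc k) \<noteq> 0" by blast
    define \<sigma> where "\<sigma> i = (if i < p then i else Suc i)" for i
    define b where "b i j = a (\<sigma> i) j - a (\<sigma> i) (Suc k) / a p (Suc k) * a p j" for i j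
    obtain c where c: "\<exists>j\<le>k. c j \<noteq> 0" "\<And>i. i < k \<Longrightarrow> (\<Sum>j\<le>k. b i j * c j) = 0"
      using Suc.IH [of b] by blast
    define d where "d j = (if j = Suc k then - (\<Sum>j\<le>k. a p j * c j) / a p (Suc k) else c j)" for j
    have sum_d: "(\<Sum>j\<le>Suc k. a i j * d j) = (\<Sum>j\<le>k. a i j * c j) - a i (Suc k) / a p (Suc k) * (\<Sum>j\<le>k. a p j * c j)" for i
      by (simp add: d_def)
    have "(\<Sum>j\<le>Suc k. a i j * d j) = 0" if "i < Suc k" for i
    proof (cases "i = p")
      case True
      then show ?thesis using p unfolding sum_d by simp
    next
      case False
      define i' where "i' = (if i < p then i else i - 1)"
      have i': "\<sigma> i' = i" "i' < k" using False p that by (auto simp: \<sigma>_def i'_def)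
      have "(\<Sum>j\<le>k. b i' j * c j) = (\<Sum>j\<le>k. a i j * c j) - a i (Suc k) / a p (Suc k) * (\<Sum>j\<le>k. a p j * c j)"
        by (simp add: b_def i' left_diff_distrib sum_subtractf sum_distrib_left mult.assoc)
      then show ?thesis using c(2) [OF i'(2)] unfolding sum_d by simp
    qed
    moreover have "\<exists>j\<le>Suc k. d j \<noteq> 0"
      using c(1) unfolding d_def by (metis Suc_n_not_le_n le_SucI)
    ultimately show ?thesis by blast
  qed
qed

text \<open>Let R, n, h be the L_2 norms of r, e and e', and s the supremum of |e|. Then s^2 \<le> 2
  n h and h^2 - \<mu> n^2 \<le> 2 R s h. For \<mu> < 0 this gives h \<le> 2 R s, then s \<le> 4 n R,
  and finally - \<mu> n^2 \<le> 4 R^2 s^2 \<le> 64 R^4 n^2.\<close>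

lemma negative_eigenvalue_bound:
  assumes r: "r \<in> L2" and e: "e \<in> dom_A r" "op_A r e =\<^sub>a\<^sub>e (\<lambda>x. of_real \<mu> * e x)" "\<not> e =\<^sub>a\<^sub>e (\<lambda>_. 0)"
  shows "- \<mu> \<le> 64 * (L2_norm (\<lambda>x. of_real (r x))) ^ 4"
proof (cases "\<mu> < 0")
  case False
  moreover have "64 * (L2_norm (\<lambda>x. of_real (r x))) ^ 4 \<ge> 0" by simp
  ultimately show ?thesis by linarith
next
  case True
  let ?r = "\<lambda>x. complex_of_real (r x)"
  define u where "u = quasi_deriv r e"
  define d where "d x = ?r x * e x + u x" for x
  define R n h where "R = L2_norm ?r" and "n = L2_norm e" and "h = L2_norm d"
  have nonneg: "R \<ge> 0" "n \<ge> 0" "h \<ge> 0" by (auto simp: R_def n_def h_def L2_norm_nonneg)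
  have qs: "quasi_system r e u (\<lambda>x. of_real \<mu> * e x)"
    unfolding u_def by (rule dom_A_quasi_system [OF e(1,2)])
  have e01: "e 0 = 0" "e 1 = 0" using e by (auto simp: dom_A_def)
  have cont: "continuous_on {0..1} e" "continuous_on {0..1} u" using quasi_system_continuous [OF qs] by auto
  have L2: "?r \<in> L2" "e \<in> L2" "u \<in> L2" "(\<lambda>x. of_real \<mu> * e x) \<in> L2" "(\<lambda>x. ?r x * e x) \<in> L2"
    by (intro L2_of_real r continuous_imp_L2 cont continuous_intros L2_mult_continuous)+
  have dL2: "d \<in> L2" unfolding d_def by (intro L2_add L2)
  have pe: "primitive e d" using qs by (simp add: quasi_system_def d_def [abs_def])
  obtain x0 where x0: "x0 \<in> {0..1}" "\<And>x. x \<in> {0..1} \<Longrightarrow> norm (e x) \<le> norm (e x0)"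
    using continuous_attains_sup [of "{0..1}" "\<lambda>x. norm (e x)"] continuous_on_norm [OF cont(1)]
    by auto
  define s where "s = norm (e x0)"
  have s0: "s \<ge> 0" by (simp add: s_def)
  \<comment> \<open>Integrate the derivative of |e|^2 from 0, where \<open>e\<close> vanishes, to
    the maximum point.\<close>
  have s2: "s\<^sup>2 \<le> 2 * (n * h)"
  proof -
    let ?ne = "\<lambda>x. complex_of_real (norm (e x))" and ?nd = "\<lambda>x. complex_of_real (norm (d x))"
    have nL2: "?ne \<in> L2" "?nd \<in> L2" using L2(2) dL2 by (auto simp: L2_def)
    have ed: "(\<lambda>x. norm (e x) * norm (d x)) absolutely_integrable_on {0..1}"
      using absolutely_integrable_norm [OF L2_mult_absolutely_integrable [OF L2(2) dL2]]
      by (simp add: o_def norm_mult)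
    have "((\<lambda>x. norm (e x) * norm (d x)) has_integral integral {0..1} (\<lambda>x. norm (e x) * norm (d x))) {0..1}"
      using ed by (auto simp: absolutely_integrable_on_def has_integral_iff)
    then have "((\<lambda>x. complex_of_real (norm (e x) * norm (d x))) has_integral
        of_real (integral {0..1} (\<lambda>x. norm (e x) * norm (d x)))) {0..1}"
      by (rule has_integral_of_real)
    then have "L2_inner ?ne ?nd = of_real (integral {0..1} (\<lambda>x. norm (e x) * norm (d x)))"
      unfolding L2_inner_integral [OF nL2] by (simp add: integral_unique)
    moreover have "norm (L2_inner ?ne ?nd) \<le> L2_norm ?ne * L2_norm ?nd"
      by (rule L2_Cauchy_Schwarz [OF nL2])
    moreover have "L2_norm ?ne = n" "L2_norm ?nd = h" by (simp_all add: L2_norm_def n_def h_def)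
    ultimately have int: "integral {0..1} (\<lambda>x. norm (e x) * norm (d x)) \<le> n * h"
      by simp
    have "primitive (\<lambda>x. cnj (e x)) (\<lambda>x. cnj (d x))"
      by (rule primitive_linear [OF pe bounded_linear_cnj])
    then have p: "primitive (\<lambda>x. e x * cnj (e x)) (\<lambda>x. e x * cnj (d x) + d x * cnj (e x))"
      by (rule primitive_mult [OF pe])
    have "e x0 * cnj (e x0) = integral {0..x0} (\<lambda>x. e x * cnj (d x) + d x * cnj (e x))"
      using primitive_eq [OF p x0(1)] e01 by simp
    then have "s\<^sup>2 = norm (integral {0..x0} (\<lambda>x. e x * cnj (d x) + d x * cnj (e x)))"
      by (metis s_def norm_mult complex_mod_cnj power2_eq_square)
    also have "\<dots> \<le> integral {0..x0} (\<lambda>x. 2 * (norm (e x) * norm (d x)))"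
    proof (intro integral_norm_bound_integral)
      show "(\<lambda>x. e x * cnj (d x) + d x * cnj (e x)) integrable_on {0..x0}"
        using x0 by (intro primitive_integrable [OF p]) auto
      show "(\<lambda>x. 2 * (norm (e x) * norm (d x))) integrable_on {0..x0}"
        using ed x0(1) by (intro integrable_on_mult_right)
          (auto simp: absolutely_integrable_on_def intro: integrable_on_subinterval)
      show "norm (e x * cnj (d x) + d x * cnj (e x)) \<le> 2 * (norm (e x) * norm (d x))" for x
        using norm_triangle_ineq [of "e x * cnj (d x)" "d x * cnj (e x)"] by (simp add: norm_mult mult.commute)
    qed
    also have "\<dots> \<le> integral {0..1} (\<lambda>x. 2 * (norm (e x) * norm (d x)))"
      using ed x0(1) by (intro integral_subset_le integrable_on_mult_right)
        (auto simp: absolutely_integrable_on_def intro: integrable_on_subinterval)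
    also have "\<dots> = 2 * integral {0..1} (\<lambda>x. norm (e x) * norm (d x))" by simp
    also have "\<dots> \<le> 2 * (n * h)" using int by simp
    finally show ?thesis .
  qed
  have energy: "h\<^sup>2 - \<mu> * n\<^sup>2 \<le> 2 * (R * s * h)"
  proof -
    have re: "L2_norm (\<lambda>x. ?r x * e x) \<le> R * s"
    proof (rule power2_le_imp_le)
      have "(L2_norm (\<lambda>x. ?r x * e x))\<^sup>2 = integral {0..1} (\<lambda>x. (norm (?r x * e x))\<^sup>2)"
        by (rule L2_norm_sq_integral [OF L2(5)])
      also have "\<dots> \<le> integral {0..1} (\<lambda>x. (norm (?r x))\<^sup>2 * s\<^sup>2)"
      proof (rule integral_le)
        show "(\<lambda>x. (norm (?r x * e x))\<^sup>2) integrable_on {0..1}" "(\<lambda>x. (norm (?r x))\<^sup>2 * s\<^sup>2) integrable_on {0..1}"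
          using L2_norm_sq_integrable [OF L2(5)] L2_norm_sq_integrable [OF L2(1)]
          by (auto simp: absolutely_integrable_on_def intro!: integrable_on_mult_left)
        show "(norm (?r x * e x))\<^sup>2 \<le> (norm (?r x))\<^sup>2 * s\<^sup>2" if "x \<in> {0..1}" for x
          using x0(2) [OF that] unfolding norm_mult power_mult_distrib s_def
          by (intro mult_left_mono power_mono) auto
      qed
      also have "\<dots> = (R * s)\<^sup>2"
        using L2_norm_sq_integral [OF L2(1)] by (simp add: R_def power_mult_distrib)
      finally show "(L2_norm (\<lambda>x. ?r x * e x))\<^sup>2 \<le> (R * s)\<^sup>2" .
    qed (use nonneg s0 in auto)
    have "of_real \<mu> * of_real (n\<^sup>2) = L2_inner (\<lambda>x. of_real \<mu> * e x) e"
      by (simp add: L2_inner_scale_left L2_inner_self n_def)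
    also have "\<dots> = integral {0..1} (\<lambda>x. u x * cnj (u x) - (?r x)\<^sup>2 * (e x * cnj (e x)))"
      by (rule form_A [OF r qs qs L2(4) e01])
    \<comment> \<open>Inserting u = d - r e cancels r^2 |e|^2; what remains contains
      \<open>r\<close> only in the product \<open>r e\<close>, whose norm is at most R s.\<close>
    also have "(\<lambda>x. u x * cnj (u x) - (?r x)\<^sup>2 * (e x * cnj (e x))) =
        (\<lambda>x. d x * cnj (d x) - ((?r x * e x) * cnj (d x) + d x * cnj (?r x * e x)))"
      by (rule ext) (simp add: d_def algebra_simps power2_eq_square)
    also have "integral {0..1} \<dots> = L2_inner d d - (L2_inner (\<lambda>x. ?r x * e x) d + L2_inner d (\<lambda>x. ?r x * e x))"
    proof -
      have i: "(\<lambda>x. f x * cnj (g x)) integrable_on {0..1}" if "f \<in> L2" "g \<in> L2" for f g :: "real \<Rightarrow> complex"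
        using L2_mult_absolutely_integrable [OF that(1) L2_cnj [OF that(2)]] by (simp add: absolutely_integrable_on_def)
      show ?thesis
        unfolding L2_inner_integral [OF dL2 dL2] L2_inner_integral [OF L2(5) dL2] L2_inner_integral [OF dL2 L2(5)]
        by (subst Henstock_Kurzweil_Integration.integral_diff, (intro i integrable_add dL2 L2)+)
          (subst Henstock_Kurzweil_Integration.integral_add, (intro i dL2 L2)+, rule refl)
    qed
    also have "L2_inner (\<lambda>x. ?r x * e x) d = cnj (L2_inner d (\<lambda>x. ?r x * e x))" by (simp add: L2_inner_cnj)
    finally have "of_real \<mu> * of_real (n\<^sup>2) = of_real (h\<^sup>2) -
        (cnj (L2_inner d (\<lambda>x. ?r x * e x)) + L2_inner d (\<lambda>x. ?r x * e x))"
      by (simp add: L2_inner_self h_def)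
    from arg_cong [OF this, of Re] have "\<mu> * n\<^sup>2 = h\<^sup>2 - 2 * Re (L2_inner d (\<lambda>x. ?r x * e x))"
      by (simp flip: of_real_power of_real_mult)
    moreover have "Re (L2_inner d (\<lambda>x. ?r x * e x)) \<le> h * (R * s)"
    proof -
      have "Re (L2_inner d (\<lambda>x. ?r x * e x)) \<le> norm (L2_inner d (\<lambda>x. ?r x * e x))" by (rule complex_Re_le_cmod)
      also have "\<dots> \<le> h * L2_norm (\<lambda>x. ?r x * e x)" unfolding h_def by (rule L2_Cauchy_Schwarz [OF dL2 L2(5)])
      also have "\<dots> \<le> h * (R * s)" by (rule mult_left_mono [OF re nonneg(3)])
      finally show ?thesis .
    qed
    ultimately show ?thesis by (simp add: mult_ac)
  qed
  have "n \<noteq> 0" using L2_norm_zero_imp_ae [OF L2(2)] e(3) by (auto simp: n_def)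
  with nonneg have n: "n > 0" by simp
  have h: "h \<le> 2 * R * s"
  proof (cases "h = 0")
    case False
    have "0 \<le> - \<mu> * n\<^sup>2" using True by (simp add: mult_nonpos_nonneg)
    then have "h * h \<le> (2 * R * s) * h" using energy by (simp add: power2_eq_square mult_ac)
    then show ?thesis using False nonneg(3) by (simp add: mult_le_cancel_right)
  qed (use nonneg s0 in auto)
  have "s \<le> 4 * n * R"
  proof (cases "s = 0")
    case False
    have "s * s \<le> 2 * n * h" using s2 by (simp add: power2_eq_square mult_ac)
    also have "\<dots> \<le> 2 * n * (2 * R * s)" using h nonneg by (intro mult_left_mono) auto
    finally have "s * s \<le> (4 * n * R) * s" by (simp add: mult_ac)
    then show ?thesis using False s0 by (simp add: mult_le_cancel_right)
  qed (use nonneg in auto)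
  then have ss: "s\<^sup>2 \<le> (4 * n * R)\<^sup>2" using s0 by (intro power_mono)
  have "- \<mu> * n\<^sup>2 \<le> 2 * (R * s * h)" using energy zero_le_power2 [of h] by linarith
  also have "\<dots> \<le> 2 * (R * s * (2 * R * s))" using h nonneg s0 by (intro mult_left_mono) auto
  also have "\<dots> = 4 * R\<^sup>2 * s\<^sup>2" by (simp add: power2_eq_square)
  also have "\<dots> \<le> 4 * R\<^sup>2 * (4 * n * R)\<^sup>2" by (rule mult_left_mono [OF ss]) simp
  also have "\<dots> = (64 * R ^ 4) * n\<^sup>2" by (simp add: power_mult_distrib power4_eq_xxxx power2_eq_square)
  finally have "- \<mu> * n\<^sup>2 \<le> (64 * R ^ 4) * n\<^sup>2" .
  then have "- \<mu> \<le> 64 * R ^ 4" by (rule mult_right_le_imp_le) (use n in simp)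
  then show ?thesis by (simp add: R_def)
qed

section \<open>The form of A and its minimum on an orthogonal complement\<close>

definition energy :: "(real \<Rightarrow> real) \<Rightarrow> (real \<Rightarrow> complex) \<Rightarrow> real" where
  "energy r y = Re (L2_inner (op_A r y) y)"

definition orth :: "(real \<Rightarrow> complex) set \<Rightarrow> (real \<Rightarrow> complex) \<Rightarrow> bool" where
  "orth S f \<longleftrightarrow> (\<forall>e\<in>S. L2_inner f e = 0)"

lemma energy_lincomb:
  assumes r: "r \<in> L2" and y: "y \<in> dom_A r" and z: "z \<in> dom_A r"
  shows "energy r (\<lambda>x. y x + c * z x) = energy r y + 2 * Re (c * L2_inner (op_A r z) y) + (norm c)\<^sup>2 * energy r z"
proof -
  note L = dom_A_L2 [OF y] dom_A_L2 [OF z] dom_A_in_L2 [OF y] dom_A_in_L2 [OF z]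
  have "L2_inner (op_A r (\<lambda>x. y x + c * z x)) (\<lambda>x. y x + c * z x) =
      L2_inner (\<lambda>x. op_A r y x + c * op_A r z x) (\<lambda>x. y x + c * z x)"
    using dom_A_lincomb [OF y z, of c] by (intro L2_inner_ae_cong ae_eq_refl dom_A_L2 dom_A_in_L2)
  also have "\<dots> = L2_inner (op_A r y) y + c * L2_inner (op_A r z) y + cnj c * L2_inner (op_A r y) z
      + c * cnj c * L2_inner (op_A r z) z"
    using L L2_scale [OF L(2), of c] L2_scale [OF L(4), of c] L2_add [OF L(3) L2_scale [OF L(4), of c]]
    by (simp add: L2_inner_add_left L2_inner_add_right L2_inner_scale_left L2_inner_scale_right algebra_simps)
  also have "L2_inner (op_A r y) z = cnj (L2_inner (op_A r z) y)"
    by (simp add: op_A_symmetric [OF r y z] L2_inner_cnj)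
  also have "c * cnj c = of_real ((norm c)\<^sup>2)" using complex_norm_square [of c] by simp
  finally have "energy r (\<lambda>x. y x + c * z x) = energy r y + Re (c * L2_inner (op_A r z) y)
      + Re (cnj (c * L2_inner (op_A r z) y)) + (norm c)\<^sup>2 * energy r z"
    by (simp add: energy_def)
  then show ?thesis by simp
qed

lemma norm_op_A_lincomb:
  assumes y: "y \<in> dom_A r" and z: "z \<in> dom_A r"
  shows "(L2_norm (op_A r (\<lambda>x. y x + c * z x)))\<^sup>2 =
    (L2_norm (op_A r y))\<^sup>2 + 2 * Re (c * L2_inner (op_A r z) (op_A r y)) + (norm c)\<^sup>2 * (L2_norm (op_A r z))\<^sup>2"
  using L2_norm_ae_cong [OF dom_A_lincomb(2) [OF y z] dom_A_L2 [OF dom_A_lincomb(1) [OF y z]]]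
    L2_norm_add_sq [OF dom_A_L2 [OF y] dom_A_L2 [OF z]] by simp

lemma energy_scale:
  assumes y: "y \<in> dom_A r"
  shows "energy r (\<lambda>x. c * y x) = (norm c)\<^sup>2 * energy r y"
    "L2_norm (op_A r (\<lambda>x. c * y x)) = norm c * L2_norm (op_A r y)"
proof -
  have "L2_inner (op_A r (\<lambda>x. c * y x)) (\<lambda>x. c * y x) = L2_inner (\<lambda>x. c * op_A r y x) (\<lambda>x. c * y x)"
    by (intro L2_inner_ae_cong ae_eq_refl dom_A_L2 dom_A_in_L2 [OF dom_A_scale(1) [OF y]]
        dom_A_scale(1) [OF y] dom_A_scale(2) [OF y])
  also have "\<dots> = of_real ((norm c)\<^sup>2) * L2_inner (op_A r y) y"
    using complex_norm_square [of c] by (simp add: L2_inner_scale_left L2_inner_scale_right)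
  finally show "energy r (\<lambda>x. c * y x) = (norm c)\<^sup>2 * energy r y" by (simp add: energy_def)
  show "L2_norm (op_A r (\<lambda>x. c * y x)) = norm c * L2_norm (op_A r y)"
    using L2_norm_ae_cong [OF dom_A_scale(2) [OF y] dom_A_L2 [OF dom_A_scale(1) [OF y]]]
    by (simp add: L2_norm_scale)
qed

lemma orth_lincomb:
  assumes "S \<subseteq> L2" "f \<in> L2" "g \<in> L2" "orth S f" "orth S g"
  shows "orth S (\<lambda>x. f x + c * g x)"
  using assms L2_inner_add_left [OF assms(2) L2_scale [OF assms(3)]]
  by (auto simp: orth_def L2_inner_scale_left)

context
  fixes r :: "real \<Rightarrow> real" and C :: real
  assumes r: "r \<in> L2"
    and C_pos: "C > 0"
    and surj: "\<And>f. f \<in> L2 \<Longrightarrow> \<exists>y\<in>dom_A r. op_A r y =\<^sub>a\<^sub>e f"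
    and C_bound: "\<And>y f x. y \<in> dom_A r \<Longrightarrow> f \<in> L2 \<Longrightarrow> op_A r y =\<^sub>a\<^sub>e f \<Longrightarrow> x \<in> {0..1} \<Longrightarrow>
      norm (y x) \<le> C * L2_norm f \<and> norm (quasi_deriv r y x) \<le> C * L2_norm f"
begin

lemma L2_norm_le_op_A: "y \<in> dom_A r \<Longrightarrow> L2_norm y \<le> C * L2_norm (op_A r y)"
  by (intro L2_norm_le_sup dom_A_continuous) (use C_bound [OF _ dom_A_L2 ae_eq_refl] in auto)

lemma abs_energy_le: "y \<in> dom_A r \<Longrightarrow> \<bar>energy r y\<bar> \<le> C * (L2_norm (op_A r y))\<^sup>2"
proof -
  assume y: "y \<in> dom_A r"
  have "\<bar>energy r y\<bar> \<le> norm (L2_inner (op_A r y) y)" unfolding energy_def by (rule abs_Re_le_cmod)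
  also have "\<dots> \<le> L2_norm (op_A r y) * L2_norm y" by (rule L2_Cauchy_Schwarz [OF dom_A_L2 [OF y] dom_A_in_L2 [OF y]])
  also have "\<dots> \<le> L2_norm (op_A r y) * (C * L2_norm (op_A r y))"
    by (intro mult_left_mono L2_norm_le_op_A y L2_norm_nonneg)
  finally show ?thesis by (simp add: power2_eq_square mult_ac)
qed

text \<open>Arzela-Ascoli. Both \<open>ys n\<close> and its quasi-derivative are bounded by
  \<open>C\<close>, so the derivative of \<open>ys n\<close> is at most C (|r| + 1), an integrable
  function independent of \<open>n\<close>, and its integral is a common modulus of
  continuity.\<close>

lemma op_A_compact:
  assumes ys: "\<And>n. ys n \<in> dom_A r" "\<And>n. L2_norm (op_A r (ys n)) \<le> 1"
  obtains g k where "continuous_on {0..1} g" "strict_mono (k :: nat \<Rightarrow> nat)"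
    "\<And>e. 0 < e \<Longrightarrow> \<exists>N. \<forall>n x. n \<ge> N \<and> x \<in> {0..1} \<longrightarrow> norm (ys (k n) x - g x) < e"
proof -
  have bound: "norm (ys n x) \<le> C \<and> norm (quasi_deriv r (ys n) x) \<le> C" if "x \<in> {0..1}" for n x
  proof -
    have "C * L2_norm (op_A r (ys n)) \<le> C * 1" using ys(2) [of n] C_pos by (intro mult_left_mono) auto
    then show ?thesis
      using C_bound [OF ys(1) dom_A_L2 [OF ys(1)] ae_eq_refl that, of n] by linarith
  qed
  let ?m = "\<lambda>x. \<bar>r x\<bar> + 1"
  have "(\<lambda>x. norm (complex_of_real (r x))) absolutely_integrable_on {0..1}"
    by (intro absolutely_integrable_norm [unfolded o_def] L2_imp_absolutely_integrable L2_of_real r)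
  then have m: "?m absolutely_integrable_on {0..1}"
    by (intro set_integral_add) auto
  define \<Psi> where "\<Psi> x = integral {0..x} ?m" for x
  have p: "primitive \<Psi> ?m" using m by (simp add: primitive_def \<Psi>_def)
  have mono: "norm (ys n b - ys n a) \<le> C * (\<Psi> b - \<Psi> a)" if "0 \<le> a" "a \<le> b" "b \<le> 1" for n a b
  proof -
    let ?u = "quasi_deriv r (ys n)"
    have "primitive (ys n) (\<lambda>x. of_real (r x) * ys n x + ?u x)"
      using dom_A_quasi_system [OF ys(1) ae_eq_refl, of n] by (simp add: quasi_system_def)
    note q = this
    have "norm (ys n b - ys n a) = norm (integral {a..b} (\<lambda>x. of_real (r x) * ys n x + ?u x))"
      using primitive_diff [OF q that] by simp
    also have "\<dots> \<le> integral {a..b} (\<lambda>x. C * ?m x)"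
    proof (intro integral_norm_bound_integral integrable_on_mult_right)
      show "(\<lambda>x. of_real (r x) * ys n x + ?u x) integrable_on {a..b}" "?m integrable_on {a..b}"
        using that by (auto intro!: primitive_integrable [OF q] primitive_integrable [OF p])
      fix x assume x: "x \<in> {a..b}"
      have "norm (of_real (r x) * ys n x + ?u x) \<le> norm (of_real (r x) * ys n x) + norm (?u x)"
        by (rule norm_triangle_ineq)
      also have "\<dots> \<le> \<bar>r x\<bar> * C + C"
        using bound [of x n] x that by (auto simp: norm_mult intro!: add_mono mult_left_mono)
      finally show "norm (of_real (r x) * ys n x + ?u x) \<le> C * ?m x" by (simp add: algebra_simps)
    qed
    also have "\<dots> = C * (\<Psi> b - \<Psi> a)" using primitive_diff [OF p that] by simp
    finally show ?thesis .
  qed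
  have contP: "continuous_on {0..1} \<Psi>" by (rule primitive_continuous_on [OF p])
  show thesis
  proof (rule Arzela_Ascoli [of "{0..1}" ys C])
    show "norm (ys n x) \<le> C" if "x \<in> {0..1}" for n x using bound [OF that] by blast
    fix x e :: real assume x: "x \<in> {0..1}" and e: "0 < e"
    then have "e / C > 0" using C_pos by simp
    then obtain d where d: "d > 0" "\<And>y. y \<in> {0..1} \<Longrightarrow> dist y x < d \<Longrightarrow> dist (\<Psi> y) (\<Psi> x) < e / C"
      using contP x unfolding continuous_on_iff by metis
    show "\<exists>d. 0 < d \<and> (\<forall>n y. y \<in> {0..1} \<and> norm (x - y) < d \<longrightarrow> norm (ys n x - ys n y) < e)"
    proof (intro exI [of _ d] conjI allI impI d(1))
      fix n y assume y: "y \<in> {0..1} \<and> norm (x - y) < d"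
      then have "\<bar>\<Psi> y - \<Psi> x\<bar> < e / C" using d(2) [of y] by (simp add: dist_real_def abs_minus_commute)
      then have "C * \<bar>\<Psi> y - \<Psi> x\<bar> < e" using C_pos by (simp add: field_simps)
      moreover have "norm (ys n x - ys n y) \<le> C * \<bar>\<Psi> y - \<Psi> x\<bar>"
      proof (cases "x \<le> y")
        case True
        have "norm (ys n y - ys n x) \<le> C * (\<Psi> y - \<Psi> x)" using mono [of x y n] True x y by auto
        also have "\<dots> \<le> C * \<bar>\<Psi> y - \<Psi> x\<bar>" using C_pos by (intro mult_left_mono) auto
        finally show ?thesis by (simp add: norm_minus_commute)
      next
        case False
        have "norm (ys n x - ys n y) \<le> C * (\<Psi> x - \<Psi> y)" using mono [of y x n] False x y by auto
        also have "\<dots> \<le> C * \<bar>\<Psi> y - \<Psi> x\<bar>" using C_pos by (intro mult_left_mono) auto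
        finally show ?thesis .
      qed
      ultimately show "norm (ys n x - ys n y) < e" by simp
    qed
  qed (auto intro: that)
qed

context
  fixes S :: "(real \<Rightarrow> complex) set" and \<mu> :: "(real \<Rightarrow> complex) \<Rightarrow> real"
  assumes S: "\<And>e. e \<in> S \<Longrightarrow> e \<in> dom_A r" "\<And>e. e \<in> S \<Longrightarrow> op_A r e =\<^sub>a\<^sub>e (\<lambda>x. of_real (\<mu> e) * e x)"
    "\<And>e. e \<in> S \<Longrightarrow> \<mu> e \<noteq> 0"
begin

text \<open>The complement of the eigenvectors in \<open>S\<close> is invariant under
  \<open>A\<close> and under its inverse; the latter uses \<mu> e \<noteq> 0.\<close>

lemma orth_op_A_iff:
  assumes y: "y \<in> dom_A r" and f: "op_A r y =\<^sub>a\<^sub>e f"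
  shows "orth S f \<longleftrightarrow> orth S y"
proof -
  have "L2_inner f e = of_real (\<mu> e) * L2_inner y e" if e: "e \<in> S" for e
  proof -
    note eD = S(1) [OF e]
    have "L2_inner f e = L2_inner (op_A r y) e"
      by (rule L2_inner_ae_cong [symmetric, OF f ae_eq_refl dom_A_L2 [OF y] dom_A_in_L2 [OF eD]])
    also have "\<dots> = L2_inner y (op_A r e)" by (rule op_A_symmetric [OF r y eD])
    also have "\<dots> = L2_inner y (\<lambda>x. of_real (\<mu> e) * e x)"
      by (rule L2_inner_ae_cong [OF ae_eq_refl S(2) [OF e] dom_A_in_L2 [OF y] dom_A_L2 [OF eD]])
    finally show ?thesis by (simp add: L2_inner_scale_right)
  qed
  then show ?thesis using S(3) by (simp add: orth_def)
qed

lemma S_L2: "S \<subseteq> L2"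
  using S(1) dom_A_in_L2 by blast

text \<open>Cauchy-Schwarz for the form \<open>(A y, z) - m (A y, A z)\<close> with \<open>A z = y - m A y\<close>: a minimising
  sequence consists of approximate eigenvectors.\<close>

lemma residual_le:
  assumes m: "m \<le> 0" and low: "\<And>y. y \<in> dom_A r \<Longrightarrow> orth S y \<Longrightarrow> m * (L2_norm (op_A r y))\<^sup>2 \<le> energy r y"
    and y: "y \<in> dom_A r" "orth S y"
  shows "(L2_norm (\<lambda>x. y x + of_real (- m) * op_A r y x))\<^sup>2
    \<le> (C - m) * (energy r y - m * (L2_norm (op_A r y))\<^sup>2)"
proof -
  let ?f = "\<lambda>x. y x + of_real (- m) * op_A r y x"
  have yL: "y \<in> L2" "op_A r y \<in> L2" by (auto intro: dom_A_in_L2 dom_A_L2 y)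
  have fL: "?f \<in> L2" by (intro L2_add L2_scale yL)
  have f_orth: "orth S ?f"
    by (intro orth_lincomb S_L2 yL y(2)) (simp add: orth_op_A_iff [OF y(1) ae_eq_refl] y(2))
  obtain z where z: "z \<in> dom_A r" "op_A r z =\<^sub>a\<^sub>e ?f" using surj [OF fL] by blast
  have z_orth: "orth S z" using orth_op_A_iff [OF z] f_orth by simp
  define q where "q y = energy r y - m * (L2_norm (op_A r y))\<^sup>2" for y
  have zf: "L2_norm (op_A r z) = L2_norm ?f" by (rule L2_norm_ae_cong [OF z(2) dom_A_L2 [OF z(1)]])
  let ?B = "L2_inner (op_A r z) y - of_real m * L2_inner (op_A r z) (op_A r y)"
  have "(norm ?B)\<^sup>2 \<le> q y * q z"
  proof (rule hermitian_Cauchy_Schwarz)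
    fix t :: complex
    have "(\<lambda>x. y x + t * z x) \<in> dom_A r" "orth S (\<lambda>x. y x + t * z x)"
      using dom_A_lincomb [OF y(1) z(1)] orth_lincomb [OF S_L2 yL(1) dom_A_in_L2 [OF z(1)] y(2) z_orth] by auto
    from low [OF this] have "0 \<le> q (\<lambda>x. y x + t * z x)" by (simp add: q_def)
    also have "\<dots> = q y + 2 * (Re (t * L2_inner (op_A r z) y) - m * Re (t * L2_inner (op_A r z) (op_A r y))) + (norm t)\<^sup>2 * q z"
      unfolding q_def energy_lincomb [OF r y(1) z(1)] norm_op_A_lincomb [OF y(1) z(1)]
      by (simp only: ring_distribs mult_ac)
    also have "Re (t * L2_inner (op_A r z) y) - m * Re (t * L2_inner (op_A r z) (op_A r y)) = Re (t * ?B)"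
      by (simp add: algebra_simps)
    finally show "0 \<le> q y + 2 * Re (t * ?B) + (norm t)\<^sup>2 * q z" .
  next
    show "0 \<le> q z" using low [OF z(1) z_orth] by (simp add: q_def)
  qed
  also have "?B = L2_inner (op_A r z) ?f"
    using L2_inner_add_right [OF yL(1) L2_scale [OF yL(2)] dom_A_L2 [OF z(1)], of "of_real (- m)"]
    by (simp only: L2_inner_scale_right) simp
  also have "\<dots> = L2_inner ?f ?f" by (rule L2_inner_ae_cong [OF z(2) ae_eq_refl dom_A_L2 [OF z(1)] fL])
  also have "norm (L2_inner ?f ?f) = (L2_norm ?f)\<^sup>2"
    unfolding L2_inner_self norm_of_real by (rule abs_of_nonneg) (rule zero_le_power2)
  finally have 1: "((L2_norm ?f)\<^sup>2)\<^sup>2 \<le> q y * q z" .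
  have "q z \<le> (C - m) * (L2_norm ?f)\<^sup>2"
    using abs_energy_le [OF z(1)] by (simp add: q_def zf algebra_simps)
  moreover have qy: "q y \<ge> 0" using low [OF y] by (simp add: q_def)
  ultimately have "((L2_norm ?f)\<^sup>2)\<^sup>2 \<le> q y * ((C - m) * (L2_norm ?f)\<^sup>2)"
    using 1 mult_left_mono order_trans by blast
  then have *: "(L2_norm ?f)\<^sup>2 * (L2_norm ?f)\<^sup>2 \<le> ((C - m) * q y) * (L2_norm ?f)\<^sup>2"
    by (simp add: power2_eq_square mult_ac)
  show ?thesis
  proof (cases "L2_norm ?f = 0")
    case True
    then show ?thesis using qy C_pos m by (simp add: q_def)
  next
    case False
    then have "(L2_norm ?f)\<^sup>2 > 0" by simp
    then have "(L2_norm ?f)\<^sup>2 \<le> (C - m) * q y" using * by (rule mult_right_le_imp_le [rotated])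
    then show ?thesis by (simp add: q_def)
  qed
qed

text \<open>Since \<open>A\<^sup>-\<^sup>1\<close> is compact into the continuous functions, the limit of a minimising sequence is
  found there, and completeness of \<open>L\<^sub>2\<close> is not needed.\<close>

lemma negative_eigenvector_exists:
  assumes y0: "y0 \<in> dom_A r" "orth S y0" "energy r y0 < 0"
  obtains w \<nu> where "w \<in> dom_A r" "orth S w" "\<not> w =\<^sub>a\<^sub>e (\<lambda>_. 0)" "\<nu> < 0" "op_A r w =\<^sub>a\<^sub>e (\<lambda>x. of_real \<nu> * w x)"
proof -
  \<comment> \<open>At an eigenvector the quotient of the energy by the squared norm of
    \<open>A y\<close> is the reciprocal of the eigenvalue; this is why \<nu> = 1/m in the
    end.\<close>
  define X where "X = {energy r y | y. y \<in> dom_A r \<and> orth S y \<and> L2_norm (op_A r y) = 1}"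
  have normalize: "energy r y / (L2_norm (op_A r y))\<^sup>2 \<in> X"
    if y: "y \<in> dom_A r" "orth S y" "L2_norm (op_A r y) \<noteq> 0" for y
  proof -
    let ?c = "complex_of_real (1 / L2_norm (op_A r y))"
    have nn: "norm ?c = 1 / L2_norm (op_A r y)" using L2_norm_nonneg [of "op_A r y"] by (simp add: norm_divide)
    have "orth S (\<lambda>x. ?c * y x)" using y(2) unfolding orth_def L2_inner_scale_left by simp
    moreover have "(\<lambda>x. ?c * y x) \<in> dom_A r" by (rule dom_A_scale(1) [OF y(1)])
    moreover have "L2_norm (op_A r (\<lambda>x. ?c * y x)) = 1" using energy_scale(2) [OF y(1), of ?c] nn y(3) by simp
    moreover have "energy r (\<lambda>x. ?c * y x) = energy r y / (L2_norm (op_A r y))\<^sup>2"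
      using energy_scale(1) [OF y(1), of ?c] nn by (simp add: power_divide)
    ultimately show ?thesis unfolding X_def by (intro CollectI exI [of _ "\<lambda>x. ?c * y x"]) auto
  qed
  have zero: "energy r y = 0" if "y \<in> dom_A r" "L2_norm (op_A r y) = 0" for y
    using abs_energy_le [OF that(1)] that(2) by simp
  have ny0: "L2_norm (op_A r y0) \<noteq> 0" using zero [OF y0(1)] y0(3) by auto
  have X0: "energy r y0 / (L2_norm (op_A r y0))\<^sup>2 \<in> X" by (rule normalize [OF y0(1,2) ny0])
  have bdd: "bdd_below X"
    unfolding X_def bdd_below_def
  proof (intro exI [of _ "- C"] ballI)
    fix a assume "a \<in> {energy r y | y. y \<in> dom_A r \<and> orth S y \<and> L2_norm (op_A r y) = 1}"
    then obtain y where "a = energy r y" "y \<in> dom_A r" "L2_norm (op_A r y) = 1" by blast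
    then show "- C \<le> a" using abs_energy_le [of y] by simp
  qed
  define m where "m = Inf X"
  have m_neg: "m < 0"
  proof -
    have "m \<le> energy r y0 / (L2_norm (op_A r y0))\<^sup>2" unfolding m_def by (rule cInf_lower [OF X0 bdd])
    also have "\<dots> < 0" using y0(3) ny0 by (simp add: divide_neg_pos)
    finally show ?thesis .
  qed
  have low: "m * (L2_norm (op_A r y))\<^sup>2 \<le> energy r y" if y: "y \<in> dom_A r" "orth S y" for y
  proof (cases "L2_norm (op_A r y) = 0")
    case False
    have "m \<le> energy r y / (L2_norm (op_A r y))\<^sup>2" unfolding m_def by (rule cInf_lower [OF normalize [OF y False] bdd])
    then show ?thesis using False by (simp add: pos_le_divide_eq)
  qed (use zero [OF y(1)] in simp)
  have "\<exists>y. y \<in> dom_A r \<and> orth S y \<and> L2_norm (op_A r y) = 1 \<and> energy r y < m + 1 / real (Suc n)" for n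
  proof -
    have "Inf X < m + 1 / real (Suc n)" by (simp add: m_def)
    then obtain a where "a \<in> X" "a < m + 1 / real (Suc n)"
      using cInf_lessD [of X] X0 by blast
    then show ?thesis by (auto simp: X_def)
  qed
  then obtain ys where ys: "\<And>n. ys n \<in> dom_A r" "\<And>n. orth S (ys n)" "\<And>n. L2_norm (op_A r (ys n)) = 1"
      "\<And>n. energy r (ys n) < m + 1 / real (Suc n)"
    using choice [of "\<lambda>n y. y \<in> dom_A r \<and> orth S y \<and> L2_norm (op_A r y) = 1 \<and> energy r y < m + 1 / real (Suc n)"]
    by blast
  obtain g k where g: "continuous_on {0..1} g" "strict_mono (k :: nat \<Rightarrow> nat)"
    "\<And>e. 0 < e \<Longrightarrow> \<exists>N. \<forall>n x. n \<ge> N \<and> x \<in> {0..1} \<longrightarrow> norm (ys (k n) x - g x) < e"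
    by (rule op_A_compact [of ys]) (use ys in auto)
  have gL: "g \<in> L2" by (rule continuous_imp_L2 [OF g(1)])
  define \<delta> where "\<delta> n = L2_norm (\<lambda>x. of_real m * op_A r (ys (k n)) x - g x)" for n
  have ysL: "ys n \<in> L2" "op_A r (ys n) \<in> L2" for n by (auto intro: dom_A_in_L2 dom_A_L2 ys)
  have lim1: "(\<lambda>n. L2_norm (\<lambda>x. ys (k n) x - g x)) \<longlonglongrightarrow> 0"
  proof (rule LIMSEQ_I)
    fix e :: real assume "e > 0"
    then have "e/2 > 0" by simp
    then obtain N where N: "\<And>n x. n \<ge> N \<Longrightarrow> x \<in> {0..1} \<Longrightarrow> norm (ys (k n) x - g x) < e/2" using g(3) by meson
    have "L2_norm (\<lambda>x. ys (k n) x - g x) \<le> e/2" if "n \<ge> N" for n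
      using N [OF that]
      by (intro L2_norm_le_sup continuous_on_diff dom_A_continuous [OF ys(1)] g(1)) (auto intro: less_imp_le)
    then show "\<exists>no. \<forall>n\<ge>no. norm (L2_norm (\<lambda>x. ys (k n) x - g x) - 0) < e"
      using \<open>e > 0\<close> by (intro exI [of _ N]) (fastforce simp: L2_norm_nonneg)
  qed
  have lim2: "(\<lambda>n. L2_norm (\<lambda>x. ys (k n) x + of_real (- m) * op_A r (ys (k n)) x)) \<longlonglongrightarrow> 0"
  proof (rule tendsto_sandwich [OF _ _ tendsto_const])
    have "(\<lambda>n. sqrt ((C - m) * (1 / real (Suc n)))) \<longlonglongrightarrow> sqrt ((C - m) * 0)"
      by (intro tendsto_intros LIMSEQ_Suc lim_1_over_n)
    then show "(\<lambda>n. sqrt ((C - m) * (1 / real (Suc n)))) \<longlonglongrightarrow> 0" by simp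
    show "\<forall>\<^sub>F n in sequentially. L2_norm (\<lambda>x. ys (k n) x + of_real (- m) * op_A r (ys (k n)) x)
        \<le> sqrt ((C - m) * (1 / real (Suc n)))"
    proof (intro always_eventually allI real_le_rsqrt)
      fix n
      have "(L2_norm (\<lambda>x. ys (k n) x + of_real (- m) * op_A r (ys (k n)) x))\<^sup>2
          \<le> (C - m) * (energy r (ys (k n)) - m * (L2_norm (op_A r (ys (k n))))\<^sup>2)"
        using m_neg by (intro residual_le low ys) auto
      also have "\<dots> \<le> (C - m) * (1 / real (Suc n))"
      proof (intro mult_left_mono)
        have "n \<le> k n" by (rule seq_suble [OF g(2)])
        then have "1 / real (Suc (k n)) \<le> 1 / real (Suc n)" by (simp add: frac_le)
        then show "energy r (ys (k n)) - m * (L2_norm (op_A r (ys (k n))))\<^sup>2 \<le> 1 / real (Suc n)"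
          using ys(4) [of "k n"] ys(3) [of "k n"] by simp
      qed (use C_pos m_neg in auto)
      finally show "(L2_norm (\<lambda>x. ys (k n) x + of_real (- m) * op_A r (ys (k n)) x))\<^sup>2 \<le> (C - m) * (1 / real (Suc n))" .
    qed
  qed (auto simp: L2_norm_nonneg)
  have \<delta>0: "\<delta> \<longlonglongrightarrow> 0"
  proof (rule tendsto_sandwich [OF _ _ tendsto_const])
    show "(\<lambda>n. L2_norm (\<lambda>x. ys (k n) x - g x) + L2_norm (\<lambda>x. ys (k n) x + of_real (- m) * op_A r (ys (k n)) x)) \<longlonglongrightarrow> 0"
      using tendsto_add [OF lim1 lim2] by simp
    show "\<forall>\<^sub>F n in sequentially. \<delta> n \<le> L2_norm (\<lambda>x. ys (k n) x - g x) + L2_norm (\<lambda>x. ys (k n) x + of_real (- m) * op_A r (ys (k n)) x)"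
    proof (intro always_eventually allI)
      fix n
      let ?a = "\<lambda>x. ys (k n) x - g x" and ?b = "\<lambda>x. ys (k n) x + of_real (- m) * op_A r (ys (k n)) x"
      have "?a \<in> L2" "(\<lambda>x. (-1) * ?b x) \<in> L2" by (intro L2_diff L2_add L2_scale ysL gL)+
      from L2_norm_triangle [OF this] have "L2_norm (\<lambda>x. ?a x + (-1) * ?b x) \<le> L2_norm ?a + L2_norm ?b"
        by (simp only: L2_norm_scale) simp
      moreover have "(\<lambda>x. ?a x + (-1) * ?b x) = (\<lambda>x. of_real m * op_A r (ys (k n)) x - g x)" by auto
      ultimately show "\<delta> n \<le> L2_norm ?a + L2_norm ?b" by (simp add: \<delta>_def)
    qed
  qed (auto simp: L2_norm_nonneg \<delta>_def)
  obtain w where w: "w \<in> dom_A r" "op_A r w =\<^sub>a\<^sub>e g" using surj [OF gL] by blast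
  \<comment> \<open>Since \<open>m * A y - g\<close> tends to 0 in L_2 along the subsequence, the
    sup bound \<open>C_bound\<close> makes \<open>m * y\<close> converge uniformly to
    \<open>w\<close>, whereas \<open>y\<close> converges to \<open>g\<close>.\<close>
  have wg: "w x = of_real m * g x" if x: "x \<in> {0..1}" for x
  proof -
    have "(\<lambda>n. of_real m * ys (k n) x - w x) \<longlonglongrightarrow> 0"
    proof (rule Lim_null_comparison)
      show "(\<lambda>n. C * \<delta> n) \<longlonglongrightarrow> 0" using tendsto_mult_right_zero [OF \<delta>0] .
      show "\<forall>\<^sub>F n in sequentially. norm (of_real m * ys (k n) x - w x) \<le> C * \<delta> n"
      proof (intro always_eventually allI)
        fix n
        let ?v = "\<lambda>x. of_real m * ys (k n) x + (-1) * w x"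
        have my: "(\<lambda>x. of_real m * ys (k n) x) \<in> dom_A r" by (rule dom_A_scale(1) [OF ys(1)])
        have 1: "op_A r ?v =\<^sub>a\<^sub>e (\<lambda>x. op_A r (\<lambda>x. of_real m * ys (k n) x) x + (-1) * op_A r w x)"
          by (rule dom_A_lincomb(2) [OF my w(1)])
        have 2: "(\<lambda>x. op_A r (\<lambda>x. of_real m * ys (k n) x) x + (-1) * op_A r w x)
            =\<^sub>a\<^sub>e (\<lambda>x. of_real m * op_A r (ys (k n)) x + (-1) * g x)"
          by (rule ae_eq_comp2 [OF dom_A_scale(2) [OF ys(1)] w(2), where h = "\<lambda>_ a b. a + (-1) * b"])
        have "op_A r ?v =\<^sub>a\<^sub>e (\<lambda>x. of_real m * op_A r (ys (k n)) x - g x)"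
          using ae_eq_trans [OF 1 2] by simp
        moreover have "(\<lambda>x. of_real m * op_A r (ys (k n)) x - g x) \<in> L2" by (intro L2_diff L2_scale ysL gL)
        ultimately show "norm (of_real m * ys (k n) x - w x) \<le> C * \<delta> n"
          using C_bound [OF dom_A_lincomb(1) [OF my w(1), of "-1"] _ _ x] by (simp add: \<delta>_def)
      qed
    qed
    moreover have "(\<lambda>n. ys (k n) x) \<longlonglongrightarrow> g x"
      unfolding LIMSEQ_iff using g(3) x by meson
    then have "(\<lambda>n. of_real m * ys (k n) x - w x) \<longlonglongrightarrow> of_real m * g x - w x" by (intro tendsto_intros)
    ultimately show ?thesis using LIMSEQ_unique by force
  qed
  \<comment> \<open>The normalisation of \<open>A y\<close> to norm 1 survives in the limit because
    m \<noteq> 0.\<close>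
  have g_ne: "L2_norm g \<noteq> 0"
  proof
    assume "L2_norm g = 0"
    have "- m \<le> \<delta> n + L2_norm g" for n
    proof -
      have "(\<lambda>x. of_real m * op_A r (ys (k n)) x - g x) \<in> L2" by (intro L2_diff L2_scale ysL gL)
      from L2_norm_triangle [OF this gL] have "L2_norm (\<lambda>x. of_real m * op_A r (ys (k n)) x) \<le> \<delta> n + L2_norm g"
        by (simp add: \<delta>_def)
      then show ?thesis using m_neg by (simp add: L2_norm_scale ys(3))
    qed
    then have "- m \<le> 0"
      using \<open>L2_norm g = 0\<close> by (intro LIMSEQ_le_const [OF \<delta>0]) auto
    then show False using m_neg by simp
  qed
  have w_ne: "\<not> w =\<^sub>a\<^sub>e (\<lambda>_. 0)"
  proof
    assume "w =\<^sub>a\<^sub>e (\<lambda>_. 0)"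
    then have "g x = 0" if "x \<in> {0..1}" for x
      using dom_A_ae_zero [OF w(1) _ that] wg [OF that] m_neg by simp
    then have "g =\<^sub>a\<^sub>e (\<lambda>_. 0)" by (rule ae_eq_on)
    from L2_norm_ae_cong [OF this gL] g_ne show False by (simp add: L2_norm_def)
  qed
  have g_orth: "orth S g"
    unfolding orth_def
  proof
    fix e assume e: "e \<in> S"
    have eL: "e \<in> L2" by (rule dom_A_in_L2 [OF S(1) [OF e]])
    have "norm (L2_inner g e) \<le> L2_norm (\<lambda>x. ys (k n) x - g x) * L2_norm e" for n
    proof -
      have "L2_inner (\<lambda>x. ys (k n) x - g x) e = - L2_inner g e"
        using ys(2) [of "k n"] e by (simp add: L2_inner_diff_left [OF ysL(1) gL eL] orth_def)
      then show ?thesis using L2_Cauchy_Schwarz [OF L2_diff [OF ysL(1) [of "k n"] gL] eL] by simp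
    qed
    then have "norm (L2_inner g e) \<le> 0"
      by (intro LIMSEQ_le_const [OF tendsto_mult_left_zero [OF lim1, of "L2_norm e"]]) auto
    then show "L2_inner g e = 0" by simp
  qed
  have "orth S w" using orth_op_A_iff [OF w] g_orth by simp
  moreover have "op_A r w =\<^sub>a\<^sub>e (\<lambda>x. of_real (1 / m) * w x)"
    using w(2) by (rule ae_eq_trans) (rule ae_eq_on, use wg m_neg in simp)
  ultimately show thesis using w(1) w_ne m_neg by (intro that [of w "1/m"]) auto
qed

end

end

section \<open>Finiteness and counting of negative eigenvalues\<close>

lemma op_A_invertible:
  assumes r: "r \<in> L2" and inj: "\<And>y. y \<in> dom_A r \<Longrightarrow> op_A r y =\<^sub>a\<^sub>e (\<lambda>_. 0) \<Longrightarrow> y =\<^sub>a\<^sub>e (\<lambda>_. 0)"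
  obtains C where "C > 0" "\<And>f. f \<in> L2 \<Longrightarrow> \<exists>y\<in>dom_A r. op_A r y =\<^sub>a\<^sub>e f"
    "\<And>y f x. y \<in> dom_A r \<Longrightarrow> f \<in> L2 \<Longrightarrow> op_A r y =\<^sub>a\<^sub>e f \<Longrightarrow> x \<in> {0..1} \<Longrightarrow>
      norm (y x) \<le> C * L2_norm f \<and> norm (quasi_deriv r y x) \<le> C * L2_norm f"
proof -
  have z: "(\<lambda>_. 0) \<in> (L2 :: (real \<Rightarrow> complex) set)" by (rule continuous_imp_L2) auto
  have inj': "y =\<^sub>a\<^sub>e (\<lambda>_. 0)" if "y \<in> dom_A r" "op_A r y =\<^sub>a\<^sub>e (\<lambda>x. - ((\<lambda>_. 0) x * y x))" for y
    using inj that by simp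
  show thesis
    by (rule resolvent [OF r z inj']) (auto intro: that)
qed

lemma op_A_eigenvectors_orthogonal:
  assumes r: "r \<in> L2" and y: "y \<in> dom_A r" "op_A r y =\<^sub>a\<^sub>e (\<lambda>x. of_real \<mu> * y x)"
    and z: "z \<in> dom_A r" "op_A r z =\<^sub>a\<^sub>e (\<lambda>x. of_real \<nu> * z x)" and ne: "\<mu> \<noteq> \<nu>"
  shows "L2_inner y z = 0"
proof -
  have "of_real \<mu> * L2_inner y z = L2_inner (op_A r y) z"
    using L2_inner_ae_cong [OF y(2) ae_eq_refl dom_A_L2 [OF y(1)] dom_A_in_L2 [OF z(1)]]
    by (simp add: L2_inner_scale_left)
  also have "\<dots> = L2_inner y (op_A r z)" by (rule op_A_symmetric [OF r y(1) z(1)])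
  also have "\<dots> = of_real \<nu> * L2_inner y z"
    using L2_inner_ae_cong [OF ae_eq_refl z(2) dom_A_in_L2 [OF y(1)] dom_A_L2 [OF z(1)]]
    by (simp add: L2_inner_scale_right)
  finally show ?thesis using ne by simp
qed

text \<open>Eigenvectors scaled so that \<open>A y\<close> has norm 1 have norm 1 / |\<mu>|, which
  \<open>negative_eigenvalue_bound\<close> keeps at least 1/M. Being mutually orthogonal, they
  cannot have a uniformly convergent subsequence, contrary to \<open>op_A_compact\<close>.\<close>

lemma finite_negative_eigenvalues:
  assumes r: "r \<in> L2" and inj: "\<And>y. y \<in> dom_A r \<Longrightarrow> op_A r y =\<^sub>a\<^sub>e (\<lambda>_. 0) \<Longrightarrow> y =\<^sub>a\<^sub>e (\<lambda>_. 0)"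
  shows "finite {\<mu>::real. \<mu> < 0 \<and> op_eigenvalue (dom_A r) (op_A r) (of_real \<mu>)}" (is "finite ?N")
proof (rule ccontr)
  assume "infinite ?N"
  then obtain \<mu> :: "nat \<Rightarrow> real" where \<mu>: "inj \<mu>" "range \<mu> \<subseteq> ?N"
    using infinite_countable_subset by blast
  have \<mu>_neg: "\<mu> n < 0" for n using \<mu>(2) by auto
  have "\<exists>e. e \<in> dom_A r \<and> \<not> e =\<^sub>a\<^sub>e (\<lambda>_. 0) \<and> op_A r e =\<^sub>a\<^sub>e (\<lambda>x. of_real (\<mu> n) * e x)" for n
    using \<mu>(2) by (auto simp: op_eigenvalue_def)
  then obtain e where e: "\<And>n. e n \<in> dom_A r" "\<And>n. \<not> e n =\<^sub>a\<^sub>e (\<lambda>_. 0)"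
      "\<And>n. op_A r (e n) =\<^sub>a\<^sub>e (\<lambda>x. of_real (\<mu> n) * e n x)"
    using choice [of "\<lambda>n e. e \<in> dom_A r \<and> \<not> e =\<^sub>a\<^sub>e (\<lambda>_. 0) \<and> op_A r e =\<^sub>a\<^sub>e (\<lambda>x. of_real (\<mu> n) * e x)"] by blast
  have ne: "L2_norm (e n) > 0" for n
    using L2_norm_zero_imp_ae [OF dom_A_in_L2 [OF e(1)]] e(2) L2_norm_nonneg [of "e n"] by (metis less_le)
  define M where "M = 64 * (L2_norm (\<lambda>x. of_real (r x))) ^ 4"
  have M: "- \<mu> n \<le> M" for n
    unfolding M_def by (rule negative_eigenvalue_bound [OF r e(1,3,2)])
  have M_pos: "M > 0" using M [of 0] \<mu>_neg [of 0] by linarith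
  define c where "c n = complex_of_real (1 / (- \<mu> n * L2_norm (e n)))" for n
  define ys where "ys n x = c n * e n x" for n x
  have nc: "norm (c n) = 1 / (- \<mu> n * L2_norm (e n))" for n
    using \<mu>_neg [of n] ne [of n] unfolding c_def norm_of_real by (intro abs_of_pos) (simp add: mult_neg_pos)
  have ys: "ys n \<in> dom_A r" for n unfolding ys_def by (rule dom_A_scale(1) [OF e(1)])
  have nys: "L2_norm (ys n) = 1 / (- \<mu> n)" for n
    using ne [of n] unfolding ys_def L2_norm_scale nc by simp
  have "op_A r (ys n) =\<^sub>a\<^sub>e (\<lambda>x. of_real (\<mu> n) * ys n x)" for n
    using ae_eq_trans [OF dom_A_scale(2) [OF e(1)] ae_eq_comp [OF e(3), of "\<lambda>_ a. c n * a"]]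
    by (simp add: ys_def [abs_def] mult_ac)
  note ysA = this
  have nA: "L2_norm (op_A r (ys n)) \<le> 1" for n
    using L2_norm_ae_cong [OF ysA dom_A_L2 [OF ys]] nys [of n] \<mu>_neg [of n] by (simp add: L2_norm_scale)
  obtain C where C: "C > 0" "\<And>f. f \<in> L2 \<Longrightarrow> \<exists>y\<in>dom_A r. op_A r y =\<^sub>a\<^sub>e f"
    "\<And>y f x. y \<in> dom_A r \<Longrightarrow> f \<in> L2 \<Longrightarrow> op_A r y =\<^sub>a\<^sub>e f \<Longrightarrow> x \<in> {0..1} \<Longrightarrow>
      norm (y x) \<le> C * L2_norm f \<and> norm (quasi_deriv r y x) \<le> C * L2_norm f"
    by (rule op_A_invertible [OF r inj]) auto
  obtain g k where g: "continuous_on {0..1} g" "strict_mono (k :: nat \<Rightarrow> nat)"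
    "\<And>e. 0 < e \<Longrightarrow> \<exists>N. \<forall>n x. n \<ge> N \<and> x \<in> {0..1} \<longrightarrow> norm (ys (k n) x - g x) < e"
    by (rule op_A_compact [OF r C, of ys]) (use ys nA in auto)
  \<comment> \<open>Two members within \<epsilon> of the limit are at distance at most 2 \<epsilon>
    = 1/(2 M), but by orthogonality their distance is at least the norm of one of them, so at least
    1/M.\<close>
  define \<epsilon> where "\<epsilon> = 1 / (4 * M)"
  have "\<epsilon> > 0" using M_pos by (simp add: \<epsilon>_def)
  then obtain N where N: "\<And>n x. n \<ge> N \<Longrightarrow> x \<in> {0..1} \<Longrightarrow> norm (ys (k n) x - g x) < \<epsilon>"
    using g(3) by meson
  let ?y = "ys (k N)" and ?z = "ys (k (Suc N))"
  have "norm (?y x + (-1) * ?z x) \<le> 2 * \<epsilon>" if "x \<in> {0..1}" for x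
  proof -
    have "?y x + (-1) * ?z x = (?y x - g x) - (?z x - g x)" by simp
    then have "norm (?y x + (-1) * ?z x) \<le> norm (?y x - g x) + norm (?z x - g x)"
      by (metis norm_triangle_ineq4)
    then show ?thesis using N [of N x] N [of "Suc N" x] that by auto
  qed
  then have "L2_norm (\<lambda>x. ?y x + (-1) * ?z x) \<le> 2 * \<epsilon>"
    by (intro L2_norm_le_sup continuous_intros dom_A_continuous [OF ys]) auto
  then have "(L2_norm (\<lambda>x. ?y x + (-1) * ?z x))\<^sup>2 \<le> (2 * \<epsilon>)\<^sup>2"
    using L2_norm_nonneg by (intro power_mono)
  moreover have "L2_inner ?z ?y = 0"
  proof (rule op_A_eigenvectors_orthogonal [OF r ys ysA ys ysA])
    have "k (Suc N) \<noteq> k N" using g(2) by (metis n_not_Suc_n strict_mono_eq)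
    then show "\<mu> (k (Suc N)) \<noteq> \<mu> (k N)" using \<mu>(1) by (simp add: inj_eq)
  qed
  ultimately have "(L2_norm ?y)\<^sup>2 + (L2_norm ?z)\<^sup>2 \<le> (2 * \<epsilon>)\<^sup>2"
    using L2_norm_add_sq [OF dom_A_in_L2 [OF ys] dom_A_in_L2 [OF ys], of "k N" "-1" "k (Suc N)"] by simp
  moreover have "(L2_norm ?y)\<^sup>2 \<ge> (1 / M)\<^sup>2"
    unfolding nys using M M_pos \<mu>_neg [of "k N"] by (intro power_mono frac_le) auto
  moreover have "(2 * \<epsilon>)\<^sup>2 < (1 / M)\<^sup>2"
    using M_pos by (intro power_strict_mono) (auto simp: \<epsilon>_def field_simps)
  ultimately show False using zero_le_power2 [of "L2_norm ?z"] by linarith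
qed

text \<open>A subspace on which the form of \<open>A\<close> is nonpositive has dimension at most
  \<open>num_neg_eigenvalues r\<close>.\<close>

lemma energy_nonneg_combination:
  assumes r: "r \<in> L2" and inj: "\<And>y. y \<in> dom_A r \<Longrightarrow> op_A r y =\<^sub>a\<^sub>e (\<lambda>_. 0) \<Longrightarrow> y =\<^sub>a\<^sub>e (\<lambda>_. 0)"
    and ys: "\<And>j. j \<le> num_neg_eigenvalues r \<Longrightarrow> ys j \<in> dom_A r"
  obtains c where "\<exists>j\<le>num_neg_eigenvalues r. c j \<noteq> 0"
    "energy r (\<lambda>x. \<Sum>j\<le>num_neg_eigenvalues r. c j * ys j x) \<le> 0 \<Longrightarrow>
      (\<lambda>x. \<Sum>j\<le>num_neg_eigenvalues r. c j * ys j x) =\<^sub>a\<^sub>e (\<lambda>_. 0)"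
proof -
  let ?k = "num_neg_eigenvalues r"
  define N where "N = {\<mu>::real. \<mu> < 0 \<and> op_eigenvalue (dom_A r) (op_A r) (of_real \<mu>)}"
  have N: "finite N" "card N = ?k"
    using finite_negative_eigenvalues [OF r inj] by (auto simp: N_def num_neg_eigenvalues_def)
  have "\<exists>e. \<mu> \<in> N \<longrightarrow> e \<in> dom_A r \<and> \<not> e =\<^sub>a\<^sub>e (\<lambda>_. 0) \<and> op_A r e =\<^sub>a\<^sub>e (\<lambda>x. of_real \<mu> * e x)" for \<mu>
    by (auto simp: N_def op_eigenvalue_def)
  then obtain e where e: "\<And>\<mu>. \<mu> \<in> N \<Longrightarrow> e \<mu> \<in> dom_A r" "\<And>\<mu>. \<mu> \<in> N \<Longrightarrow> \<not> e \<mu> =\<^sub>a\<^sub>e (\<lambda>_. 0)"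
      "\<And>\<mu>. \<mu> \<in> N \<Longrightarrow> op_A r (e \<mu>) =\<^sub>a\<^sub>e (\<lambda>x. of_real \<mu> * e \<mu> x)"
    using choice [of "\<lambda>\<mu> e. \<mu> \<in> N \<longrightarrow> e \<in> dom_A r \<and> \<not> e =\<^sub>a\<^sub>e (\<lambda>_. 0) \<and> op_A r e =\<^sub>a\<^sub>e (\<lambda>x. of_real \<mu> * e x)"]
    by blast
  obtain h where h: "bij_betw h {..<?k} N"
    using ex_bij_betw_nat_finite [OF N(1)] N(2) by (auto simp: atLeast0LessThan)
  have hN: "h i \<in> N" if "i < ?k" for i using h that by (auto simp: bij_betw_def)
  \<comment> \<open>Orthogonality to the \<open>?k\<close> eigenvectors imposes \<open>?k\<close>
    linear conditions on \<open>?k + 1\<close> coefficients.\<close>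
  obtain c where c: "\<exists>j\<le>?k. c j \<noteq> 0" "\<And>i. i < ?k \<Longrightarrow> (\<Sum>j\<le>?k. L2_inner (ys j) (e (h i)) * c j) = 0"
    using homogeneous_system_nontrivial [of ?k "\<lambda>i j. L2_inner (ys j) (e (h i))"] by blast
  define Y where "Y x = (\<Sum>j\<le>?k. c j * ys j x)" for x
  have YD: "Y \<in> dom_A r" using dom_A_sum [of "{..?k}" ys r c] ys by (simp add: Y_def [abs_def])
  have inner_sum: "L2_inner (\<lambda>x. \<Sum>j\<in>J. c j * ys j x) f = (\<Sum>j\<in>J. c j * L2_inner (ys j) f)"
    if "finite J" "J \<subseteq> {..?k}" "f \<in> L2" for J f
    using that
  proof (induction J rule: finite_induct)
    case empty
    then show ?case by (simp add: L2_inner_def)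
  next
    case (insert j J)
    have "ys i \<in> L2" if "i \<in> insert j J" for i using insert.prems that by (intro dom_A_in_L2 [where r = r] ys) auto
    then have "(\<lambda>x. c j * ys j x) \<in> L2" "(\<lambda>x. \<Sum>i\<in>J. c i * ys i x) \<in> L2"
      by (auto intro!: L2_scale L2_sum)
    then show ?case using insert by (simp add: L2_inner_add_left L2_inner_scale_left)
  qed
  \<comment> \<open>The lemmas on \<open>S\<close> take the eigenvalue as a function of the
    eigenvector, so \<open>e\<close> has to be inverted.\<close>
  define \<mu>' where "\<mu>' f = (SOME \<mu>. \<mu> \<in> N \<and> f = e \<mu>)" for f
  have \<mu>': "\<mu>' f \<in> N \<and> f = e (\<mu>' f)" if "f \<in> e ` N" for f
    unfolding \<mu>'_def by (rule someI_ex) (use that in auto)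
  obtain C where C: "C > 0" "\<And>f. f \<in> L2 \<Longrightarrow> \<exists>y\<in>dom_A r. op_A r y =\<^sub>a\<^sub>e f"
    "\<And>y f x. y \<in> dom_A r \<Longrightarrow> f \<in> L2 \<Longrightarrow> op_A r y =\<^sub>a\<^sub>e f \<Longrightarrow> x \<in> {0..1} \<Longrightarrow>
      norm (y x) \<le> C * L2_norm f \<and> norm (quasi_deriv r y x) \<le> C * L2_norm f"
    by (rule op_A_invertible [OF r inj]) auto
  have S: "\<And>f. f \<in> e ` N \<Longrightarrow> f \<in> dom_A r" "\<And>f. f \<in> e ` N \<Longrightarrow> op_A r f =\<^sub>a\<^sub>e (\<lambda>x. of_real (\<mu>' f) * f x)"
    "\<And>f. f \<in> e ` N \<Longrightarrow> \<mu>' f \<noteq> 0"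
  proof -
    fix f assume "f \<in> e ` N"
    note f = \<mu>' [OF this]
    show "f \<in> dom_A r" "op_A r f =\<^sub>a\<^sub>e (\<lambda>x. of_real (\<mu>' f) * f x)" using f e(1,3) by metis+
    show "\<mu>' f \<noteq> 0" using f by (auto simp: N_def)
  qed
  have orth_Y: "orth (e ` N) Y"
    unfolding orth_def
  proof
    fix f assume "f \<in> e ` N"
    then obtain \<mu> where \<mu>: "\<mu> \<in> N" "f = e \<mu>" by blast
    then obtain i where i: "i < ?k" "\<mu> = h i" using h by (auto simp: bij_betw_def)
    have "L2_inner Y f = (\<Sum>j\<le>?k. c j * L2_inner (ys j) f)"
      unfolding Y_def by (rule inner_sum) (use \<mu> e(1) dom_A_in_L2 in auto)
    also have "\<dots> = 0" using c(2) [OF i(1)] \<mu>(2) i(2) by (simp add: mult.commute)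
    finally show "L2_inner Y f = 0" .
  qed
  \<comment> \<open>A negative energy would give a further eigenvector \<open>w\<close> orthogonal
    to all \<open>e \<mu>\<close>; its eigenvalue lies in \<open>N\<close> and eigenspaces are
    one-dimensional, so \<open>w\<close> would be orthogonal to itself.\<close>
  have nonneg: "0 \<le> energy r y" if y: "y \<in> dom_A r" "orth (e ` N) y" for y
  proof (rule ccontr)
    assume "\<not> 0 \<le> energy r y"
    then have neg: "energy r y < 0" by simp
    obtain w \<nu> where w: "w \<in> dom_A r" "orth (e ` N) w" "\<not> w =\<^sub>a\<^sub>e (\<lambda>_. 0)" "\<nu> < 0"
        "op_A r w =\<^sub>a\<^sub>e (\<lambda>x. of_real \<nu> * w x)"
      by (rule negative_eigenvector_exists [OF r C S y neg]) blast+
    then have \<nu>: "\<nu> \<in> N" by (auto simp: N_def op_eigenvalue_def)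
    have Q: "(\<lambda>_. - complex_of_real \<nu>) \<in> L2" by (intro continuous_imp_L2 continuous_intros)
    obtain a where a: "\<And>x. x \<in> {0..1} \<Longrightarrow> w x = a * e \<nu> x"
      by (rule eigenspace_one_dim [OF r Q, of w "e \<nu>"]) (use w e \<nu> in auto)
    have wL: "w \<in> L2" by (rule dom_A_in_L2 [OF w(1)])
    have "L2_inner w w = L2_inner w (\<lambda>x. a * e \<nu> x)"
      by (intro L2_inner_ae_cong ae_eq_refl ae_eq_on a wL)
    also have "\<dots> = 0" using w(2) \<nu> by (simp add: L2_inner_scale_right orth_def)
    finally have "L2_norm w = 0" by (simp add: L2_inner_self)
    then show False using L2_norm_zero_imp_ae [OF wL] w(3) by blast
  qed
  have "Y =\<^sub>a\<^sub>e (\<lambda>_. 0)" if le: "energy r Y \<le> 0"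
  proof -
    \<comment> \<open>Energy 0 must be excluded as well: \<open>Y\<close> is isotropic for a
      nonnegative form, so by Cauchy-Schwarz it is form-orthogonal to \<open>z\<close>, and with
      \<open>A z = Y\<close> this says that the norm of \<open>Y\<close> is 0.\<close>
    have Y0: "energy r Y = 0" using le nonneg [OF YD orth_Y] by simp
    have YL: "Y \<in> L2" by (rule dom_A_in_L2 [OF YD])
    obtain z where z: "z \<in> dom_A r" "op_A r z =\<^sub>a\<^sub>e Y" using C(2) [OF YL] by blast
    have "orth (e ` N) Y \<longleftrightarrow> orth (e ` N) z" by (rule orth_op_A_iff [OF r C S z])
    then have oz: "orth (e ` N) z" using orth_Y by simp
    have "(norm (L2_inner (op_A r z) Y))\<^sup>2 \<le> energy r Y * energy r z"
    proof (rule hermitian_Cauchy_Schwarz)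
      fix t :: complex
      have "0 \<le> energy r (\<lambda>x. Y x + t * z x)"
      proof (rule nonneg)
        show "orth (e ` N) (\<lambda>x. Y x + t * z x)"
          using S(1) dom_A_in_L2 by (intro orth_lincomb YL dom_A_in_L2 [OF z(1)] orth_Y oz) blast
      qed (rule dom_A_lincomb(1) [OF YD z(1)])
      then show "0 \<le> energy r Y + 2 * Re (t * L2_inner (op_A r z) Y) + (norm t)\<^sup>2 * energy r z"
        by (simp only: energy_lincomb [OF r YD z(1)])
    qed (rule nonneg [OF z(1) oz])
    then have "L2_inner (op_A r z) Y = 0" using Y0 by simp
    then have "L2_inner Y Y = 0"
      using L2_inner_ae_cong [OF z(2) ae_eq_refl dom_A_L2 [OF z(1)] YL] by simp
    then show ?thesis by (intro L2_norm_zero_imp_ae YL) (simp add: L2_inner_self)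
  qed
  then show thesis by (intro that [OF c(1)]) (simp add: Y_def [abs_def])
qed

section \<open>The indefinite form of the pencil\<close>

definition krein :: "(real \<Rightarrow> real) \<Rightarrow> (real \<Rightarrow> complex) \<times> (real \<Rightarrow> complex) \<Rightarrow>
    (real \<Rightarrow> complex) \<times> (real \<Rightarrow> complex) \<Rightarrow> complex" where
  "krein r P Q = L2_inner (op_A r (fst P)) (fst Q) + L2_inner (snd P) (snd Q)"

lemma op_B_L2:
  assumes "p \<in> L2" "continuous_on {0..1} y"
  shows "op_B p y \<in> L2"
proof -
  have "(\<lambda>x. 2 * (of_real (p x) * y x)) \<in> L2"
    by (intro L2_scale L2_mult_continuous L2_of_real assms)
  then show ?thesis by (simp add: op_B_def mult.assoc)
qed

lemma op_B_symmetric: "L2_inner (op_B p y) z = L2_inner y (op_B p z)"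
  unfolding L2_inner_def op_B_def by (simp add: mult_ac)

lemma pencil_L2: "p \<in> L2 \<Longrightarrow> y \<in> dom_A r \<Longrightarrow> pencil p r \<zeta> y \<in> L2"
  unfolding pencil_def
  by (intro L2_diff L2_scale op_B_L2 dom_A_continuous dom_A_L2 dom_A_in_L2 [where r = r])

text \<open>Symmetry of \<open>(y, v) \<mapsto> (v, A y + B v)\<close>, applied to \<open>(y, v)\<close> and \<open>(z, w)\<close> in chains at \<open>\<zeta>\<close>
  and \<open>\<eta>\<close>; the primed pairs are their predecessors.\<close>

lemma krein_chain_identity:
  assumes r: "r \<in> L2" and p: "p \<in> L2"
    and dom: "y \<in> dom_A r" "y' \<in> dom_A r" "z \<in> dom_A r" "z' \<in> dom_A r" "v' \<in> dom_A r" "w' \<in> dom_A r"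
    and v: "v = (\<lambda>x. \<zeta> * y x + y' x)" and w: "w = (\<lambda>x. \<eta> * z x + z' x)"
    and y: "op_A r y =\<^sub>a\<^sub>e (\<lambda>x. \<zeta> * v x + v' x - op_B p v x)"
    and z: "op_A r z =\<^sub>a\<^sub>e (\<lambda>x. \<eta> * w x + w' x - op_B p w x)"
  shows "(\<zeta> - cnj \<eta>) * krein r (y, v) (z, w) = krein r (y, v) (z', w') - krein r (y', v') (z, w)"
proof -
  have vD: "v \<in> dom_A r" using dom_A_lincomb(1) [OF dom(2,1), of \<zeta>] by (simp add: v add.commute)
  have wD: "w \<in> dom_A r" using dom_A_lincomb(1) [OF dom(4,3), of \<eta>] by (simp add: w add.commute)
  have Bv: "op_B p v \<in> L2" by (rule op_B_L2 [OF p dom_A_continuous [OF vD]])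
  have Bw: "op_B p w \<in> L2" by (rule op_B_L2 [OF p dom_A_continuous [OF wD]])
  note L = dom [THEN dom_A_in_L2] dom_A_in_L2 [OF vD] dom_A_in_L2 [OF wD] dom [THEN dom_A_L2]
    dom_A_L2 [OF vD] dom_A_L2 [OF wD]
  have Av: "L2_inner (op_A r v) z = \<zeta> * L2_inner (op_A r y) z + L2_inner (op_A r y') z"
  proof -
    have "op_A r v =\<^sub>a\<^sub>e (\<lambda>x. op_A r y' x + \<zeta> * op_A r y x)"
      using dom_A_lincomb(2) [OF dom(2,1), of \<zeta>] by (simp add: v add.commute)
    then have "L2_inner (op_A r v) z = L2_inner (\<lambda>x. op_A r y' x + \<zeta> * op_A r y x) z"
      by (intro L2_inner_ae_cong ae_eq_refl L)
    then show ?thesis using L2_inner_add_left [OF L(10) L2_scale [OF L(9)] L(3)]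
      by (simp add: L2_inner_scale_left)
  qed
  have vw: "L2_inner v (op_A r z) = L2_inner (op_A r v) z" by (rule op_A_symmetric [OF r vD dom(3), symmetric])
  have yw: "L2_inner (op_A r y) w = cnj \<eta> * L2_inner (op_A r y) z + L2_inner (op_A r y) z'"
    unfolding w using L2_inner_add_right [OF L2_scale [OF L(3)] L(4) L(9)] by (simp add: L2_inner_scale_right)
  have 1: "L2_inner (op_A r y) w = \<zeta> * L2_inner v w + L2_inner v' w - L2_inner (op_B p v) w"
  proof -
    have "L2_inner (op_A r y) w = L2_inner (\<lambda>x. \<zeta> * v x + v' x - op_B p v x) w"
      by (intro L2_inner_ae_cong ae_eq_refl L y)
    also have "\<dots> = L2_inner (\<lambda>x. \<zeta> * v x + v' x) w - L2_inner (op_B p v) w"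
      by (rule L2_inner_diff_left [OF L2_add [OF L2_scale [OF L(7)] L(5)] Bv L(8)])
    also have "L2_inner (\<lambda>x. \<zeta> * v x + v' x) w = \<zeta> * L2_inner v w + L2_inner v' w"
      using L2_inner_add_left [OF L2_scale [OF L(7)] L(5) L(8)] by (simp add: L2_inner_scale_left)
    finally show ?thesis .
  qed
  have 2: "L2_inner v (op_A r z) = cnj \<eta> * L2_inner v w + L2_inner v w' - L2_inner v (op_B p w)"
  proof -
    have "L2_inner v (op_A r z) = L2_inner v (\<lambda>x. (\<eta> * w x + w' x) + (-1) * op_B p w x)"
      using z by (intro L2_inner_ae_cong ae_eq_refl L) simp
    also have "\<dots> = L2_inner v (\<lambda>x. \<eta> * w x + w' x) + L2_inner v (\<lambda>x. (-1) * op_B p w x)"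
      by (rule L2_inner_add_right [OF L2_add [OF L2_scale [OF L(8)] L(6)] L2_scale [OF Bw] L(7)])
    also have "L2_inner v (\<lambda>x. \<eta> * w x + w' x) = cnj \<eta> * L2_inner v w + L2_inner v w'"
      using L2_inner_add_right [OF L2_scale [OF L(8)] L(6) L(7)] by (simp add: L2_inner_scale_right)
    finally show ?thesis by (simp only: L2_inner_scale_right) simp
  qed
  have e1: "\<zeta> * L2_inner (op_A r y) z + L2_inner (op_A r y') z = cnj \<eta> * L2_inner v w + L2_inner v w' - L2_inner v (op_B p w)"
    using Av vw 2 by simp
  have e2: "cnj \<eta> * L2_inner (op_A r y) z + L2_inner (op_A r y) z' = \<zeta> * L2_inner v w + L2_inner v' w - L2_inner (op_B p v) w"
    using yw 1 by simp
  show ?thesis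
    unfolding krein_def fst_conv snd_conv using e1 e2 [unfolded op_B_symmetric] by algebra
qed

lemma krein_sum_sum:
  fixes J :: "'i set" and c :: "'i \<Rightarrow> complex"
  assumes "finite J" "\<And>j. j \<in> J \<Longrightarrow> y j \<in> dom_A r" "\<And>j. j \<in> J \<Longrightarrow> v j \<in> dom_A r"
  shows "krein r (\<lambda>x. \<Sum>j\<in>J. c j * y j x, \<lambda>x. \<Sum>j\<in>J. c j * v j x) (\<lambda>x. \<Sum>j\<in>J. c j * y j x, \<lambda>x. \<Sum>j\<in>J. c j * v j x)
    = (\<Sum>i\<in>J. \<Sum>j\<in>J. c i * cnj (c j) * krein r (y i, v i) (y j, v j))"
proof -
  have left: "L2_inner (\<lambda>x. \<Sum>j\<in>I. c j * f j x) g = (\<Sum>j\<in>I. c j * L2_inner (f j) g)"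
    if "finite I" "\<And>j. j \<in> I \<Longrightarrow> f j \<in> L2" "g \<in> L2" for I :: "'i set" and f g
    using that
  proof (induction I rule: finite_induct)
    case empty
    then show ?case by (simp add: L2_inner_def)
  next
    case (insert j I)
    have "(\<lambda>x. c j * f j x) \<in> L2" "(\<lambda>x. \<Sum>i\<in>I. c i * f i x) \<in> L2"
      using insert.prems by (auto intro!: L2_scale L2_sum)
    then show ?case using insert by (simp add: L2_inner_add_left L2_inner_scale_left)
  qed
  have right: "L2_inner g (\<lambda>x. \<Sum>j\<in>I. c j * f j x) = (\<Sum>j\<in>I. cnj (c j) * L2_inner g (f j))"
    if "finite I" "\<And>j. j \<in> I \<Longrightarrow> f j \<in> L2" "g \<in> L2" for I :: "'i set" and f g
    using arg_cong [OF left [OF that], where f = cnj] by (simp add: L2_inner_cnj)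
  let ?Y = "\<lambda>x. \<Sum>j\<in>J. c j * y j x" and ?V = "\<lambda>x. \<Sum>j\<in>J. c j * v j x"
  have Y: "?Y \<in> dom_A r" "op_A r ?Y =\<^sub>a\<^sub>e (\<lambda>x. \<Sum>j\<in>J. c j * op_A r (y j) x)"
    using dom_A_sum [OF assms(1,2), where c = c] by auto
  have V: "?V \<in> dom_A r" using dom_A_sum [OF assms(1,3), where c = c] by auto
  have "L2_inner (op_A r ?Y) ?Y = L2_inner (\<lambda>x. \<Sum>j\<in>J. c j * op_A r (y j) x) ?Y"
    by (intro L2_inner_ae_cong ae_eq_refl dom_A_L2 Y dom_A_in_L2 [OF Y(1)])
  also have "\<dots> = (\<Sum>i\<in>J. \<Sum>j\<in>J. c i * cnj (c j) * L2_inner (op_A r (y i)) (y j))"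
    using assms dom_A_in_L2 [OF Y(1)]
    by (simp add: left right dom_A_L2 dom_A_in_L2 [where r = r] sum_distrib_left mult.assoc)
  finally have 1: "L2_inner (op_A r ?Y) ?Y = \<dots>" .
  have 2: "L2_inner ?V ?V = (\<Sum>i\<in>J. \<Sum>j\<in>J. c i * cnj (c j) * L2_inner (v i) (v j))"
    using assms dom_A_in_L2 [OF V]
    by (simp add: left right dom_A_in_L2 [where r = r] sum_distrib_left mult.assoc)
  show ?thesis
    unfolding krein_def fst_conv snd_conv 1 2 by (simp add: sum.distrib ring_distribs)
qed

text \<open>Neutrality of the span means that the energy of the first component is minus the squared
  norm of the second. The second claim transfers linear relations from the \<open>y j\<close> to the
  \<open>v j\<close> with the same coefficients, the key to all independence proofs below.\<close>

lemma neutral_combination: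
  assumes J: "finite J" "\<And>j. j \<in> J \<Longrightarrow> y j \<in> dom_A r" "\<And>j. j \<in> J \<Longrightarrow> v j \<in> dom_A r"
    and neutral: "\<And>i j. i \<in> J \<Longrightarrow> j \<in> J \<Longrightarrow> krein r (y i, v i) (y j, v j) = 0"
  shows "energy r (\<lambda>x. \<Sum>j\<in>J. c j * y j x) \<le> 0"
    "(\<lambda>x. \<Sum>j\<in>J. c j * y j x) =\<^sub>a\<^sub>e (\<lambda>_. 0) \<Longrightarrow> (\<lambda>x. \<Sum>j\<in>J. c j * v j x) =\<^sub>a\<^sub>e (\<lambda>_. 0)"
proof -
  let ?Y = "\<lambda>x. \<Sum>j\<in>J. c j * y j x" and ?V = "\<lambda>x. \<Sum>j\<in>J. c j * v j x"
  have "krein r (?Y, ?V) (?Y, ?V) = (\<Sum>i\<in>J. \<Sum>j\<in>J. c i * cnj (c j) * krein r (y i, v i) (y j, v j))"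
    by (rule krein_sum_sum) (use J in auto)
  also have "\<dots> = 0" by (intro sum.neutral ballI) (simp add: neutral)
  finally have "krein r (?Y, ?V) (?Y, ?V) = 0" .
  then have k: "L2_inner (op_A r ?Y) ?Y + of_real ((L2_norm ?V)\<^sup>2) = 0"
    by (simp add: krein_def L2_inner_self)
  from arg_cong [OF this, of Re] have e: "energy r ?Y = - (L2_norm ?V)\<^sup>2"
    by (simp add: energy_def flip: of_real_power)
  then show "energy r ?Y \<le> 0" by simp
  assume Y0: "?Y =\<^sub>a\<^sub>e (\<lambda>_. 0)"
  have YD: "?Y \<in> dom_A r" and VD: "?V \<in> dom_A r" using dom_A_sum [OF J(1,2), where c = c] dom_A_sum [OF J(1,3), where c = c] by auto
  have "L2_inner (op_A r ?Y) ?Y = L2_inner (op_A r ?Y) (\<lambda>_. 0)"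
    by (intro L2_inner_ae_cong ae_eq_refl Y0 dom_A_L2 YD dom_A_in_L2 [OF YD])
  then have "energy r ?Y = 0" by (simp add: energy_def L2_inner_def)
  with e have "L2_norm ?V = 0" by simp
  then show "?V =\<^sub>a\<^sub>e (\<lambda>_. 0)" by (intro L2_norm_zero_imp_ae dom_A_in_L2 [OF VD])
qed

lemma ae_eq_sum_zero:
  fixes f g :: "real \<Rightarrow> complex"
  shows "f =\<^sub>a\<^sub>e (\<lambda>_. 0) \<Longrightarrow> g =\<^sub>a\<^sub>e (\<lambda>_. 0) \<Longrightarrow> (\<lambda>x. f x + a * g x) =\<^sub>a\<^sub>e (\<lambda>_. 0)"
  using ae_eq_comp2 [of f "\<lambda>_. 0" g "\<lambda>_. 0" "\<lambda>_ u v. u + a * v"] by simp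

lemma ae_eq_scale_zero:
  fixes f :: "real \<Rightarrow> complex"
  assumes "(\<lambda>x. c * f x) =\<^sub>a\<^sub>e (\<lambda>_. 0)" "\<not> f =\<^sub>a\<^sub>e (\<lambda>_. 0)"
  shows "c = 0"
proof (rule ccontr)
  assume "c \<noteq> 0"
  then have "(\<lambda>x. (1/c) * (c * f x)) = f" by simp
  then show False using ae_eq_comp [OF assms(1), of "\<lambda>_ a. (1/c) * a"] assms(2) by simp
qed

section \<open>Non-real eigenvalues and lengths of chains\<close>

context
  fixes p r :: "real \<Rightarrow> real"
  assumes p: "p \<in> L2" and r: "r \<in> L2"
    and inj: "\<And>y. y \<in> dom_A r \<Longrightarrow> op_A r y =\<^sub>a\<^sub>e (\<lambda>_. 0) \<Longrightarrow> y =\<^sub>a\<^sub>e (\<lambda>_. 0)"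
begin

text \<open>A neutral family forces energy at most 0 on its span, while among \<kappa> + 1 vectors
  some nontrivial combination has positive energy or vanishes; independence excludes the
  latter.\<close>

lemma no_large_neutral_family:
  assumes J: "\<And>j. j \<le> num_neg_eigenvalues r \<Longrightarrow> y j \<in> dom_A r"
      "\<And>j. j \<le> num_neg_eigenvalues r \<Longrightarrow> v j \<in> dom_A r"
    and neutral: "\<And>i j. i \<le> num_neg_eigenvalues r \<Longrightarrow> j \<le> num_neg_eigenvalues r \<Longrightarrow>
      krein r (y i, v i) (y j, v j) = 0"
    and indep: "\<And>c. (\<lambda>x. \<Sum>j\<le>num_neg_eigenvalues r. c j * y j x) =\<^sub>a\<^sub>e (\<lambda>_. 0) \<Longrightarrow>
      \<forall>j\<le>num_neg_eigenvalues r. c j = 0"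
  shows False
proof -
  obtain c where c: "\<exists>j\<le>num_neg_eigenvalues r. c j \<noteq> 0"
    "energy r (\<lambda>x. \<Sum>j\<le>num_neg_eigenvalues r. c j * y j x) \<le> 0 \<Longrightarrow>
      (\<lambda>x. \<Sum>j\<le>num_neg_eigenvalues r. c j * y j x) =\<^sub>a\<^sub>e (\<lambda>_. 0)"
    by (rule energy_nonneg_combination [OF r inj J(1)]) auto
  have "energy r (\<lambda>x. \<Sum>j\<le>num_neg_eigenvalues r. c j * y j x) \<le> 0"
    by (rule neutral_combination(1) [where v = v]) (use J neutral in auto)
  then show False using c indep by blast
qed

lemma pencil_eigenvectorD:
  assumes "pencil_eigenvector p r \<zeta> y"
  shows "y \<in> dom_A r" "\<not> y =\<^sub>a\<^sub>e (\<lambda>_. 0)" "op_A r y =\<^sub>a\<^sub>e (\<lambda>x. \<zeta> * (\<zeta> * y x) - op_B p (\<lambda>x. \<zeta> * y x) x)"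
proof -
  show "y \<in> dom_A r" "\<not> y =\<^sub>a\<^sub>e (\<lambda>_. 0)" using assms by (auto simp: pencil_eigenvector_def)
  have "pencil p r \<zeta> y =\<^sub>a\<^sub>e (\<lambda>_. 0)" using assms by (simp add: pencil_eigenvector_def)
  from ae_eq_comp [OF this, of "\<lambda>x a. \<zeta>\<^sup>2 * y x - \<zeta> * op_B p y x - a"]
  show "op_A r y =\<^sub>a\<^sub>e (\<lambda>x. \<zeta> * (\<zeta> * y x) - op_B p (\<lambda>x. \<zeta> * y x) x)"
    by (simp add: pencil_def op_B_def power2_eq_square mult_ac)
qed

text \<open>For two points of the upper half plane, equal or not, \<zeta> i - cnj (\<zeta> j) has
  positive imaginary part, so the chain identity makes the eigenvectors neutral and mutually
  orthogonal.\<close>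

lemma upper_eigenvalues_card:
  assumes U: "finite U" "\<And>\<zeta>. \<zeta> \<in> U \<Longrightarrow> Im \<zeta> > 0 \<and> pencil_eigenvalue p r \<zeta>"
  shows "card U \<le> num_neg_eigenvalues r"
proof (rule ccontr)
  let ?k = "num_neg_eigenvalues r"
  assume "\<not> card U \<le> ?k"
  then obtain W where W: "W \<subseteq> U" "card W = Suc ?k"
    using obtain_subset_with_card_n [of "Suc ?k" U] by auto
  then have "finite W" using U(1) finite_subset by blast
  from ex_bij_betw_nat_finite [OF this] obtain \<zeta> where \<zeta>: "bij_betw \<zeta> {..?k} W"
    using W(2) by (auto simp: atLeast0LessThan lessThan_Suc_atMost)
  have \<zeta>W: "Im (\<zeta> i) > 0 \<and> pencil_eigenvalue p r (\<zeta> i)" if "i \<le> ?k" for i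
    using \<zeta> that W(1) U(2) by (auto simp: bij_betw_def)
  have \<zeta>_inj: "\<zeta> i \<noteq> \<zeta> j" if "i \<le> ?k" "j \<le> ?k" "i \<noteq> j" for i j
    using \<zeta> that by (auto simp: bij_betw_def inj_on_def)
  have "\<exists>y. i \<le> ?k \<longrightarrow> pencil_eigenvector p r (\<zeta> i) y" for i
    using \<zeta>W by (auto simp: pencil_eigenvalue_def)
  then obtain y where "\<And>i. i \<le> ?k \<Longrightarrow> pencil_eigenvector p r (\<zeta> i) (y i)"
    using choice [of "\<lambda>i y. i \<le> ?k \<longrightarrow> pencil_eigenvector p r (\<zeta> i) y"] by blast
  note y = pencil_eigenvectorD [OF this]
  let ?v = "\<lambda>i x. \<zeta> i * y i x"
  have vD: "?v i \<in> dom_A r" if "i \<le> ?k" for i by (rule dom_A_scale(1) [OF y(1) [OF that]])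
  have neutral: "krein r (y i, ?v i) (y j, ?v j) = 0" if ij: "i \<le> ?k" "j \<le> ?k" for i j
  proof -
    \<comment> \<open>An eigenvector has the zero pair as its predecessor in
      \<open>krein_chain_identity\<close>.\<close>
    have kz: "krein r (f, g) (\<lambda>_. 0, \<lambda>_. 0) = 0" "krein r (\<lambda>_. 0, \<lambda>_. 0) (f, g) = 0"
      if "f \<in> L2" for f g
    proof -
      have "L2_inner (op_A r (\<lambda>_. 0)) f = L2_inner (\<lambda>_. 0) f"
        by (intro L2_inner_ae_cong ae_eq_refl op_A_zero dom_A_L2 zero_in_dom_A that)
      then show "krein r (f, g) (\<lambda>_. 0, \<lambda>_. 0) = 0" "krein r (\<lambda>_. 0, \<lambda>_. 0) (f, g) = 0"
        by (simp_all add: krein_def L2_inner_def)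
    qed
    have "(\<zeta> i - cnj (\<zeta> j)) * krein r (y i, ?v i) (y j, ?v j) =
        krein r (y i, ?v i) (\<lambda>_. 0, \<lambda>_. 0) - krein r (\<lambda>_. 0, \<lambda>_. 0) (y j, ?v j)"
      by (rule krein_chain_identity [OF r p]) (use y ij zero_in_dom_A in auto)
    also have "\<dots> = 0" 
      using kz(1) [OF dom_A_in_L2 [OF y(1) [OF ij(1)]]] kz(2) [OF dom_A_in_L2 [OF y(1) [OF ij(2)]]] by simp
    finally have "(\<zeta> i - cnj (\<zeta> j)) * krein r (y i, ?v i) (y j, ?v j) = 0" .
    moreover have "Im (\<zeta> i - cnj (\<zeta> j)) > 0"
      using \<zeta>W [OF ij(1)] \<zeta>W [OF ij(2)] by simp
    then have "\<zeta> i - cnj (\<zeta> j) \<noteq> 0" by auto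
    ultimately show ?thesis by simp
  qed
  \<comment> \<open>The relation also holds with coefficients \<open>c j * \<zeta> j\<close>, by
    neutrality; subtracting \<zeta> n times the original removes the last term, as for eigenvectors
    of a linear operator.\<close>
  have indep: "\<forall>j<n. c j = 0" if "n \<le> Suc ?k" "(\<lambda>x. \<Sum>j<n. c j * y j x) =\<^sub>a\<^sub>e (\<lambda>_. 0)" for n c
    using that
  proof (induction n arbitrary: c)
    case (Suc n)
    have "(\<lambda>x. \<Sum>j<Suc n. c j * ?v j x) =\<^sub>a\<^sub>e (\<lambda>_. 0)"
      by (rule neutral_combination(2) [where r = r, OF _ _ _ _ Suc.prems(2)]) (use y(1) vD neutral Suc.prems(1) in auto)
    from ae_eq_sum_zero [OF this Suc.prems(2), of "- \<zeta> n"]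
    have "(\<lambda>x. \<Sum>j<n. (c j * (\<zeta> j - \<zeta> n)) * y j x) =\<^sub>a\<^sub>e (\<lambda>_. 0)"
      by (simp add: sum_distrib_left sum.distrib [symmetric] algebra_simps sum_subtractf)
    then have "\<forall>j<n. c j * (\<zeta> j - \<zeta> n) = 0" using Suc.prems(1) by (intro Suc.IH) auto
    then have c0: "\<forall>j<n. c j = 0" using \<zeta>_inj Suc.prems(1) by auto
    then have "(\<lambda>x. c n * y n x) =\<^sub>a\<^sub>e (\<lambda>_. 0)" using Suc.prems(2) by simp
    then have "c n = 0" using ae_eq_scale_zero y(2) Suc.prems(1) by blast
    then show ?case using c0 by (auto simp: less_Suc_eq)
  qed auto
  show False
    by (rule no_large_neutral_family [of y ?v])
      (use y(1) vD neutral indep [of "Suc ?k"] in \<open>auto simp: lessThan_Suc_atMost\<close>)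
qed

text \<open>The chain is shifted by one, so that \<open>Y 0 = 0\<close> precedes the eigenvector; then \<open>V 0 = 0\<close>, because
  \<open>0 - 1 = 0\<close>.\<close>

lemma pencil_chain_equation:
  assumes ch: "pencil_chain p r \<zeta> m ys" and i: "i < m"
  defines "Y \<equiv> \<lambda>j. case j of 0 \<Rightarrow> (\<lambda>_. 0) | Suc k \<Rightarrow> ys k"
  defines "V \<equiv> \<lambda>j x. \<zeta> * Y j x + Y (j - 1) x"
  shows "op_A r (Y (Suc i)) =\<^sub>a\<^sub>e (\<lambda>x. \<zeta> * V (Suc i) x + V i x - op_B p (V (Suc i)) x)"
proof (cases i)
  case 0
  have "pencil_eigenvector p r \<zeta> (ys 0)" using ch by (simp add: pencil_chain_def)
  from pencil_eigenvectorD(3) [OF this] show ?thesis using 0 by (simp add: Y_def V_def)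
next
  case (Suc l)
  have d1: "pencil_deriv 1 p r \<zeta> f x = 2 * \<zeta> * f x - op_B p f x" for f x
  proof -
    have "((\<lambda>z. pencil p r z f x) has_field_derivative 2 * \<zeta> * f x - op_B p f x) (at \<zeta>)" for \<zeta>
      unfolding pencil_def by (auto intro!: derivative_eq_intros)
    then show ?thesis by (simp add: pencil_deriv_def DERIV_imp_deriv)
  qed
  have d1': "deriv (\<lambda>z. pencil p r z f x) = (\<lambda>z. 2 * z * f x - op_B p f x)" for f x
  proof
    fix z
    have "((\<lambda>z. pencil p r z f x) has_field_derivative 2 * z * f x - op_B p f x) (at z)"
      unfolding pencil_def by (auto intro!: derivative_eq_intros)
    then show "deriv (\<lambda>z. pencil p r z f x) z = 2 * z * f x - op_B p f x" by (rule DERIV_imp_deriv)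
  qed
  have d2': "deriv (\<lambda>z. 2 * z * a - b) = (\<lambda>_. 2 * a)" for a b :: complex
    by (rule ext, rule DERIV_imp_deriv) (auto intro!: derivative_eq_intros)
  have d3: "(deriv ^^ n) (\<lambda>_. a) = (\<lambda>_. if n = 0 then a else 0)" for n and a :: complex
    by (induction n) auto
  have pd: "pencil_deriv k p r \<zeta> f x = (if k = 0 then pencil p r \<zeta> f x else if k = 1 then 2 * \<zeta> * f x - op_B p f x
      else if k = 2 then 2 * f x else 0)" for k f x
  proof -
    consider "k = 0" | "k = 1" | n where "k = Suc (Suc n)" by (metis One_nat_def not0_implies_Suc)
    then show ?thesis
    proof cases
      case 3
      have "(deriv ^^ k) (\<lambda>z. pencil p r z f x) = (deriv ^^ n) (deriv (deriv (\<lambda>z. pencil p r z f x)))"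
        unfolding 3 by (simp only: funpow_Suc_right o_apply)
      also have "\<dots> = (\<lambda>_. if n = 0 then 2 * f x else 0)" by (simp only: d1' d2' d3)
      finally show ?thesis using 3 by (simp add: pencil_deriv_def)
    qed (simp_all add: pencil_deriv_def d1')
  qed
  have "(\<lambda>x. \<Sum>k=0..i. 1 / fact k * pencil_deriv k p r \<zeta> (ys (i - k)) x) =\<^sub>a\<^sub>e (\<lambda>_. 0)"
    using ch i Suc unfolding pencil_chain_def by (elim conjE bspec) simp
  moreover have "(\<Sum>k=0..i. 1 / fact k * pencil_deriv k p r \<zeta> (ys (i - k)) x) =
     pencil p r \<zeta> (ys i) x + (2 * \<zeta> * ys l x - op_B p (ys l) x) + Y l x" for x
  proof -
    let ?t = "\<lambda>k. 1 / fact k * pencil_deriv k p r \<zeta> (ys (i - k)) x"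
    \<comment> \<open>The pencil is quadratic in \<zeta>, so only k \<le> 2 contributes. For i = 1
      the term k = 2 is absent, in agreement with \<open>Y 0 = 0\<close>.\<close>
    have "(\<Sum>k=0..i. ?t k) = (\<Sum>k\<in>{0, 1} \<union> (if l = 0 then {} else {2}). ?t k)"
      by (rule sum.mono_neutral_right) (use Suc in \<open>auto simp: pd\<close>)
    also have "\<dots> = ?t 0 + ?t 1 + (if l = 0 then 0 else ?t 2)" by auto
    also have "\<dots> = pencil p r \<zeta> (ys i) x + (2 * \<zeta> * ys l x - op_B p (ys l) x) + Y l x"
      using Suc by (cases l) (simp_all add: pd Y_def)
    finally show ?thesis .
  qed
  ultimately have "(\<lambda>x. pencil p r \<zeta> (ys i) x + (2 * \<zeta> * ys l x - op_B p (ys l) x) + Y l x) =\<^sub>a\<^sub>e (\<lambda>_. 0)"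
    by simp
  from ae_eq_comp [OF this, of "\<lambda>x a. op_A r (ys i) x + a"]
  have "(\<lambda>x. \<zeta>\<^sup>2 * ys i x - \<zeta> * op_B p (ys i) x + (2 * \<zeta> * ys l x - op_B p (ys l) x) + Y l x) =\<^sub>a\<^sub>e op_A r (ys i)"
    by (simp add: pencil_def algebra_simps)
  from ae_eq_sym [OF this]
  have "op_A r (ys i) =\<^sub>a\<^sub>e (\<lambda>x. \<zeta>\<^sup>2 * ys i x - \<zeta> * op_B p (ys i) x + (2 * \<zeta> * ys l x - op_B p (ys l) x) + Y l x)" .
  moreover have "(\<lambda>x. \<zeta>\<^sup>2 * ys i x - \<zeta> * op_B p (ys i) x + (2 * \<zeta> * ys l x - op_B p (ys l) x) + Y l x) =
      (\<lambda>x. \<zeta> * V (Suc i) x + V i x - op_B p (V (Suc i)) x)"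
    using Suc by (simp add: V_def Y_def op_B_def algebra_simps power2_eq_square)
  ultimately show ?thesis by (simp add: Y_def)
qed

text \<open>All pairs with i + j \<le> m are orthogonal for the indefinite form. With m \<ge> 2
  \<kappa> + 2 this makes the pairs with indices 1 to \<kappa> + 1 a neutral family, one more than
  is possible.\<close>

lemma pencil_chain_length_le:
  assumes ch: "pencil_chain p r \<zeta> m ys"
  shows "m \<le> 2 * num_neg_eigenvalues r + 1"
proof (rule ccontr)
  let ?k = "num_neg_eigenvalues r"
  assume "\<not> m \<le> 2 * ?k + 1"
  then have m: "2 * ?k + 2 \<le> m" by simp
  define Y where "Y = (\<lambda>j. case j of 0 \<Rightarrow> (\<lambda>_. 0) | Suc k \<Rightarrow> ys k)"
  define V where "V = (\<lambda>j x. \<zeta> * Y j x + Y (j - 1) x)"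
  have YD: "Y j \<in> dom_A r" if "j \<le> m" for j
    using ch that zero_in_dom_A by (cases j) (auto simp: Y_def pencil_chain_def)
  have VD: "V j \<in> dom_A r" if "j \<le> m" for j
    using dom_A_lincomb(1) [OF YD [of "j - 1"] YD [OF that], of \<zeta>] that by (simp add: V_def add.commute)
  have eq: "op_A r (Y (Suc i)) =\<^sub>a\<^sub>e (\<lambda>x. \<zeta> * V (Suc i) x + V i x - op_B p (V (Suc i)) x)" if "i < m" for i
    using pencil_chain_equation [OF ch that] by (simp add: Y_def V_def)
  have VS: "V (Suc i) = (\<lambda>x. \<zeta> * Y (Suc i) x + Y i x)" for i by (simp add: V_def)
  define g where "g i j = krein r (Y i, V i) (Y j, V j)" for i j
  have step: "(\<zeta> - cnj \<zeta>) * g (Suc i) (Suc j) = g (Suc i) j - g i (Suc j)" if "i < m" "j < m" for i j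
    unfolding g_def
    by (rule krein_chain_identity [OF r p YD YD YD YD VD VD VS VS eq eq]) (use that in auto)
  have V0: "V 0 = (\<lambda>_. 0)" "Y 0 = (\<lambda>_. 0)" by (auto simp: V_def Y_def)
  have g0: "g 0 j = 0" "g j 0 = 0" if "j \<le> m" for j
  proof -
    have "L2_inner (op_A r (\<lambda>_. 0)) (Y j) = L2_inner (\<lambda>_. 0) (Y j)"
      by (intro L2_inner_ae_cong ae_eq_refl op_A_zero dom_A_L2 zero_in_dom_A dom_A_in_L2 [OF YD [OF that]])
    then show "g 0 j = 0" "g j 0 = 0" by (simp_all add: g_def krein_def V0 L2_inner_def)
  qed
  \<comment> \<open>For real \<zeta> the identity reads \<open>g (Suc i) j = g i (Suc j)\<close>, so
    values are constant along i + j and reach an index 0. Otherwise the factor \<zeta> - cnj \<zeta>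
    can be divided out, which reduces i + j by one.\<close>
  have neutral: "g i j = 0" if ij: "i + j \<le> m" for i j
  proof (cases "\<zeta> = cnj \<zeta>")
    case True
    show ?thesis using ij
    proof (induction j arbitrary: i)
      case (Suc j)
      have "g i (Suc j) = g (Suc i) j" using step [of i j] True Suc.prems by simp
      then show ?case using Suc.IH [of "Suc i"] Suc.prems by simp
    qed (use g0 in auto)
  next
    case False
    show ?thesis using ij
    proof (induction "i + j" arbitrary: i j rule: less_induct)
      case less
      show ?case
      proof (cases "i = 0 \<or> j = 0")
        case True
        then show ?thesis using g0 less.prems by auto
      next
        case False
        then obtain a b where ab: "i = Suc a" "j = Suc b" by (metis not0_implies_Suc)
        then have "g (Suc a) b = 0" "g a (Suc b) = 0" using less by auto
        then have "(\<zeta> - cnj \<zeta>) * g i j = 0" using step [of a b] ab less.prems by simp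
        then show ?thesis using \<open>\<zeta> \<noteq> cnj \<zeta>\<close> by simp
      qed
    qed
  qed
  \<comment> \<open>By neutrality a relation among the \<open>Y (Suc j)\<close> holds for the
    \<open>V (Suc j)\<close> too, and \<open>V (Suc j) - \<zeta> Y (Suc j) = Y j\<close> lowers
    every index by one. The term with \<open>Y 0 = 0\<close> drops out, so the coefficients move
    down one place.\<close>
  have indep: "\<forall>j<n. c j = 0" if "n \<le> Suc ?k" "(\<lambda>x. \<Sum>j<n. c j * Y (Suc j) x) =\<^sub>a\<^sub>e (\<lambda>_. 0)" for n c
    using that
  proof (induction n arbitrary: c)
    case (Suc n)
    have "(\<lambda>x. \<Sum>j<Suc n. c j * V (Suc j) x) =\<^sub>a\<^sub>e (\<lambda>_. 0)"
    proof (rule neutral_combination(2) [where r = r, OF _ _ _ _ Suc.prems(2)])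
      show "krein r (Y (Suc i), V (Suc i)) (Y (Suc j), V (Suc j)) = 0" if "i \<in> {..<Suc n}" "j \<in> {..<Suc n}" for i j
        using neutral [of "Suc i" "Suc j"] that Suc.prems(1) m by (simp add: g_def)
    qed (use YD VD Suc.prems(1) m in auto)
    from ae_eq_sum_zero [OF this Suc.prems(2), of "- \<zeta>"]
    have "(\<lambda>x. \<Sum>j<Suc n. c j * Y j x) =\<^sub>a\<^sub>e (\<lambda>_. 0)"
      by (simp add: V_def sum_distrib_left sum.distrib [symmetric] algebra_simps)
    moreover have "(\<Sum>j<Suc n. c j * Y j x) = (\<Sum>j<n. c (Suc j) * Y (Suc j) x)" for x
      by (subst sum.lessThan_Suc_shift) (simp add: V0)
    ultimately have "(\<lambda>x. \<Sum>j<n. c (Suc j) * Y (Suc j) x) =\<^sub>a\<^sub>e (\<lambda>_. 0)" by simp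
    from Suc.IH [OF _ this] have c0: "\<forall>j<n. c (Suc j) = 0" using Suc.prems(1) by simp
    have "(\<Sum>j<Suc n. c j * Y (Suc j) x) = c 0 * Y (Suc 0) x" for x
      by (subst sum.lessThan_Suc_shift) (use c0 in simp)
    then have "(\<lambda>x. c 0 * Y (Suc 0) x) =\<^sub>a\<^sub>e (\<lambda>_. 0)" using Suc.prems(2) by simp
    moreover have "\<not> Y (Suc 0) =\<^sub>a\<^sub>e (\<lambda>_. 0)"
      using ch by (simp add: Y_def pencil_chain_def pencil_eigenvector_def)
    ultimately have "c 0 = 0" by (rule ae_eq_scale_zero)
    show ?case
    proof (intro allI impI)
      fix j assume "j < Suc n"
      then show "c j = 0" using \<open>c 0 = 0\<close> c0 by (cases j) auto
    qed
  qed auto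
  show False
  proof (rule no_large_neutral_family [of "\<lambda>j. Y (Suc j)" "\<lambda>j. V (Suc j)"])
    show "krein r (Y (Suc i), V (Suc i)) (Y (Suc j), V (Suc j)) = 0" if "i \<le> ?k" "j \<le> ?k" for i j
      using neutral [of "Suc i" "Suc j"] that m by (simp add: g_def)
  qed (use YD VD m indep [of "Suc ?k"] in \<open>auto simp: lessThan_Suc_atMost less_Suc_eq_le\<close>)
qed

end

section \<open>Spectrum and eigenvalues of the pencil\<close>

lemma pencil_ae_iff:
  "pencil p r \<zeta> y =\<^sub>a\<^sub>e f \<longleftrightarrow> op_A r y =\<^sub>a\<^sub>e (\<lambda>x. - f x - (2 * \<zeta> * of_real (p x) - \<zeta>\<^sup>2) * y x)"
proof
  assume "pencil p r \<zeta> y =\<^sub>a\<^sub>e f"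
  from ae_eq_comp [OF this, of "\<lambda>x a. - a - (2 * \<zeta> * of_real (p x) - \<zeta>\<^sup>2) * y x"]
  show "op_A r y =\<^sub>a\<^sub>e (\<lambda>x. - f x - (2 * \<zeta> * of_real (p x) - \<zeta>\<^sup>2) * y x)"
    by (simp add: pencil_def op_B_def algebra_simps)
next
  assume "op_A r y =\<^sub>a\<^sub>e (\<lambda>x. - f x - (2 * \<zeta> * of_real (p x) - \<zeta>\<^sup>2) * y x)"
  from ae_eq_comp [OF this, of "\<lambda>x a. - a - (2 * \<zeta> * of_real (p x) - \<zeta>\<^sup>2) * y x"]
  show "pencil p r \<zeta> y =\<^sub>a\<^sub>e f"
    by (simp add: pencil_def op_B_def algebra_simps)
qed

text \<open>If \<zeta> is not an eigenvalue, the equation for \<open>A\<close> with potential 2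
  \<zeta> p - \<zeta>^2 is injective, and \<open>resolvent\<close> supplies solvability and a sup
  bound, which on an interval of length 1 dominates the L_2 norm.\<close>

lemma pencil_spectrum_imp_eigenvalue:
  assumes p: "p \<in> L2" and r: "r \<in> L2" and spec: "\<zeta> \<in> pencil_spectrum p r"
  shows "pencil_eigenvalue p r \<zeta>"
proof (rule ccontr)
  assume no: "\<not> pencil_eigenvalue p r \<zeta>"
  define Q where "Q x = 2 * \<zeta> * of_real (p x) - \<zeta>\<^sup>2" for x
  have QL: "Q \<in> L2"
    unfolding Q_def [abs_def] by (intro L2_diff L2_scale L2_of_real p continuous_imp_L2 continuous_intros)
  have inj: "y =\<^sub>a\<^sub>e (\<lambda>_. 0)" if "y \<in> dom_A r" "op_A r y =\<^sub>a\<^sub>e (\<lambda>x. - (Q x * y x))" for y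
    using no that pencil_ae_iff [of p r \<zeta> y "\<lambda>_. 0"]
    by (auto simp: Q_def pencil_eigenvalue_def pencil_eigenvector_def)
  obtain C where C: "C > 0" "\<And>f. f \<in> L2 \<Longrightarrow> \<exists>y\<in>dom_A r. op_A r y =\<^sub>a\<^sub>e (\<lambda>x. f x - Q x * y x)"
    "\<And>y f x. y \<in> dom_A r \<Longrightarrow> f \<in> L2 \<Longrightarrow> op_A r y =\<^sub>a\<^sub>e (\<lambda>x. f x - Q x * y x) \<Longrightarrow> x \<in> {0..1} \<Longrightarrow>
      norm (y x) \<le> C * L2_norm f \<and> norm (quasi_deriv r y x) \<le> C * L2_norm f"
    by (rule resolvent [OF r QL inj]) auto
  have "boundedly_invertible (dom_A r) (pencil p r \<zeta>)"
    unfolding boundedly_invertible_def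
  proof (intro conjI ballI exI)
    fix f :: "real \<Rightarrow> complex" assume f: "f \<in> L2"
    then have "(\<lambda>x. - f x) \<in> L2" using L2_scale [of f "-1"] by simp
    then obtain y where y: "y \<in> dom_A r" "op_A r y =\<^sub>a\<^sub>e (\<lambda>x. - f x - Q x * y x)" using C(2) by blast
    show "\<exists>y\<in>dom_A r. pencil p r \<zeta> y =\<^sub>a\<^sub>e f \<and> (\<forall>z\<in>dom_A r. pencil p r \<zeta> z =\<^sub>a\<^sub>e f \<longrightarrow> z =\<^sub>a\<^sub>e y)"
    proof (intro bexI [of _ y] conjI ballI impI)
      show "pencil p r \<zeta> y =\<^sub>a\<^sub>e f" using y(2) by (simp add: pencil_ae_iff Q_def)
      fix z assume z: "z \<in> dom_A r" "pencil p r \<zeta> z =\<^sub>a\<^sub>e f"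
      then have Az: "op_A r z =\<^sub>a\<^sub>e (\<lambda>x. - f x - Q x * z x)" by (simp add: pencil_ae_iff Q_def)
      let ?w = "\<lambda>x. z x + (-1) * y x"
      have "(\<lambda>x. op_A r z x + (-1) * op_A r y x) =\<^sub>a\<^sub>e (\<lambda>x. (- f x - Q x * z x) + (-1) * (- f x - Q x * y x))"
        by (rule ae_eq_comp2 [OF Az y(2), where h = "\<lambda>_ a b. a + (-1) * b"])
      also have "(\<lambda>x. (- f x - Q x * z x) + (-1) * (- f x - Q x * y x)) = (\<lambda>x. - (Q x * ?w x))"
        by (simp add: algebra_simps)
      finally have "op_A r ?w =\<^sub>a\<^sub>e (\<lambda>x. - (Q x * ?w x))"
        by (rule ae_eq_trans [OF dom_A_lincomb(2) [OF z(1) y(1)]])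
      from inj [OF dom_A_lincomb(1) [OF z(1) y(1)] this]
      have "?w =\<^sub>a\<^sub>e (\<lambda>_. 0)" .
      from ae_eq_comp [OF this, of "\<lambda>x a. a + y x"] show "z =\<^sub>a\<^sub>e y" by simp
    qed (rule y(1))
  next
    fix y assume y: "y \<in> dom_A r"
    have L: "(\<lambda>x. - pencil p r \<zeta> y x) \<in> L2" using L2_scale [OF pencil_L2 [OF p y], of "-1"] by simp
    have "op_A r y =\<^sub>a\<^sub>e (\<lambda>x. - pencil p r \<zeta> y x - Q x * y x)"
      using pencil_ae_iff [of p r \<zeta> y "pencil p r \<zeta> y"] by (simp add: ae_eq_refl Q_def)
    from C(3) [OF y L this] have "L2_norm y \<le> C * L2_norm (\<lambda>x. - pencil p r \<zeta> y x)"
      by (intro L2_norm_le_sup dom_A_continuous [OF y]) blast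
    then show "L2_norm y \<le> C * L2_norm (pencil p r \<zeta> y)" by (simp add: L2_norm_def)
  qed
  with spec show False by (simp add: pencil_spectrum_def op_spectrum_def)
qed

text \<open>T(0) = -A, so regularity of the pencil at 0 is invertibility of
  \<open>A\<close>.\<close>

lemma zero_resolvent_imp_injective:
  assumes "0 \<notin> pencil_spectrum p r" and y: "y \<in> dom_A r" "op_A r y =\<^sub>a\<^sub>e (\<lambda>_. 0)"
  shows "y =\<^sub>a\<^sub>e (\<lambda>_. 0)"
proof -
  have b: "boundedly_invertible (dom_A r) (pencil p r 0)"
    using assms(1) by (simp add: pencil_spectrum_def op_spectrum_def)
  have "(\<lambda>_. 0) \<in> (L2 :: (real \<Rightarrow> complex) set)" by (rule continuous_imp_L2) auto
  with b obtain z where z: "\<And>w. w \<in> dom_A r \<Longrightarrow> pencil p r 0 w =\<^sub>a\<^sub>e (\<lambda>_. 0) \<Longrightarrow> w =\<^sub>a\<^sub>e z"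
    unfolding boundedly_invertible_def by blast
  have "y =\<^sub>a\<^sub>e z" using y by (intro z) (simp_all add: pencil_ae_iff)
  moreover have "(\<lambda>_. 0) =\<^sub>a\<^sub>e z" using op_A_zero zero_in_dom_A by (intro z) (simp_all add: pencil_ae_iff)
  ultimately show ?thesis using ae_eq_sym ae_eq_trans by blast
qed

text \<open>Since \<open>p\<close> and \<open>r\<close> are real, conjugating an eigenvector at
  \<zeta> gives one at \<open>cnj \<zeta>\<close>.\<close>

lemma pencil_eigenvalue_cnj:
  assumes "pencil_eigenvalue p r \<zeta>"
  shows "pencil_eigenvalue p r (cnj \<zeta>)"
proof -
  obtain y where y: "y \<in> dom_A r" "\<not> y =\<^sub>a\<^sub>e (\<lambda>_. 0)" "pencil p r \<zeta> y =\<^sub>a\<^sub>e (\<lambda>_. 0)"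
    using assms by (auto simp: pencil_eigenvalue_def pencil_eigenvector_def)
  let ?z = "\<lambda>x. cnj (y x)"
  have "\<not> ?z =\<^sub>a\<^sub>e (\<lambda>_. 0)" using y(2) by (simp add: ae_eq_def)
  moreover from ae_eq_trans [OF dom_A_cnj(2) [OF y(1)]
      ae_eq_comp [OF y(3) [unfolded pencil_ae_iff], of "\<lambda>_ a. cnj a"]]
  have "pencil p r (cnj \<zeta>) ?z =\<^sub>a\<^sub>e (\<lambda>_. 0)" by (simp add: pencil_ae_iff)
  ultimately show ?thesis
    using dom_A_cnj(1) [OF y(1)] unfolding pencil_eigenvalue_def pencil_eigenvector_def by blast
qed

lemma op_positive_num_neg_eigenvalues:
  assumes "op_positive (dom_A r) (op_A r)"
  shows "num_neg_eigenvalues r = 0"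
proof -
  have "\<not> op_eigenvalue (dom_A r) (op_A r) (of_real \<mu>)" if "\<mu> < 0" for \<mu>
  proof
    assume "op_eigenvalue (dom_A r) (op_A r) (of_real \<mu>)"
    then obtain y where y: "y \<in> dom_A r" "\<not> y =\<^sub>a\<^sub>e (\<lambda>_. 0)" "op_A r y =\<^sub>a\<^sub>e (\<lambda>x. of_real \<mu> * y x)"
      by (auto simp: op_eigenvalue_def)
    have "L2_inner (op_A r y) y = of_real (\<mu> * (L2_norm y)\<^sup>2)"
      using L2_inner_ae_cong [OF y(3) ae_eq_refl dom_A_L2 [OF y(1)] dom_A_in_L2 [OF y(1)]]
      by (simp add: L2_inner_scale_left L2_inner_self)
    then have "Re (L2_inner (op_A r y) y) = \<mu> * (L2_norm y)\<^sup>2" by (metis Re_complex_of_real)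
    then have "Re (L2_inner (op_A r y) y) \<le> 0" using that by (simp add: mult_nonpos_nonneg)
    moreover have "0 < Re (L2_inner (op_A r y) y)" using assms y by (auto simp: op_positive_def)
    ultimately show False by simp
  qed
  then have "{\<mu>::real. \<mu> < 0 \<and> op_eigenvalue (dom_A r) (op_A r) (of_real \<mu>)} = {}" by blast
  then show ?thesis unfolding num_neg_eigenvalues_def by (simp only: card.empty)
qed

theorem theorem4p7:
  fixes p r :: "real \<Rightarrow> real" and \<kappa> :: nat
  assumes "p \<in> L2" and "r \<in> L2"
    and "0 \<notin> pencil_spectrum p r"
    and "\<kappa> = num_neg_eigenvalues r"
  shows
    "((\<forall>\<zeta>\<in>pencil_spectrum p r - \<real>. pencil_eigenvalue p r \<zeta> \<and> pencil_eigenvalue p r (cnj \<zeta>)) \<and>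
      finite {{\<zeta>, cnj \<zeta>} | \<zeta>. \<zeta> \<in> pencil_spectrum p r - \<real>} \<and>
      card {{\<zeta>, cnj \<zeta>} | \<zeta>. \<zeta> \<in> pencil_spectrum p r - \<real>} \<le> \<kappa>) \<and>
     (\<forall>\<zeta>. pencil_eigenvalue p r \<zeta> \<longrightarrow> alg_mult p r \<zeta> \<le> enat (2 * \<kappa> + 1)) \<and>
     (op_positive (dom_A r) (op_A r) \<longrightarrow>
        pencil_spectrum p r \<subseteq> \<real> \<and> pencil_spectrum_simple p r)"
proof -
  note p = assms(1) and r = assms(2) and \<kappa> = assms(4)
  have inj: "y =\<^sub>a\<^sub>e (\<lambda>_. 0)" if "y \<in> dom_A r" "op_A r y =\<^sub>a\<^sub>e (\<lambda>_. 0)" for y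
    by (rule zero_resolvent_imp_injective [OF assms(3) that])
  have eig: "pencil_eigenvalue p r \<zeta>" if "\<zeta> \<in> pencil_spectrum p r" for \<zeta>
    by (rule pencil_spectrum_imp_eigenvalue [OF p r that])
  define P where "P = {{\<zeta>, cnj \<zeta>} | \<zeta>. \<zeta> \<in> pencil_spectrum p r - \<real>}"
  define U where "U = {\<zeta>. Im \<zeta> > 0 \<and> pencil_eigenvalue p r \<zeta>}"
  have cardU: "card W \<le> \<kappa>" if "finite W" "W \<subseteq> U" for W
    unfolding \<kappa> by (rule upper_eigenvalues_card [OF p r inj that(1)]) (use that(2) in \<open>auto simp: U_def\<close>)
  \<comment> \<open>The bound for all finite subsets excludes an infinite \<open>U\<close>, which
    would contain a subset with \<kappa> + 1 elements.\<close>
  have finU: "finite U"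
  proof (rule ccontr)
    assume "infinite U"
    then obtain W where "W \<subseteq> U" "finite W" "card W = Suc \<kappa>" using infinite_arbitrarily_large by blast
    then show False using cardU by fastforce
  qed
  \<comment> \<open>Each pair has a member in the upper half plane; if that is the conjugate of the
    given spectral point, it is an eigenvalue by \<open>pencil_eigenvalue_cnj\<close>.\<close>
  have PU: "P \<subseteq> (\<lambda>\<zeta>. {\<zeta>, cnj \<zeta>}) ` U"
  proof
    fix X assume "X \<in> P"
    then obtain \<zeta> where \<zeta>: "\<zeta> \<in> pencil_spectrum p r" "\<zeta> \<notin> \<real>" "X = {\<zeta>, cnj \<zeta>}" by (auto simp: P_def)
    then have "Im \<zeta> \<noteq> 0" by (auto simp: complex_is_Real_iff)
    then consider "Im \<zeta> > 0" | "Im (cnj \<zeta>) > 0" by fastforce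
    then show "X \<in> (\<lambda>\<zeta>. {\<zeta>, cnj \<zeta>}) ` U"
    proof cases
      case 1
      then show ?thesis using \<zeta> eig by (auto simp: U_def)
    next
      case 2
      then have "cnj \<zeta> \<in> U" using pencil_eigenvalue_cnj [OF eig [OF \<zeta>(1)]] by (simp add: U_def)
      moreover have "X = {cnj \<zeta>, cnj (cnj \<zeta>)}" using \<zeta>(3) by auto
      ultimately show ?thesis by (intro image_eqI)
    qed
  qed
  have finP: "finite P" by (rule finite_subset [OF PU finite_imageI [OF finU]])
  have cardP: "card P \<le> \<kappa>"
    using card_mono [OF finite_imageI [OF finU] PU] card_image_le [OF finU, of "\<lambda>\<zeta>. {\<zeta>, cnj \<zeta>}"] cardU [OF finU order_refl]
    by linarith
  have mult: "alg_mult p r \<zeta> \<le> enat (2 * \<kappa> + 1)" for \<zeta>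
    unfolding alg_mult_def
  proof (rule Sup_least)
    fix m assume "m \<in> {enat m | m. \<exists>ys. pencil_chain p r \<zeta> m ys}"
    then obtain n ys where "m = enat n" "pencil_chain p r \<zeta> n ys" by blast
    then show "m \<le> enat (2 * \<kappa> + 1)" using pencil_chain_length_le [OF p r inj] \<kappa> by simp
  qed
  have "pencil_spectrum p r \<subseteq> \<real> \<and> pencil_spectrum_simple p r" if "op_positive (dom_A r) (op_A r)"
  proof -
    have \<kappa>0: "\<kappa> = 0" using op_positive_num_neg_eigenvalues [OF that] \<kappa> by simp
    \<comment> \<open>Finiteness is essential here, as \<open>card\<close> is 0 on infinite sets
      too.\<close>
    then have "P = {}" using cardP finP by simp
    then have "pencil_spectrum p r \<subseteq> \<real>" by (auto simp: P_def)
    moreover have "alg_mult p r \<zeta> = 1" if \<zeta>: "pencil_eigenvalue p r \<zeta>" for \<zeta>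
    proof (rule antisym)
      show "alg_mult p r \<zeta> \<le> 1" using mult [of \<zeta>] \<kappa>0 by (simp add: one_enat_def)
      obtain y where "pencil_eigenvector p r \<zeta> y" using \<zeta> by (auto simp: pencil_eigenvalue_def)
      then have "pencil_chain p r \<zeta> 1 (\<lambda>_. y)"
        by (auto simp: pencil_chain_def pencil_eigenvector_def)
      then show "1 \<le> alg_mult p r \<zeta>"
        unfolding alg_mult_def one_enat_def by (intro Sup_upper) blast
    qed
    ultimately show ?thesis using eig by (auto simp: pencil_spectrum_simple_def)
  qed
  then show ?thesis
    using eig pencil_eigenvalue_cnj finP cardP mult unfolding P_def by auto
qed

end
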